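(* Let $\nu>0$. Let $\alpha,\beta,\delta\in\mathbb{R}$ and $s_-,s_+\in\mathbb{C}$ satisfy $\alpha+2<\Re(s_-)<0<\Re(s_+)<\beta-2$ and $\delta>0$. Let $f$ be a meromorphic function on $D=\{s\in\mathbb{C}\mid \Re(s)\in(\alpha-\delta,\beta+\delta)\}$ satisfying $f(s)=O(e^{r|s|})$ as $s\to\infty$, $s\in D$, for some $r<\frac{\pi}{2}$. Assume that $f$ has one or two poles in $D$, that every pole of $f$ in $D$ belongs to $\{s_-,s_+\}$, and that each pole is simple. Then the MP-expansion $\sum_{n=0}^{\infty}a_n q_n^{(\nu,0)}(it)$ of $f(it)$ converges to $f(it)$ uniformly on every compact subset of the strip $$E(f)=\left\{t\in\mathbb{C}\;:\;|\Im(t)|<\min\{|\Re s_+|,|\Re s_-|\}\right\}.$$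
   Context: For $\nu>0$ and an integer $n\ge 0$, the Meixner-Pollaczek polynomial (with $\theta=0$) is $q_n^{(\nu,0)}(s)=\frac{(\nu)_n}{n!}\,{}_2F_1\left(-n,\,s+\frac{\nu}{2};\,\nu;\,2\right)$, where $(\nu)_n=\nu(\nu+1)\cdots(\nu+n-1)$. Put $M_\nu(dt)=\frac{1}{2\pi}\frac{2^\nu}{\Gamma(\nu)}\left|\Gamma\left(it+\frac{\nu}{2}\right)\right|^2dt$ on $\mathbb{R}$. The functions $t\mapsto q_n^{(\nu,0)}(it)$, $n\ge0$, form an orthogonal basis of $L^2(\mathbb{R},M_\nu(dt))$ with squared norms $\frac{(\nu)_n}{n!}$. For $f(it)\in L^2(\mathbb{R},M_\nu(dt))$, its MP-expansion is $f(it)=\sum_{n\ge0}a_nq_n^{(\nu,0)}(it)$ in this Hilbert space, with MP-coefficients $a_n=\frac{n!}{(\nu)_n}\int_{\mathbb{R}}f(it)\overline{q_n^{(\nu,0)}(it)}\,M_\nu(dt)$. *)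

theory Defs
  imports "HOL-Complex_Analysis.Complex_Analysis" "HOL-Library.Landau_Symbols"
begin

definition hyp2F1 :: "complex \<Rightarrow> complex \<Rightarrow> complex \<Rightarrow> complex \<Rightarrow> complex" where
  "hyp2F1 a b c z = eval_fps (fps_hypergeo [a, b] [c] 1) z"

definition MP_poly :: "real \<Rightarrow> nat \<Rightarrow> complex \<Rightarrow> complex" where
  "MP_poly \<nu> n s =
     of_real (pochhammer \<nu> n / fact n) * hyp2F1 (- of_nat n) (s + of_real \<nu> / 2) (of_real \<nu>) 2"

text \<open>The series terminates, so the argument 2 outside the unit disc causes no
  convergence problem.\<close>

lemma MP_poly_eq_finite_sum:
  "MP_poly \<nu> n s = of_real (pochhammer \<nu> n / fact n) *
     (\<Sum>k\<le>n. pochhammer (- of_nat n) k * pochhammer (s + of_real \<nu> / 2) k /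
              (pochhammer (of_real \<nu>) k * fact k) * 2 ^ k)"
proof -
  have z: "pochhammer (- of_nat n :: complex) k = 0" if "k > n" for k
    using that by (simp add: pochhammer_of_nat_eq_0_lemma)
  show ?thesis
    unfolding MP_poly_def hyp2F1_def eval_fps_def
    by (subst suminf_finite[of "{..n}"]) (auto simp: z not_le mult_ac)
qed

definition MP_measure :: "real \<Rightarrow> real measure" where
  "MP_measure \<nu> = density lborel (\<lambda>t. ennreal
     (1 / (2 * pi) * (2 powr \<nu> / Gamma \<nu>) *
      (norm (Gamma (\<i> * of_real t + of_real \<nu> / 2 :: complex)))\<^sup>2))"

definition MP_L2 :: "real \<Rightarrow> (real \<Rightarrow> complex) \<Rightarrow> bool" where
  "MP_L2 \<nu> g \<longleftrightarrow> g \<in> borel_measurable (MP_measure \<nu>) \<and>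
     integrable (MP_measure \<nu>) (\<lambda>t. (norm (g t))\<^sup>2)"

text \<open>The coefficients of the function \<open>t \<mapsto> f (it)\<close>; they are meaningful when this function
  satisfies \<^const>\<open>MP_L2\<close> (the Bochner integral is 0 for non-integrable integrands).\<close>

definition MP_coeff :: "real \<Rightarrow> (complex \<Rightarrow> complex) \<Rightarrow> nat \<Rightarrow> complex" where
  "MP_coeff \<nu> f n = of_real (fact n / pochhammer \<nu> n) *
     (\<integral>t. f (\<i> * of_real t) * cnj (MP_poly \<nu> n (\<i> * of_real t)) \<partial>MP_measure \<nu>)"

end

theory Submission
  imports Defs "HOL-Probability.Characteristic_Functions"
begin

text \<open>
  Put \<open>h\<^sub>n = (\<nu>)\<^sub>n / n!\<close>, \<open>g\<^sub>n(y) = (2 cosh (y/2))\<^bsup>-\<nu>\<^esup> (- tanh (y/2))\<^sup>n\<close> and let \<open>m\<close> be the minimum of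
  \<open>|Re s\<^sub>+|\<close> and \<open>|Re s\<^sub>-|\<close>; the poles of \<open>f\<close> only enter through \<open>m\<close>. By the beta integral, the
  Fourier transform of \<open>g\<^sub>n\<close> at \<open>t\<close> is \<open>|\<Gamma>(\<nu>/2 + it)|\<^sup>2 / \<Gamma>(\<nu>)\<close> times \<open>q\<^sub>n(it) / h\<^sub>n\<close>, so
  \<open>a\<^sub>n\<close> is a constant multiple of the double integral of \<open>f(it) e\<^bsup>-ity\<^esup> g\<^sub>n(y)\<close>, in which no Gamma
  factor (and none of its poles) is left.

  Moving \<open>y\<close> to the lines \<open>Im y = \<plusminus>\<theta>\<close> with \<open>r < \<theta> < \<pi>/2\<close> makes this integral absolutely
  convergent uniformly in \<open>n\<close>, since \<open>|tanh (y/2)| < 1\<close> there. Moving then the line of integration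
  of \<open>f\<close> to \<open>Re s = \<sigma>\<close> or \<open>Re s = -\<sigma>\<close>, \<open>\<sigma> < m\<close>, depending on the sign of \<open>Re y\<close>, yields
  \<open>a\<^sub>n = O(n\<^bsup>-\<nu>/2-\<sigma>+\<epsilon>\<^esup>)\<close>. Together with \<open>q\<^sub>n(s) = O(n\<^bsup>\<nu>/2+|Re s|-1+\<epsilon>\<^esup>)\<close>, read off from the generating
  function \<open>(1-z)\<^bsup>s-\<nu>/2\<^esup> (1+z)\<^bsup>-s-\<nu>/2\<^esup>\<close>, this gives locally uniform convergence for \<open>|Re s| < m\<close>.
  On the imaginary axis the sum is \<open>f\<close> by Fourier inversion and the Poisson kernel
  \<open>\<Sum>\<^sub>n h\<^sub>n g\<^sub>n(y) g\<^sub>n(y') = 2\<^bsup>-\<nu>\<^esup> g\<^sub>0(y' - y)\<close>; the identity theorem extends this to the strip.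
\<close>

section \<open>Integrals over lines and half-lines\<close>

text \<open>For real \<open>y\<close> the double integral need not converge absolutely:
  \<open>f (it)\<close> may grow like \<open>exp (r |t|)\<close>, while \<open>exp (- ity)\<close>
  has modulus 1. The sign of \<open>Im y\<close> is therefore tied to the sign of \<open>t\<close>.
  The integral then breaks into quarters, by the signs of \<open>t\<close> and \<open>Re y\<close>,
  and each half-line of \<open>f\<close> is shifted on its own. A half-line starting at 0 leaves,
  when shifted, an integral over the segment from 0 to \<open>\<sigma>\<close>. This is the
  obstacle: near 0 it has no factor \<open>exp (- \<sigma> |Re y|)\<close> to pay for the growth in
  \<open>Re y\<close> at which the decay in \<open>n\<close> is bought. But these integrals occur on
  both lines of \<open>y\<close> with opposite signs, and Cauchy's theorem in \<open>y\<close> turns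
  their difference into an integral over the segment from \<open>- i \<theta>\<close> to
  \<open>i \<theta>\<close>, where the kernel is small. For the polynomials, estimating the
  convolution termwise would give the exponent \<open>\<nu> - 1\<close> if
  \<open>|Re s| < \<nu> / 2\<close>; the missing cancellation comes from
  \<open>(1 + z) + (1 - z) = 2\<close>. The losses \<open>\<epsilon>\<close> are harmless: the
  exponents of the two bounds add up to \<open>|Re s| - \<sigma> - 1 + 2 \<epsilon>\<close>, and
  \<open>\<sigma>\<close> may be chosen between \<open>|Re s|\<close> and \<open>m\<close>.\<close>

lemma open_strip: "open {y. \<bar>Im y\<bar> < c}"
  by (intro open_Collect_less continuous_intros)

lemma convex_strip: "convex {y. \<bar>Im y\<bar> < c}"
proof -
  have "{y. \<bar>Im y\<bar> < c} = {y. Im y < c} \<inter> {y. Im y > - c}" by auto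
  then show ?thesis by (simp add: convex_Int convex_halfspace_Im_lt convex_halfspace_Im_gt)
qed

text \<open>A measure of its own rather than a set integral, so that
  \<open>Fubini_product_dominated\<close> applies to a quadrant with majorants that are valid only
  for nonnegative arguments.\<close>

definition half_line :: "real measure" where
  "half_line = restrict_space lborel {0..}"

lemma space_half_line [simp]: "space half_line = {0..}"
  by (simp add: half_line_def space_restrict_space)

lemma measurable_half_line [measurable (raw)]: "f \<in> borel_measurable borel \<Longrightarrow> f \<in> borel_measurable half_line"
  unfolding half_line_def by (rule measurable_restrict_space1) simp

lemma integral_half_line:
  fixes f :: "real \<Rightarrow> 'a :: {banach, second_countable_topology}"
  shows "integral\<^sup>L half_line f = (LBINT x:{0..}. f x)"
  unfolding half_line_def set_lebesgue_integral_def by (rule integral_restrict_space) auto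

lemma integrable_half_line:
  fixes f :: "real \<Rightarrow> 'a :: {banach, second_countable_topology}"
  shows "integrable half_line f \<longleftrightarrow> set_integrable lborel {0..} f"
  unfolding half_line_def set_integrable_def by (rule integrable_restrict_space) auto

lemma sigma_finite_half_line: "sigma_finite_measure half_line"
  unfolding half_line_def by (rule sigma_finite_measure_restrict_space[OF lborel.sigma_finite_measure_axioms]) auto

lemma integrable_half_line_exp:
  assumes "c > 0"
  shows "integrable half_line (\<lambda>y. exp (- c * y))"
proof -
  have "(\<lambda>y. exp (- c * y)) integrable_on {0..}"
    using integrable_on_exp_minus_to_infinity[OF assms, of 0] by simp
  then have "(\<lambda>y. exp (- c * y)) absolutely_integrable_on {0..}"
    by (intro nonnegative_absolutely_integrable_1) auto
  then have "set_integrable lborel {0..} (\<lambda>y. exp (- c * y))"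
    unfolding set_integrable_def by (subst (asm) integrable_completion) auto
  then show ?thesis by (simp add: integrable_half_line)
qed

lemma lborel_integral_reflect:
  fixes f :: "real \<Rightarrow> 'a :: {banach, second_countable_topology}"
  assumes "integrable lborel f"
  shows "integrable lborel (\<lambda>x. f (- x))" "integral\<^sup>L lborel (\<lambda>x. f (- x)) = integral\<^sup>L lborel f"
  using lborel_integrable_real_affine[OF assms, of "-1" 0]
    lborel_integral_real_affine[of "-1" f 0] by simp_all

lemma integrable_half_lineI:
  fixes f :: "real \<Rightarrow> 'a :: {banach, second_countable_topology}"
  assumes "integrable lborel f"
  shows "integrable half_line f"
  unfolding integrable_half_line set_integrable_def
  by (rule integrable_mult_indicator) (use assms in auto)

lemma integral_lborel_eq_half_line:
  fixes f :: "real \<Rightarrow> 'a :: {banach, second_countable_topology}"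
  assumes "integrable lborel f"
  shows "integral\<^sup>L lborel f = (\<integral>y. f y + f (- y) \<partial>half_line)"
proof -
  have i: "integrable half_line f" "integrable half_line (\<lambda>y. f (- y))"
    using assms lborel_integral_reflect(1)[OF assms] by (auto intro: integrable_half_lineI)
  have s: "integrable lborel (\<lambda>x. indicator A x *\<^sub>R f x)" if "A \<in> sets lborel" for A
    using that assms by (rule integrable_mult_indicator)
  have "integral\<^sup>L lborel f =
      (\<integral>x. indicator {0..} x *\<^sub>R f x + indicator {..<0} x *\<^sub>R f x \<partial>lborel)"
    by (intro Bochner_Integration.integral_cong) (auto simp: indicator_def)
  also have "\<dots> = (\<integral>x. indicator {0..} x *\<^sub>R f x \<partial>lborel) + (\<integral>x. indicator {..<0} x *\<^sub>R f x \<partial>lborel)"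
    by (intro Bochner_Integration.integral_add s) auto
  also have "(\<integral>x. indicator {..<0} x *\<^sub>R f x \<partial>lborel) =
      (\<integral>x. indicator {..<0} (- x) *\<^sub>R f (- x) \<partial>lborel)"
    using lborel_integral_reflect(2)[OF s[of "{..<0}"]] by simp
  also have "\<dots> = (\<integral>x. indicator {0..} x *\<^sub>R f (- x) \<partial>lborel)"
  proof (rule integral_cong_AE)
    have "AE x in lborel. x \<noteq> (0 :: real)" by (rule AE_lborel_singleton)
    then show "AE x in lborel. indicator {..<0} (- x) *\<^sub>R f (- x) = indicator {0..} x *\<^sub>R f (- x)"
      by eventually_elim (auto simp: indicator_def)
    have [measurable]: "f \<in> borel_measurable borel" using assms by auto
    show "(\<lambda>x. indicator {..<0} (- x) *\<^sub>R f (- x)) \<in> borel_measurable lborel"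
      "(\<lambda>x. indicator {0..} x *\<^sub>R f (- x)) \<in> borel_measurable lborel"
      by measurable
  qed
  finally have "integral\<^sup>L lborel f = integral\<^sup>L half_line f + (\<integral>y. f (- y) \<partial>half_line)"
    by (simp add: integral_half_line set_lebesgue_integral_def)
  also have "\<dots> = (\<integral>y. f y + f (- y) \<partial>half_line)"
    using i by (rule Bochner_Integration.integral_add[symmetric])
  finally show ?thesis .
qed

lemma half_line_dominated:
  fixes f :: "real \<Rightarrow> 'a :: {banach, second_countable_topology}"
  assumes "c > 0" and [measurable]: "f \<in> borel_measurable borel"
    and "\<And>y. y \<ge> 0 \<Longrightarrow> norm (f y) \<le> C * exp (- c * y)"
  shows "integrable half_line f"
    "norm (integral\<^sup>L half_line f) \<le> C * (\<integral>y. exp (- c * y) \<partial>half_line)"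
proof -
  have i: "integrable half_line (\<lambda>y. C * exp (- c * y))"
    using integrable_half_line_exp[OF assms(1)] by simp
  then show f: "integrable half_line f"
    by (rule Bochner_Integration.integrable_bound) (use assms in \<open>auto intro!: AE_I2 order_trans[OF _ abs_ge_self]\<close>)
  have "norm (integral\<^sup>L half_line f) \<le> (\<integral>y. norm (f y) \<partial>half_line)"
    by (rule integral_norm_bound)
  also have "\<dots> \<le> (\<integral>y. C * exp (- c * y) \<partial>half_line)"
    using i f assms by (intro integral_mono) auto
  finally show "norm (integral\<^sup>L half_line f) \<le> C * (\<integral>y. exp (- c * y) \<partial>half_line)" by simp
qed

lemma integrable_lborel_exp_abs:
  assumes "c > 0"
  shows "integrable lborel (\<lambda>y :: real. exp (- c * \<bar>y\<bar>))"
proof -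
  let ?f = "\<lambda>y :: real. indicator {0..} y *\<^sub>R exp (- c * y)"
  have i: "integrable lborel ?f"
    using integrable_half_line_exp[OF assms] by (simp add: integrable_half_line set_integrable_def)
  from i have "integrable lborel (\<lambda>y. ?f y + ?f (- y))"
    by (intro Bochner_Integration.integrable_add lborel_integral_reflect(1)[OF i]) auto
  then show ?thesis
    by (rule Bochner_Integration.integrable_bound) (auto simp: indicator_def intro!: AE_I2)
qed

lemma integrable_lborel_dominated:
  fixes f :: "real \<Rightarrow> 'a :: {banach, second_countable_topology}"
  assumes "c > 0" and [measurable]: "f \<in> borel_measurable borel"
    and "\<And>y. norm (f y) \<le> C * exp (- c * \<bar>y\<bar>)"
  shows "integrable lborel f"
proof -
  have "integrable lborel (\<lambda>y :: real. C * exp (- c * \<bar>y\<bar>))"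
    using integrable_lborel_exp_abs[OF assms(1)] by simp
  then show ?thesis
    by (rule Bochner_Integration.integrable_bound) (use assms in \<open>auto intro!: AE_I2 order_trans[OF _ abs_ge_self]\<close>)
qed

lemma Fubini_product_dominated:
  fixes F :: "'a \<Rightarrow> 'b \<Rightarrow> 'c :: {banach, second_countable_topology}"
  assumes "sigma_finite_measure M1" "sigma_finite_measure M2"
    and meas [measurable]: "case_prod F \<in> borel_measurable (M1 \<Otimes>\<^sub>M M2)"
    and "integrable M1 g" "integrable M2 h"
    and bound: "\<And>x y. x \<in> space M1 \<Longrightarrow> y \<in> space M2 \<Longrightarrow> norm (F x y) \<le> g x * h y"
  shows "(\<integral>x. (\<integral>y. F x y \<partial>M2) \<partial>M1) = (\<integral>y. (\<integral>x. F x y \<partial>M1) \<partial>M2)"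
    "integrable M1 (\<lambda>x. \<integral>y. F x y \<partial>M2)" "integrable M2 (\<lambda>y. \<integral>x. F x y \<partial>M1)"
proof -
  interpret M1: sigma_finite_measure M1 by fact
  interpret M2: sigma_finite_measure M2 by fact
  interpret pair_sigma_finite M1 M2 ..
  have i: "integrable (M1 \<Otimes>\<^sub>M M2) (case_prod F)"
  proof (rule Fubini_integrable)
    have Fx: "integrable M2 (\<lambda>y. F x y)" if x: "x \<in> space M1" for x
    proof (rule Bochner_Integration.integrable_bound)
      show "integrable M2 (\<lambda>y. g x * h y)" using assms by simp
      show "(\<lambda>y. F x y) \<in> borel_measurable M2" using measurable_Pair2[OF meas x] by simp
      show "AE y in M2. norm (F x y) \<le> norm (g x * h y)"
        using bound[OF x] by (intro AE_I2) (metis abs_ge_self order_trans real_norm_def)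
    qed
    then show "AE x in M1. integrable M2 (\<lambda>y. case_prod F (x, y))" by (intro AE_I2) auto
    show "integrable M1 (\<lambda>x. \<integral>y. norm (case_prod F (x, y)) \<partial>M2)"
    proof (rule Bochner_Integration.integrable_bound)
      show "integrable M1 (\<lambda>x. g x * (\<integral>y. h y \<partial>M2))" using assms by simp
      show "AE x in M1. norm (\<integral>y. norm (case_prod F (x, y)) \<partial>M2) \<le> norm (g x * (\<integral>y. h y \<partial>M2))"
      proof (rule AE_I2)
        fix x assume x: "x \<in> space M1"
        have "(\<integral>y. norm (F x y) \<partial>M2) \<le> (\<integral>y. g x * h y \<partial>M2)"
          using assms x Fx[OF x] by (intro integral_mono) auto
        then show "norm (\<integral>y. norm (case_prod F (x, y)) \<partial>M2) \<le> norm (g x * (\<integral>y. h y \<partial>M2))"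
          by (simp add: abs_of_nonneg) 
      qed
    qed simp
  qed simp
  show "(\<integral>x. (\<integral>y. F x y \<partial>M2) \<partial>M1) = (\<integral>y. (\<integral>x. F x y \<partial>M1) \<partial>M2)"
    using Fubini_integral[OF i] by simp
  show "integrable M1 (\<lambda>x. \<integral>y. F x y \<partial>M2)" using integrable_fst'[OF i] by simp
  show "integrable M2 (\<lambda>y. \<integral>x. F x y \<partial>M1)" using integrable_snd[OF i] by simp
qed

lemma sums_integral_dominated:
  fixes F :: "nat \<Rightarrow> 'a \<Rightarrow> complex" and g :: "'a \<Rightarrow> real" and q :: "nat \<Rightarrow> real"
  assumes g: "integrable M g" and F: "\<And>n. F n \<in> borel_measurable M"
    and le: "\<And>n x. norm (F n x) \<le> g x * q n" and q: "summable q"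
  shows "(\<lambda>n. integral\<^sup>L M (F n)) sums (\<integral>x. (\<Sum>n. F n x) \<partial>M)"
    "integrable M (\<lambda>x. \<Sum>n. F n x)"
proof -
  have iF: "integrable M (F n)" for n
  proof (rule Bochner_Integration.integrable_bound[OF _ F])
    show "integrable M (\<lambda>x. g x * q n)" using g by simp
    show "AE x in M. norm (F n x) \<le> norm (g x * q n)"
      unfolding real_norm_def by (intro AE_I2 order_trans[OF le abs_ge_self])
  qed
  have AE: "AE x in M. summable (\<lambda>n. norm (F n x))"
  proof (rule AE_I2)
    fix x
    show "summable (\<lambda>n. norm (F n x))"
      by (rule summable_comparison_test'[OF summable_mult[OF q, of "g x"], of 0]) (simp add: le)
  qed
  have sn: "summable (\<lambda>n. \<integral>x. norm (F n x) \<partial>M)"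
  proof (rule summable_comparison_test'[OF summable_mult[OF q], of 0])
    fix n :: nat
    have "(\<integral>x. norm (F n x) \<partial>M) \<le> (\<integral>x. g x * q n \<partial>M)"
      using iF g le by (intro integral_mono) auto
    then show "norm (\<integral>x. norm (F n x) \<partial>M) \<le> (\<integral>x. g x \<partial>M) * q n" by simp
  qed
  show "(\<lambda>n. integral\<^sup>L M (F n)) sums (\<integral>x. (\<Sum>n. F n x) \<partial>M)" by (rule sums_integral[OF iF AE sn])
  show "integrable M (\<lambda>x. \<Sum>n. F n x)" by (rule integrable_suminf[OF iF AE sn])
qed

section \<open>Cauchy's theorem for rectangles, half-strips and strips\<close>

lemma rectangle_integral_identity:
  fixes G :: "complex \<Rightarrow> complex"
  assumes S: "open S" "convex S" "G holomorphic_on S" and le: "x0 \<le> x1" "a \<le> b"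
    and sub: "\<And>u v. x0 \<le> u \<Longrightarrow> u \<le> x1 \<Longrightarrow> a \<le> v \<Longrightarrow> v \<le> b \<Longrightarrow> of_real u + \<i> * of_real v \<in> S"
  shows "(LBINT u:{x0..x1}. G (of_real u + \<i> * of_real b)) -
      (LBINT u:{x0..x1}. G (of_real u + \<i> * of_real a)) =
    \<i> * (LBINT v:{a..b}. G (of_real x1 + \<i> * of_real v)) -
    \<i> * (LBINT v:{a..b}. G (of_real x0 + \<i> * of_real v))"
proof -
  \<comment> \<open>On the convex set \<open>S\<close> there is a primitive, so every side of the
    rectangle is a difference of its values at two corners, and the four differences cancel.\<close>
  obtain P where P: "\<And>z. z \<in> S \<Longrightarrow> (P has_field_derivative G z) (at z)"
    using holomorphic_convex_primitive'[OF S(2,1,3)] at_within_open[OF _ S(1)] by metis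
  have cont: "continuous_on S G" using S(3) by (rule holomorphic_on_imp_continuous_on)
  have h: "(LBINT u:{x0..x1}. G (of_real u + \<i> * of_real v)) =
      P (of_real x1 + \<i> * of_real v) - P (of_real x0 + \<i> * of_real v)" if v: "a \<le> v" "v \<le> b" for v
    unfolding set_lebesgue_integral_def
  proof (rule integral_FTC_atLeastAtMost[OF le(1)])
    fix u assume u: "x0 \<le> u" "u \<le> x1"
    have "((\<lambda>u. of_real u + \<i> * of_real v) has_vector_derivative 1) (at u)"
      by (auto intro!: derivative_eq_intros simp: has_vector_derivative_of_real)
    from field_vector_diff_chain_at[OF this P[OF sub[OF u v]]]
    show "((\<lambda>u. P (of_real u + \<i> * of_real v)) has_vector_derivative
        G (of_real u + \<i> * of_real v)) (at u within {x0..x1})"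
      by (simp add: o_def has_vector_derivative_at_within)
  next
    show "continuous_on {x0..x1} (\<lambda>u. G (of_real u + \<i> * of_real v))"
      using sub v by (intro continuous_on_compose2[OF cont] continuous_intros) auto
  qed
  have w: "\<i> * (LBINT v:{a..b}. G (of_real u + \<i> * of_real v)) =
      P (of_real u + \<i> * of_real b) - P (of_real u + \<i> * of_real a)" if u: "x0 \<le> u" "u \<le> x1" for u
    unfolding set_integral_mult_right[symmetric] 
    unfolding set_lebesgue_integral_def
  proof (rule integral_FTC_atLeastAtMost[OF le(2)])
    fix v assume v: "a \<le> v" "v \<le> b"
    have "((\<lambda>v. of_real u + \<i> * of_real v) has_vector_derivative \<i>) (at v)"
      by (auto intro!: derivative_eq_intros simp: has_vector_derivative_of_real)
    from field_vector_diff_chain_at[OF this P[OF sub[OF u v]]]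
    show "((\<lambda>v. P (of_real u + \<i> * of_real v)) has_vector_derivative
        \<i> * G (of_real u + \<i> * of_real v)) (at v within {a..b})"
      by (simp add: o_def has_vector_derivative_at_within)
  next
    show "continuous_on {a..b} (\<lambda>v. \<i> * G (of_real u + \<i> * of_real v))"
      using sub u by (intro continuous_intros continuous_on_compose2[OF cont]) auto
  qed
  show ?thesis using h[of a] h[of b] w[of x0] w[of x1] le by simp
qed

lemma norm_set_integral_Icc_le:
  fixes g :: "real \<Rightarrow> complex"
  assumes "a \<le> b" "continuous_on {a..b} g" "\<And>v. a \<le> v \<Longrightarrow> v \<le> b \<Longrightarrow> norm (g v) \<le> B"
  shows "norm (LBINT v:{a..b}. g v) \<le> B * (b - a)"
  using integral_bound[of a b g B] assms
  by (subst set_borel_integral_eq_integral) (auto intro!: borel_integrable_atLeastAtMost')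

text \<open>Let the rectangle with right side on the imaginary axis grow to the left. Its far
  vertical side tends to 0 by the exponential bound, and only the side on the axis survives.\<close>

lemma half_strip_integral_identity:
  fixes G :: "complex \<Rightarrow> complex"
  assumes G: "G holomorphic_on {z. \<bar>Im z\<bar> < w}" and ab: "a \<le> b" "- w < a" "b < w" and "c > 0"
    and bound: "\<And>u v. u \<ge> 0 \<Longrightarrow> a \<le> v \<Longrightarrow> v \<le> b \<Longrightarrow>
      norm (G (- of_real u + \<i> * of_real v)) \<le> C * exp (- c * u)"
  shows "(\<integral>u. G (- of_real u + \<i> * of_real b) \<partial>half_line) -
      (\<integral>u. G (- of_real u + \<i> * of_real a) \<partial>half_line) =
    \<i> * (LBINT v:{a..b}. G (\<i> * of_real v))"
proof -
  have cont: "continuous_on {z. \<bar>Im z\<bar> < w} G" using G by (rule holomorphic_on_imp_continuous_on)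
  have hor: "((\<lambda>x. LBINT u:{-x..0}. G (of_real u + \<i> * of_real v)) \<longlongrightarrow>
      (\<integral>u. G (- of_real u + \<i> * of_real v) \<partial>half_line)) at_top" if v: "a \<le> v" "v \<le> b" for v
  proof -
    have meas: "(\<lambda>u. G (- of_real u + \<i> * of_real v)) \<in> borel_measurable borel"
      using v ab by (intro borel_measurable_continuous_onI continuous_on_compose2[OF cont] continuous_intros) auto
    have "integrable half_line (\<lambda>u. G (- of_real u + \<i> * of_real v))"
      using bound v by (intro half_line_dominated[OF \<open>c > 0\<close> meas, of C]) blast
    then have "set_integrable lborel {0..} (\<lambda>u. G (- of_real u + \<i> * of_real v))"
      by (simp add: integrable_half_line)
    from tendsto_set_lebesgue_integral_at_top[OF _ this]
    have "((\<lambda>x. LBINT u:{0..x}. G (- of_real u + \<i> * of_real v)) \<longlongrightarrow>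
      (\<integral>u. G (- of_real u + \<i> * of_real v) \<partial>half_line)) at_top"
      by (simp add: integral_half_line)
    moreover have "(LBINT u:{0..x}. G (- of_real u + \<i> * of_real v)) =
        (LBINT u:{-x..0}. G (of_real u + \<i> * of_real v))" for x
      by (subst set_integral_reflect) (auto intro!: arg_cong2[where f = "set_lebesgue_integral lborel"])
    ultimately show ?thesis by simp
  qed
  have ver: "((\<lambda>x. \<i> * (LBINT v:{a..b}. G (of_real (- x) + \<i> * of_real v))) \<longlongrightarrow> 0) at_top"
  proof (rule Lim_null_comparison)
    have "norm (\<i> * (LBINT v:{a..b}. G (of_real (- x) + \<i> * of_real v))) \<le> C * exp (- c * x) * (b - a)"
      if "x \<ge> 0" for x :: real
      unfolding norm_mult using that ab bound[of x]
      by (auto intro!: norm_set_integral_Icc_le continuous_on_compose2[OF cont] continuous_intros)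
    then show "\<forall>\<^sub>F x in at_top. norm (\<i> * (LBINT v:{a..b}. G (of_real (- x) + \<i> * of_real v))) \<le>
        C * exp (- c * x) * (b - a)"
      by (rule eventually_mono[OF eventually_ge_at_top])
    have "((\<lambda>x. exp (- c * x)) \<longlongrightarrow> 0) at_top" using \<open>c > 0\<close>
      by real_asymp
    then show "((\<lambda>x. C * exp (- c * x) * (b - a)) \<longlongrightarrow> 0) at_top"
      by (intro tendsto_mult_left_zero tendsto_mult_right_zero)
  qed
  have "((\<lambda>x. (LBINT u:{-x..0}. G (of_real u + \<i> * of_real b)) -
      (LBINT u:{-x..0}. G (of_real u + \<i> * of_real a))) \<longlongrightarrow>
      (\<integral>u. G (- of_real u + \<i> * of_real b) \<partial>half_line) -
      (\<integral>u. G (- of_real u + \<i> * of_real a) \<partial>half_line)) at_top"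
    using ab by (intro tendsto_diff hor) auto
  moreover have "\<forall>\<^sub>F x in at_top. (LBINT u:{-x..0}. G (of_real u + \<i> * of_real b)) -
      (LBINT u:{-x..0}. G (of_real u + \<i> * of_real a)) =
      \<i> * (LBINT v:{a..b}. G (of_real 0 + \<i> * of_real v)) -
      \<i> * (LBINT v:{a..b}. G (of_real (- x) + \<i> * of_real v))"
    by (intro eventually_mono[OF eventually_ge_at_top[of 0]]
        rectangle_integral_identity[OF open_strip convex_strip G]) (use ab in auto)
  ultimately have "((\<lambda>x. \<i> * (LBINT v:{a..b}. G (of_real 0 + \<i> * of_real v)) -
      \<i> * (LBINT v:{a..b}. G (of_real (- x) + \<i> * of_real v))) \<longlongrightarrow>
      (\<integral>u. G (- of_real u + \<i> * of_real b) \<partial>half_line) -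
      (\<integral>u. G (- of_real u + \<i> * of_real a) \<partial>half_line)) at_top"
    by (subst (asm) filterlim_cong[OF refl refl]) 
  moreover have "((\<lambda>x. \<i> * (LBINT v:{a..b}. G (of_real 0 + \<i> * of_real v)) -
      \<i> * (LBINT v:{a..b}. G (of_real (- x) + \<i> * of_real v))) \<longlongrightarrow>
      \<i> * (LBINT v:{a..b}. G (of_real 0 + \<i> * of_real v)) - 0) at_top"
    by (intro tendsto_diff ver tendsto_const)
  ultimately show ?thesis
    using tendsto_unique[OF trivial_limit_at_top_linorder] by fastforce
qed

text \<open>The left half of the strip and the right half, the latter treated through
  \<open>G (- z)\<close>, contribute the same integral over the imaginary axis with opposite
  signs.\<close>

lemma strip_integral_shift:
  fixes G :: "complex \<Rightarrow> complex"
  assumes G: "G holomorphic_on {z. \<bar>Im z\<bar> < w}" and ab: "a \<le> b" "- w < a" "b < w" and c: "c > 0"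
    and bound: "\<And>u v. a \<le> v \<Longrightarrow> v \<le> b \<Longrightarrow>
      norm (G (of_real u + \<i> * of_real v)) \<le> C * exp (- c * \<bar>u\<bar>)"
  shows "(\<integral>u. G (of_real u + \<i> * of_real b) \<partial>lborel) = (\<integral>u. G (of_real u + \<i> * of_real a) \<partial>lborel)"
proof -
  have cont: "continuous_on {z. \<bar>Im z\<bar> < w} G" using G by (rule holomorphic_on_imp_continuous_on)
  have int: "integrable lborel (\<lambda>u. G (of_real u + \<i> * of_real v))" if v: "a \<le> v" "v \<le> b" for v
    using v ab by (intro integrable_lborel_dominated[OF c _ bound] borel_measurable_continuous_onI
      continuous_on_compose2[OF cont] continuous_intros) auto
  have split: "(\<integral>u. G (of_real u + \<i> * of_real v) \<partial>lborel) =
     (\<integral>u. G (of_real u + \<i> * of_real v) \<partial>half_line) + (\<integral>u. G (- of_real u + \<i> * of_real v) \<partial>half_line)"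
    if v: "a \<le> v" "v \<le> b" for v
    using integral_lborel_eq_half_line[OF int[OF v]] integrable_half_lineI[OF int[OF v]]
      integrable_half_lineI[OF lborel_integral_reflect(1)[OF int[OF v]]] by simp
  have bound': "norm (G (- of_real u + \<i> * of_real v)) \<le> C * exp (- c * u)"
    if "u \<ge> 0" "a \<le> v" "v \<le> b" for u v
    using bound[of v "- u"] that by simp
  have 1: "(\<integral>u. G (- of_real u + \<i> * of_real b) \<partial>half_line) -
      (\<integral>u. G (- of_real u + \<i> * of_real a) \<partial>half_line) =
    \<i> * (LBINT v:{a..b}. G (\<i> * of_real v))"
    by (rule half_strip_integral_identity[OF G ab c bound'])
  have G': "(\<lambda>z. G (- z)) holomorphic_on {z. \<bar>Im z\<bar> < w}"
  proof -
    have "(G \<circ> uminus) holomorphic_on {z. \<bar>Im z\<bar> < w}"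
      by (rule holomorphic_on_compose_gen[OF _ G]) (auto intro!: holomorphic_intros)
    then show ?thesis by (simp add: o_def)
  qed
  have "(\<integral>u. G (- (- of_real u + \<i> * of_real (- a))) \<partial>half_line) -
      (\<integral>u. G (- (- of_real u + \<i> * of_real (- b))) \<partial>half_line) =
    \<i> * (LBINT v:{- b..- a}. G (- (\<i> * of_real v)))"
  proof (rule half_strip_integral_identity[OF G' _ _ _ c, of "- b" "- a" C])
    fix u v :: real assume "u \<ge> 0" "- b \<le> v" "v \<le> - a"
    then show "norm (G (- (- of_real u + \<i> * of_real v))) \<le> C * exp (- c * u)"
      using bound[of "- v" u] by simp
  qed (use ab in auto)
  moreover have "(LBINT v:{- b..- a}. G (- (\<i> * of_real v))) = (LBINT v:{a..b}. G (\<i> * of_real v))"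
    by (subst set_integral_reflect) (auto intro!: arg_cong2[where f = "set_lebesgue_integral lborel"])
  ultimately have 2: "(\<integral>u. G (of_real u + \<i> * of_real a) \<partial>half_line) -
      (\<integral>u. G (of_real u + \<i> * of_real b) \<partial>half_line) =
    \<i> * (LBINT v:{a..b}. G (\<i> * of_real v))" by (simp add: add.commute)
  show ?thesis using 1 2 split[of a] split[of b] ab by (simp add: algebra_simps)
qed

section \<open>Fourier inversion\<close>

lemma gaussian_fourier:
  "(\<integral>x. iexp (a * x) * of_real (exp (- x\<^sup>2 / 2)) \<partial>lborel) = of_real (sqrt (2 * pi) * exp (- a\<^sup>2 / 2))"
proof -
  have "char std_normal_distribution a =
      (\<integral>x. std_normal_density x *\<^sub>R iexp (a * x) \<partial>lborel)"
    unfolding char_def by (subst integral_density) auto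
  also have "\<dots> = (\<integral>x. of_real (1 / sqrt (2 * pi)) * (iexp (a * x) * of_real (exp (- x\<^sup>2 / 2))) \<partial>lborel)"
    by (intro Bochner_Integration.integral_cong)
       (auto simp: std_normal_density_def scaleR_conv_of_real)
  also have "\<dots> = of_real (1 / sqrt (2 * pi)) * (\<integral>x. iexp (a * x) * of_real (exp (- x\<^sup>2 / 2)) \<partial>lborel)"
    by (rule integral_mult_right_zero)
  finally have "of_real (exp (- a\<^sup>2 / 2)) =
      of_real (1 / sqrt (2 * pi)) * (\<integral>x. iexp (a * x) * of_real (exp (- x\<^sup>2 / 2)) \<partial>lborel)"
    by (simp add: char_std_normal_distribution)
  then show ?thesis by (simp add: field_simps)
qed

lemma integrable_gaussian: "integrable lborel (\<lambda>x :: real. exp (- x\<^sup>2 / 2))"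
proof -
  have "integrable lborel (\<lambda>x. sqrt (2 * pi) * std_normal_density x)" by simp
  then show ?thesis by (simp add: std_normal_density_def)
qed

text \<open>Gaussian summation: both sides are the limit for \<open>\<epsilon> \<rightarrow> 0\<close> of the integral on the left with
  the additional factor \<open>exp (- (\<epsilon> y)\<^sup>2 / 2)\<close>.\<close>

theorem fourier_inversion:
  fixes \<psi> :: "real \<Rightarrow> complex"
  assumes cont: "continuous_on UNIV \<psi>" and int: "integrable lborel \<psi>"
    and bdd: "\<And>\<tau>. norm (\<psi> \<tau>) \<le> B"
    and int': "integrable lborel (\<lambda>y. \<integral>\<tau>. \<psi> \<tau> * iexp (- (\<tau> * y)) \<partial>lborel)"
  shows "(\<integral>y. iexp (t * y) * (\<integral>\<tau>. \<psi> \<tau> * iexp (- (\<tau> * y)) \<partial>lborel) \<partial>lborel) = 2 * pi * \<psi> t"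
proof -
  define h where "h = (\<lambda>y. \<integral>\<tau>. \<psi> \<tau> * iexp (- (\<tau> * y)) \<partial>lborel)"
  define g where "g = (\<lambda>x :: real. exp (- x\<^sup>2 / 2))"
  define e where "e = (\<lambda>k. inverse (real (Suc k)))"
  have e0: "e k > 0" for k by (simp add: e_def)
  have lim_e: "e \<longlonglongrightarrow> 0" unfolding e_def by (rule LIMSEQ_inverse_real_of_nat)
  have [measurable]: "\<psi> \<in> borel_measurable borel" using int by auto
  have [measurable]: "h \<in> borel_measurable borel" using int' by (auto simp: h_def)
  have [measurable]: "g \<in> borel_measurable borel" unfolding g_def by measurable
  have g1: "0 \<le> g x" "g x \<le> 1" for x by (auto simp: g_def)
  have gi: "integrable lborel g" unfolding g_def by (rule integrable_gaussian)
  have gk: "integrable lborel (\<lambda>y. g (e k * y))" for k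
    using lborel_integrable_real_affine[OF gi, of "e k" 0] e0[of k] by simp
  have lim1: "(\<lambda>k. \<integral>y. iexp (t * y) * h y * of_real (g (e k * y)) \<partial>lborel) \<longlonglongrightarrow>
      (\<integral>y. iexp (t * y) * h y \<partial>lborel)"
  proof (rule integral_dominated_convergence[where w = "\<lambda>y. norm (h y)"])
    show "integrable lborel (\<lambda>y. norm (h y))" using int' by (simp add: h_def)
    show "AE y in lborel. norm (iexp (t * y) * h y * of_real (g (e k * y))) \<le> norm (h y)" for k
      using g1 by (intro AE_I2) (auto simp: norm_mult intro!: mult_left_le)
    show "AE y in lborel. (\<lambda>k. iexp (t * y) * h y * of_real (g (e k * y))) \<longlonglongrightarrow> iexp (t * y) * h y"
    proof (rule AE_I2)
      fix y
      have "(\<lambda>k. iexp (t * y) * h y * of_real (exp (- (e k * y)\<^sup>2 / 2))) \<longlonglongrightarrow>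
          iexp (t * y) * h y * of_real (exp (- (0 * y)\<^sup>2 / 2))"
        by (intro tendsto_intros lim_e) auto
      then show "(\<lambda>k. iexp (t * y) * h y * of_real (g (e k * y))) \<longlonglongrightarrow> iexp (t * y) * h y"
        by (simp add: g_def)
    qed
  qed measurable
  have lim2: "(\<lambda>k. of_real (sqrt (2 * pi)) * (\<integral>x. \<psi> (t + e k * x) * of_real (g x) \<partial>lborel)) \<longlonglongrightarrow>
     of_real (sqrt (2 * pi)) * (\<integral>x. \<psi> t * of_real (g x) \<partial>lborel)"
  proof (intro tendsto_mult tendsto_const
      integral_dominated_convergence[where w = "\<lambda>x. B * g x"])
    show "integrable lborel (\<lambda>x. B * g x)" using gi by simp
    show "AE x in lborel. norm (\<psi> (t + e k * x) * of_real (g x)) \<le> B * g x" for k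
      using g1 bdd by (intro AE_I2) (auto simp: norm_mult intro!: mult_right_mono)
    show "AE x in lborel. (\<lambda>k. \<psi> (t + e k * x) * of_real (g x)) \<longlonglongrightarrow> \<psi> t * of_real (g x)"
    proof (rule AE_I2)
      fix x
      have "(\<lambda>k. t + e k * x) \<longlonglongrightarrow> t + 0 * x" by (intro tendsto_intros lim_e)
      then have "(\<lambda>k. \<psi> (t + e k * x)) \<longlonglongrightarrow> \<psi> t"
        using continuous_on_tendsto_compose[OF cont] by simp
      then show "(\<lambda>k. \<psi> (t + e k * x) * of_real (g x)) \<longlonglongrightarrow> \<psi> t * of_real (g x)"
        by (intro tendsto_intros)
    qed
  qed measurable
  \<comment> \<open>By Fubini the inner integral over \<open>y\<close> is again a Gaussian,
    concentrated near \<open>\<tau> = t\<close> on the scale \<open>e k\<close>. Substituting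
    \<open>t + e k * x\<close> for \<open>\<tau>\<close> moves that scale into the argument of
    \<open>\<psi>\<close>, where continuity and boundedness yield \<open>lim2\<close>.\<close>
  have eq: "(\<integral>y. iexp (t * y) * h y * of_real (g (e k * y)) \<partial>lborel) =
     of_real (sqrt (2 * pi)) * (\<integral>x. \<psi> (t + e k * x) * of_real (g x) \<partial>lborel)" for k
  proof -
    let ?F = "\<lambda>y \<tau>. iexp (t * y) * (\<psi> \<tau> * iexp (- (\<tau> * y))) * of_real (g (e k * y))"
    have inner: "(\<integral>y. iexp ((t - \<tau>) * y) * of_real (g (e k * y)) \<partial>lborel) =
        of_real (sqrt (2 * pi) / e k * g ((t - \<tau>) / e k))" for \<tau>
    proof -
      have "(\<integral>x. iexp ((t - \<tau>) / e k * x) * of_real (g x) \<partial>lborel) =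
         of_real (sqrt (2 * pi) * g ((t - \<tau>) / e k))"
        unfolding g_def by (rule gaussian_fourier)
      moreover have "(\<integral>x. iexp ((t - \<tau>) / e k * x) * of_real (g x) \<partial>lborel) =
         e k *\<^sub>R (\<integral>y. iexp ((t - \<tau>) / e k * (0 + e k * y)) * of_real (g (0 + e k * y)) \<partial>lborel)"
        using lborel_integral_real_affine[of "e k"
            "\<lambda>x. iexp ((t - \<tau>) / e k * x) * of_real (g x)" 0] e0[of k] by simp
      moreover have "(t - \<tau>) / e k * (0 + e k * y) = (t - \<tau>) * y" for y
        using e0[of k] by simp
      ultimately have "e k *\<^sub>R (\<integral>y. iexp ((t - \<tau>) * y) * of_real (g (e k * y)) \<partial>lborel) =
          of_real (sqrt (2 * pi) * g ((t - \<tau>) / e k))" by simp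
      then show ?thesis using e0[of k] by (simp add: scaleR_conv_of_real field_simps)
    qed
    have "(\<integral>y. iexp (t * y) * h y * of_real (g (e k * y)) \<partial>lborel) = (\<integral>y. \<integral>\<tau>. ?F y \<tau> \<partial>lborel \<partial>lborel)"
      by (simp add: h_def)
    also have "\<dots> = (\<integral>\<tau>. \<integral>y. ?F y \<tau> \<partial>lborel \<partial>lborel)"
    proof (rule Fubini_product_dominated(1))
      show "integrable lborel (\<lambda>y. g (e k * y))" by (rule gk)
      show "integrable lborel (\<lambda>\<tau>. norm (\<psi> \<tau>))" using int by simp
      show "norm (?F y \<tau>) \<le> g (e k * y) * norm (\<psi> \<tau>)" for y \<tau>
        using g1 by (simp add: norm_mult)
    qed (auto intro: lborel.sigma_finite_measure_axioms)
    also have "\<dots> = (\<integral>\<tau>. \<psi> \<tau> * (\<integral>y. iexp ((t - \<tau>) * y) * of_real (g (e k * y)) \<partial>lborel) \<partial>lborel)"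
    proof (rule Bochner_Integration.integral_cong[OF refl])
      fix \<tau>
      have "(\<integral>y. ?F y \<tau> \<partial>lborel) = (\<integral>y. \<psi> \<tau> * (iexp ((t - \<tau>) * y) * of_real (g (e k * y))) \<partial>lborel)"
        by (intro Bochner_Integration.integral_cong)
           (auto simp: exp_diff exp_minus algebra_simps field_simps)
      then show "(\<integral>y. ?F y \<tau> \<partial>lborel) = \<psi> \<tau> * (\<integral>y. iexp ((t - \<tau>) * y) * of_real (g (e k * y)) \<partial>lborel)"
        by simp
    qed
    also have "\<dots> = (\<integral>\<tau>. of_real (sqrt (2 * pi) / e k) * (\<psi> \<tau> * of_real (g ((t - \<tau>) / e k))) \<partial>lborel)"
      unfolding inner by (intro Bochner_Integration.integral_cong) auto
    also have "\<dots> = of_real (sqrt (2 * pi) / e k) * (\<integral>\<tau>. \<psi> \<tau> * of_real (g ((t - \<tau>) / e k)) \<partial>lborel)"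
      by (rule integral_mult_right_zero)
    also have "(\<integral>\<tau>. \<psi> \<tau> * of_real (g ((t - \<tau>) / e k)) \<partial>lborel) =
       e k *\<^sub>R (\<integral>x. \<psi> (t + e k * x) * of_real (g ((t - (t + e k * x)) / e k)) \<partial>lborel)"
      using lborel_integral_real_affine[of "e k" "\<lambda>\<tau>. \<psi> \<tau> * of_real (g ((t - \<tau>) / e k))" t] e0[of k]
      by simp
    also have "(\<integral>x. \<psi> (t + e k * x) * of_real (g ((t - (t + e k * x)) / e k)) \<partial>lborel) =
       (\<integral>x. \<psi> (t + e k * x) * of_real (g x) \<partial>lborel)"
      using e0[of k] by (intro Bochner_Integration.integral_cong) (auto simp: g_def)
    finally show ?thesis using e0[of k] by (simp add: scaleR_conv_of_real)
  qed
  have "(\<integral>x. of_real (g x) \<partial>lborel) = complex_of_real (sqrt (2 * pi))"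
    using gaussian_fourier[of 0] by (simp add: g_def)
  then have "of_real (sqrt (2 * pi)) * (\<integral>x. \<psi> t * of_real (g x) \<partial>lborel) = 2 * pi * \<psi> t"
    by (simp flip: of_real_mult)
  then show ?thesis
    using LIMSEQ_unique[OF lim1[unfolded eq] lim2] by (simp add: h_def)
qed

section \<open>Growth of the polynomials\<close>

text \<open>The coefficient of \<open>z^k\<close> in \<open>(1 - z)^(-q)\<close>.\<close>

abbreviation rising_coeff :: "complex \<Rightarrow> nat \<Rightarrow> complex" where
  "rising_coeff q k \<equiv> pochhammer q k / fact k"

text \<open>\<open>rising_coeff q k\<close> is the product of the factors
  \<open>1 + (q - 1) / j\<close> for \<open>j\<close> from 1 to \<open>k\<close>. Each is compared
  with \<open>(1 + 1 / j) powr (Re q - 1)\<close>, and these comparison factors telescope. The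
  explicit constant is what makes the bound uniform on bounded sets of \<open>q\<close>.\<close>

lemma norm_pochhammer_over_fact_le:
  fixes q :: complex
  shows "norm (rising_coeff q k) \<le>
    exp (2 * (\<bar>Re q - 1\<bar> + (norm (q - 1))\<^sup>2)) * real (k + 1) powr (Re q - 1)"
proof -
  define a where "a = Re q - 1"
  define w where "w = q - 1"
  define M where "M = \<bar>a\<bar> + (norm w)\<^sup>2"
  have M0: "M \<ge> 0" by (simp add: M_def)
  \<comment> \<open>The factor for \<open>j\<close> is off by at most \<open>exp (M / j^2)\<close>.
    Since \<open>1 / j^2 \<le> 2 * (1 / j - 1 / (j + 1))\<close>, the errors telescope, which
    explains the term \<open>1 - 1 / (k + 1)\<close> in the strengthened induction claim.\<close>
  have "norm (rising_coeff q k) \<le>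
    exp (2 * M * (1 - 1 / real (k + 1))) * real (k + 1) powr a"
  proof (induction k)
    case (Suc k)
    let ?x = "1 / real (k + 1)"
    have x: "?x > 0" "?x \<le> 1" by auto
    have nz: "1 + complex_of_nat k \<noteq> 0" by (metis of_nat_Suc of_nat_neq_0)
    have "rising_coeff q (Suc k) =
        (rising_coeff q k) * (1 + of_real ?x * w)"
      using nz by (simp add: pochhammer_Suc w_def divide_simps)
    then have eq: "norm (rising_coeff q (Suc k)) =
        norm (rising_coeff q k) * norm (1 + of_real ?x * w)"
      by (simp only: norm_mult)
    have "(norm (1 + of_real x * w))\<^sup>2 = 1 + (2 * (x * a) + (x * norm w)\<^sup>2)" for x :: real
      unfolding cmod_power2 power_mult_distrib
      by (simp add: w_def a_def power2_eq_square algebra_simps)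
    note sq = this[of ?x]
    have "(norm (1 + of_real ?x * w))\<^sup>2 \<le> exp (2 * (?x * a) + (?x * norm w)\<^sup>2)"
      unfolding sq by (rule exp_ge_add_one_self)
    also have "\<dots> = (exp (?x * a + (?x * norm w)\<^sup>2 / 2))\<^sup>2"
      by (simp add: power2_eq_square flip: exp_add)
    finally have n1: "norm (1 + of_real ?x * w) \<le> exp (?x * a + (?x * norm w)\<^sup>2 / 2)"
      by (rule power2_le_imp_le) simp
    have l1: "ln (1 + ?x) \<le> ?x" using x by (intro ln_add_one_self_le_self) auto
    have l2: "?x - ?x\<^sup>2 \<le> ln (1 + ?x)" using x by (intro ln_one_plus_pos_lower_bound) auto
    have "\<bar>?x - ln (1 + ?x)\<bar> \<le> ?x\<^sup>2" using l1 l2 by (simp add: abs_if)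
    then have "\<bar>a * (?x - ln (1 + ?x))\<bar> \<le> \<bar>a\<bar> * ?x\<^sup>2"
      unfolding abs_mult by (intro mult_left_mono) auto
    then have "?x * a \<le> a * ln (1 + ?x) + \<bar>a\<bar> * ?x\<^sup>2"
      by (simp add: algebra_simps abs_le_iff)
    moreover have "(?x * norm w)\<^sup>2 / 2 \<le> (norm w)\<^sup>2 * ?x\<^sup>2"
      by (simp add: power_mult_distrib divide_simps)
    ultimately have "?x * a + (?x * norm w)\<^sup>2 / 2 \<le> a * ln (1 + ?x) + M * ?x\<^sup>2"
      unfolding M_def by (simp add: algebra_simps)
    also have "M * ?x\<^sup>2 \<le> M * (2 * (?x - 1 / real (Suc k + 1)))"
    proof (rule mult_left_mono[OF _ M0])
      show "?x\<^sup>2 \<le> 2 * (?x - 1 / real (Suc k + 1))"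
        by (simp add: divide_simps power2_eq_square)
    qed
    finally have n2: "norm (1 + of_real ?x * w) \<le>
        exp (a * ln (1 + ?x)) * exp (M * (2 * (?x - 1 / real (Suc k + 1))))"
      using n1 by (simp add: order_trans flip: exp_add)
    have e: "real (k + 1) powr a * exp (a * ln (1 + ?x)) = real (Suc k + 1) powr a"
    proof -
      have "exp (a * ln (1 + ?x)) = (1 + ?x) powr a"
        using x add_pos_pos[of 1 ?x] by (simp add: powr_def)
      moreover have "real (k + 1) * (1 + ?x) = real (Suc k + 1)" by (simp add: field_simps)
      ultimately show ?thesis by (metis powr_mult)
    qed
    have "norm (rising_coeff q (Suc k)) \<le>
      (exp (2 * M * (1 - ?x)) * real (k + 1) powr a) *
      (exp (a * ln (1 + ?x)) * exp (M * (2 * (?x - 1 / real (Suc k + 1)))))"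
      unfolding eq using Suc.IH n2 by (intro mult_mono) auto
    also have "\<dots> = (exp (2 * M * (1 - ?x)) * exp (M * (2 * (?x - 1 / real (Suc k + 1))))) *
        (real (k + 1) powr a * exp (a * ln (1 + ?x)))"
      by (simp only: mult_ac)
    also have "\<dots> = exp (2 * M * (1 - 1 / real (Suc k + 1))) * real (Suc k + 1) powr a"
      unfolding e exp_add[symmetric] by (simp add: algebra_simps)
    finally show ?case .
  qed auto
  also have "\<dots> \<le> exp (2 * M) * real (k + 1) powr a"
    using M0 by (intro mult_right_mono) (auto intro!: mult_left_le)
  finally show ?thesis by (simp add: M_def a_def w_def)
qed

text \<open>The harmonic sum is at most \<open>1 + ln (n + 1)\<close>, and the logarithm is absorbed
  by an arbitrarily small power. The \<open>\<epsilon>\<close> in the bound for the polynomials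
  originates here.\<close>

lemma sum_inverse_Suc_le_powr:
  fixes \<epsilon> :: real
  assumes "\<epsilon> > 0"
  shows "(\<Sum>k\<le>n. 1 / real (k + 1)) \<le> (1 + 1 / \<epsilon>) * real (n + 1) powr \<epsilon>"
proof -
  have h: "(\<Sum>k\<le>n. 1 / real (k + 1)) \<le> 1 + ln (real (n + 1))"
  proof (induction n)
    case (Suc n)
    have "ln (real (n+1) / real (n + 2)) \<le> real (n+1) / real (n + 2) - 1"
      by (rule ln_le_minus_one) auto
    also have "\<dots> = - (1 / real (n + 2))" by (simp add: field_simps)
    finally have "1 / real (n + 2) \<le> ln (real (n + 2)) - ln (real (n + 1))"
      by (simp add: ln_div)
    with Suc show ?case by simp
  qed auto
  have "\<epsilon> * ln (real (n + 1)) = ln (real (n + 1) powr \<epsilon>)" by (simp add: ln_powr)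
  also have "\<dots> \<le> real (n + 1) powr \<epsilon> - 1" by (intro ln_le_minus_one) auto
  finally have "ln (real (n + 1)) \<le> real (n + 1) powr \<epsilon> / \<epsilon>"
    using assms by (simp add: field_simps)
  moreover have "1 \<le> real (n + 1) powr \<epsilon>" using assms by (intro ge_one_powr_ge_zero) auto
  ultimately show ?thesis using h by (simp add: algebra_simps)
qed

lemma powr_le_powr_of_half_le:
  fixes x N c M :: real
  assumes "N / 2 \<le> x" "x \<le> N" "0 < N" "\<bar>c\<bar> \<le> M"
  shows "x powr c \<le> 2 powr M * N powr c"
proof (cases "c \<ge> 0")
  case True
  have "x powr c \<le> N powr c" using assms True by (intro powr_mono2) auto
  also have "\<dots> \<le> 2 powr M * N powr c" using assms ge_one_powr_ge_zero[of 2 M] by simp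
  finally show ?thesis .
next
  case False
  have "x powr c \<le> (N / 2) powr c" using assms False by (intro powr_mono2') auto
  also have "\<dots> = 2 powr (-c) * N powr c" using assms by (simp add: powr_divide powr_minus field_simps)
  also have "\<dots> \<le> 2 powr M * N powr c" using assms by (intro mult_right_mono powr_mono) auto
  finally show ?thesis .
qed

text \<open>One of \<open>k + 1\<close> and \<open>n - k + 1\<close> is at least half of
  \<open>n + 1\<close>. Its power is replaced, up to a constant, by that of \<open>n + 1\<close>,
  and the other variable leaves a harmonic sum. For positive \<open>A\<close> and \<open>B\<close>
  the sum would have the larger order \<open>A + B - 1\<close>, hence the condition on
  \<open>A\<close>.\<close>

lemma powr_convolution_le:
  fixes \<epsilon> M A B :: real
  assumes "\<epsilon> > 0" "\<bar>A\<bar> \<le> M" "\<bar>B\<bar> \<le> M" "A \<le> 0"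
  shows "(\<Sum>k\<le>n. real (k + 1) powr (A - 1) * real (n - k + 1) powr (B - 1)) \<le>
    2 * 2 powr (M + 1) * (1 + 1 / \<epsilon>) * real (n + 1) powr (max A B - 1 + \<epsilon>)"
proof -
  define N where "N = real (n + 1)"
  define m where "m = max A B"
  define D where "D = 2 powr (M + 1)"
  have N1: "N \<ge> 1" by (simp add: N_def)
  have D0: "D > 0" by (simp add: D_def)
  have term_le: "real (k + 1) powr (A - 1) * real (n - k + 1) powr (B - 1) \<le>
     D * N powr (m - 1) * (1 / real (k + 1) + 1 / real (n - k + 1))" if "k \<le> n" for k
  proof -
    define x where "x = real (k + 1)"
    define y where "y = real (n - k + 1)"
    have xy: "x \<ge> 1" "y \<ge> 1" "x \<le> N" "y \<le> N" "x + y \<ge> N"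
      using that by (auto simp: x_def y_def N_def of_nat_diff)
    have nn: "0 \<le> D * N powr (m - 1) * (1 / x)" "0 \<le> D * N powr (m - 1) * (1 / y)"
      using xy D0 by auto
    have "x powr (A - 1) * y powr (B - 1) \<le> D * N powr (m - 1) * (1 / x + 1 / y)"
    proof (cases "y \<ge> N / 2")
      case True
      have "x powr (A - 1) \<le> x powr (-1)" using xy assms by (intro powr_mono) auto
      then have 1: "x powr (A - 1) \<le> 1 / x" using xy by (simp add: powr_minus field_simps)
      have "y powr (B - 1) \<le> D * N powr (B - 1)" unfolding D_def
        using xy True assms N1 by (intro powr_le_powr_of_half_le) auto
      also have "\<dots> \<le> D * N powr (m - 1)" using D0 N1
        by (intro mult_left_mono powr_mono) (auto simp: m_def)
      finally have "x powr (A - 1) * y powr (B - 1) \<le> (1 / x) * (D * N powr (m - 1))"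
        using 1 xy by (intro mult_mono) auto
      then show ?thesis using nn by (simp add: algebra_simps)
    next
      case False
      then have "x \<ge> N / 2" using xy by linarith
      then have 1: "x powr (A - 1) \<le> D * N powr (A - 1)" unfolding D_def
        using xy assms N1 by (intro powr_le_powr_of_half_le) auto
      have "y powr (B - 1) \<le> y powr (max B 0 - 1)" using xy by (intro powr_mono) auto
      also have "\<dots> = y powr (max B 0) / y" using xy by (simp add: powr_diff)
      also have "\<dots> \<le> N powr (max B 0) / y" using xy
        by (intro divide_right_mono powr_mono2) auto
      finally have 2: "y powr (B - 1) \<le> N powr (max B 0) * (1 / y)" by simp
      have "x powr (A - 1) * y powr (B - 1) \<le>
          (D * N powr (A - 1)) * (N powr (max B 0) * (1 / y))"
        using 1 2 D0 by (intro mult_mono) auto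
      also have "\<dots> = D * N powr (A - 1 + max B 0) * (1 / y)" by (simp add: powr_add)
      \<comment> \<open>From \<open>A \<le> 0\<close> it follows that
        \<open>A + max B 0 \<le> max A B\<close>, whatever the sign of \<open>B\<close>.\<close>
      also have "\<dots> \<le> D * N powr (m - 1) * (1 / y)" using D0 N1 xy assms
        by (intro mult_right_mono mult_left_mono powr_mono) (auto simp: m_def)
      finally show ?thesis using nn by (simp add: algebra_simps)
    qed
    then show ?thesis by (simp add: x_def y_def)
  qed
  have rev: "(\<Sum>k\<le>n. 1 / real (n - k + 1)) = (\<Sum>k\<le>n. 1 / real (k + 1))"
    by (rule sum.reindex_bij_witness[of _ "\<lambda>k. n - k" "\<lambda>k. n - k"]) auto
  have "(\<Sum>k\<le>n. real (k + 1) powr (A - 1) * real (n - k + 1) powr (B - 1)) \<le>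
     (\<Sum>k\<le>n. D * N powr (m - 1) * (1 / real (k + 1) + 1 / real (n - k + 1)))"
    by (intro sum_mono term_le) auto
  also have "\<dots> = D * N powr (m - 1) * (2 * (\<Sum>k\<le>n. 1 / real (k + 1)))"
    unfolding sum_distrib_left[symmetric] sum.distrib rev by simp
  also have "\<dots> \<le> D * N powr (m - 1) * (2 * ((1 + 1 / \<epsilon>) * N powr \<epsilon>))"
    unfolding N_def using assms D0
    by (intro mult_left_mono sum_inverse_Suc_le_powr) auto
  also have "\<dots> = 2 * D * (1 + 1 / \<epsilon>) * (N powr (m - 1) * N powr \<epsilon>)" by (simp only: mult_ac)
  also have "N powr (m - 1) * N powr \<epsilon> = N powr (m - 1 + \<epsilon>)" by (simp add: powr_add)
  finally show ?thesis by (simp add: D_def N_def m_def)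
qed

section \<open>Coefficients of the generating function\<close>

text \<open>\<open>MP_conv n p q\<close> is the coefficient of \<open>z\<^sup>n\<close> in \<open>(1 + z)\<^bsup>-p\<^esup> (1 - z)\<^bsup>-q\<^esup>\<close>.\<close>

definition MP_conv :: "nat \<Rightarrow> complex \<Rightarrow> complex \<Rightarrow> complex" where
  "MP_conv n p q =
     (\<Sum>k\<le>n. (-1) ^ k * (rising_coeff p k) * (rising_coeff q (n - k)))"

text \<open>Multiplication of \<open>(1 - z)^(-q)\<close> by \<open>1 - z\<close>, read off
  coefficientwise.\<close>

lemma pochhammer_over_fact_diff:
  fixes q :: complex
  shows "rising_coeff (q - 1) (Suc k) =
     rising_coeff q (Suc k) - rising_coeff q k"
proof -
  have "pochhammer (q - 1) (Suc k) = (q - 1) * pochhammer q k" by (simp add: pochhammer_rec)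
  moreover have "1 + complex_of_nat k \<noteq> 0" by (metis of_nat_Suc of_nat_neq_0)
  ultimately show ?thesis
    by (simp add: pochhammer_Suc divide_simps) (simp add: algebra_simps)
qed

text \<open>The substitution of \<open>- z\<close> for \<open>z\<close> exchanges the two factors of
  the generating function.\<close>

lemma MP_conv_swap: "MP_conv n q p = (-1) ^ n * MP_conv n p q"
proof -
  have "MP_conv n q p =
    (\<Sum>k\<le>n. (-1) ^ (n - k) * (rising_coeff q (n - k)) * (rising_coeff p k))"
    unfolding MP_conv_def by (rule sum.reindex_bij_witness[of _ "\<lambda>k. n - k" "\<lambda>k. n - k"]) auto
  also have "\<dots> = (-1) ^ n * MP_conv n p q"
    unfolding MP_conv_def sum_distrib_left
    by (intro sum.cong refl) (auto simp: minus_one_power_iff mult.commute)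
  finally show ?thesis .
qed

lemma MP_conv_minus_one_right:
  "MP_conv (Suc n) p (q - 1) = MP_conv (Suc n) p q - MP_conv n p q"
proof -
  have "(\<Sum>k\<le>n. (-1) ^ k * (rising_coeff p k) *
           (rising_coeff (q - 1) (Suc n - k))) =
        (\<Sum>k\<le>n. (-1) ^ k * (rising_coeff p k) *
           (rising_coeff q (Suc n - k)) -
           (-1) ^ k * (rising_coeff p k) * (rising_coeff q (n - k)))"
    by (intro sum.cong refl)
       (simp only: Suc_diff_le atMost_iff pochhammer_over_fact_diff right_diff_distrib)
  then show ?thesis
    unfolding MP_conv_def sum.atMost_Suc by (simp add: sum_subtractf)
qed

lemma MP_conv_minus_one_left:
  "MP_conv (Suc n) (p - 1) q = MP_conv (Suc n) p q + MP_conv n p q"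
proof -
  have "(-1) ^ Suc n * MP_conv (Suc n) (p - 1) q =
      (-1) ^ Suc n * (MP_conv (Suc n) p q + MP_conv n p q)"
    using MP_conv_minus_one_right[of n q p]
    unfolding MP_conv_swap[of _ q p] MP_conv_swap[of _ q "p - 1"] by (simp add: algebra_simps)
  then show ?thesis by (simp del: power_Suc)
qed

text \<open>This is \<open>2 = (1 - z) + (1 + z)\<close> applied to the generating function. Both
  terms on the right have \<open>Re p + Re q\<close> lowered by 1, while neither real part
  increases.\<close>

lemma MP_conv_split: "MP_conv n p q = (MP_conv n p (q - 1) + MP_conv n (p - 1) q) / 2"
proof (cases n)
  case (Suc m)
  show ?thesis unfolding Suc MP_conv_minus_one_left MP_conv_minus_one_right by simp
qed (simp add: MP_conv_def)

lemma norm_MP_conv_le_nonpos: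
  fixes \<epsilon> M :: real
  assumes "\<epsilon> > 0"
  obtains C where "C \<ge> 0" "\<And>n p q. norm p \<le> M \<Longrightarrow> norm q \<le> M \<Longrightarrow> Re p \<le> 0 \<Longrightarrow>
    norm (MP_conv n p q) \<le> C * real (n + 1) powr (max (Re p) (Re q) - 1 + \<epsilon>)"
proof -
  \<comment> \<open>An upper bound for the constant of \<open>norm_pochhammer_over_fact_le\<close>
    over all \<open>q\<close> of norm at most \<open>M\<close>; there \<open>q - 1\<close> has norm
    at most \<open>M + 1\<close>.\<close>
  define E where "E = exp (2 * ((M + 1) + (M + 1)\<^sup>2))"
  define C where "C = E * E * (2 * 2 powr (M + 1) * (1 + 1 / \<epsilon>))"
  have E0: "E > 0" by (simp add: E_def)
  have c: "norm (rising_coeff q k) \<le> E * real (k + 1) powr (Re q - 1)"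
    if "norm q \<le> M" for q :: complex and k
  proof -
    have "\<bar>Re q\<bar> \<le> M" using that abs_Re_le_cmod[of q] by linarith
    moreover have "norm (q - 1) \<le> M + 1" using that norm_triangle_ineq4[of q 1] by simp
    ultimately have "2 * (\<bar>Re q - 1\<bar> + (norm (q - 1))\<^sup>2) \<le> 2 * ((M + 1) + (M + 1)\<^sup>2)"
      by (intro mult_left_mono add_mono power_mono) auto
    then have "exp (2 * (\<bar>Re q - 1\<bar> + (norm (q - 1))\<^sup>2)) \<le> E" by (simp add: E_def)
    then show ?thesis
      by (rule order_trans[OF norm_pochhammer_over_fact_le mult_right_mono]) auto
  qed
  have "norm (MP_conv n p q) \<le> C * real (n + 1) powr (max (Re p) (Re q) - 1 + \<epsilon>)"
    if "norm p \<le> M" "norm q \<le> M" "Re p \<le> 0" for n p q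
  proof -
    have "norm (MP_conv n p q) \<le> (\<Sum>k\<le>n. norm ((-1) ^ k * (rising_coeff p k) *
        (rising_coeff q (n - k))))"
      unfolding MP_conv_def by (rule norm_sum)
    also have "\<dots> \<le> (\<Sum>k\<le>n. (E * real (k + 1) powr (Re p - 1)) *
        (E * real (n - k + 1) powr (Re q - 1)))"
    proof (rule sum_mono)
      fix k
      have "norm ((-1) ^ k * (rising_coeff p k) * (rising_coeff q (n - k))) =
         norm (rising_coeff p k) * norm (rising_coeff q (n - k))"
        by (simp add: norm_mult norm_power norm_divide)
      also have "\<dots> \<le> (E * real (k + 1) powr (Re p - 1)) * (E * real (n - k + 1) powr (Re q - 1))"
        using that E0 by (intro mult_mono c) auto
      finally show "norm ((-1) ^ k * (rising_coeff p k) *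
          (rising_coeff q (n - k))) \<le> \<dots>" .
    qed
    also have "\<dots> = E * E * (\<Sum>k\<le>n. real (k + 1) powr (Re p - 1) * real (n - k + 1) powr (Re q - 1))"
      by (simp add: sum_distrib_left mult_ac)
    also have "\<dots> \<le> E * E * (2 * 2 powr (M + 1) * (1 + 1 / \<epsilon>) *
        real (n + 1) powr (max (Re p) (Re q) - 1 + \<epsilon>))"
      using E0 assms that abs_Re_le_cmod[of p] abs_Re_le_cmod[of q]
      by (intro mult_left_mono powr_convolution_le) auto
    finally show ?thesis by (simp add: C_def mult_ac)
  qed
  moreover have "C \<ge> 0" using E0 assms by (simp add: C_def)
  ultimately show ?thesis using that by blast
qed

text \<open>If both real parts are positive, termwise estimation loses too much, so cancellation
  enters through \<open>MP_conv_split\<close>, by induction on a bound for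
  \<open>Re p + Re q\<close>. For the bound 0 one of the real parts is nonpositive and
  \<open>norm_MP_conv_le_nonpos\<close> applies, if necessary after a swap. The radius
  \<open>M\<close> is generalised because passing to \<open>p - 1\<close> or \<open>q - 1\<close>
  may enlarge the norm by 1.\<close>

lemma norm_MP_conv_le:
  fixes \<epsilon> M :: real and N :: nat
  assumes "\<epsilon> > 0"
  shows "\<exists>C\<ge>0. \<forall>n p q. norm p \<le> M \<longrightarrow> norm q \<le> M \<longrightarrow> Re p + Re q \<le> real N \<longrightarrow>
    norm (MP_conv n p q) \<le> C * real (n + 1) powr (max (Re p) (Re q) - 1 + \<epsilon>)"
proof (induction N arbitrary: M)
  case 0
  obtain C where C: "C \<ge> 0" "\<And>n p q. norm p \<le> M \<Longrightarrow> norm q \<le> M \<Longrightarrow> Re p \<le> 0 \<Longrightarrow>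
    norm (MP_conv n p q) \<le> C * real (n + 1) powr (max (Re p) (Re q) - 1 + \<epsilon>)"
    using norm_MP_conv_le_nonpos[OF assms] by metis
  have "norm (MP_conv n p q) \<le> C * real (n + 1) powr (max (Re p) (Re q) - 1 + \<epsilon>)"
    if "norm p \<le> M" "norm q \<le> M" "Re p + Re q \<le> 0" for n p q
  proof (cases "Re p \<le> 0")
    case False
    then have "norm (MP_conv n q p) \<le> C * real (n + 1) powr (max (Re q) (Re p) - 1 + \<epsilon>)"
      using that by (intro C) auto
    then show ?thesis by (simp add: MP_conv_swap[of n q p] norm_mult norm_power max.commute)
  qed (use C that in auto)
  then show ?case using C(1) by auto
next
  case (Suc N)
  obtain C where C: "C \<ge> 0" "\<And>n p q. norm p \<le> M + 1 \<Longrightarrow> norm q \<le> M + 1 \<Longrightarrow>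
    Re p + Re q \<le> real N \<Longrightarrow>
    norm (MP_conv n p q) \<le> C * real (n + 1) powr (max (Re p) (Re q) - 1 + \<epsilon>)"
    using Suc.IH[of "M + 1"] by blast
  have "norm (MP_conv n p q) \<le> C * real (n + 1) powr (max (Re p) (Re q) - 1 + \<epsilon>)"
    if "norm p \<le> M" "norm q \<le> M" "Re p + Re q \<le> real (Suc N)" for n p q
  proof -
    let ?B = "C * real (n + 1) powr (max (Re p) (Re q) - 1 + \<epsilon>)"
    have m: "norm (p - 1) \<le> M + 1" "norm (q - 1) \<le> M + 1"
      using that norm_triangle_ineq4[of p 1] norm_triangle_ineq4[of q 1] by auto
    have "norm (MP_conv n p (q - 1)) \<le>
       C * real (n + 1) powr (max (Re p) (Re (q - 1)) - 1 + \<epsilon>)"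
      using that m by (intro C) auto
    also have "\<dots> \<le> ?B" using C(1) by (intro mult_left_mono powr_mono) auto
    finally have 1: "norm (MP_conv n p (q - 1)) \<le> ?B" .
    have "norm (MP_conv n (p - 1) q) \<le>
       C * real (n + 1) powr (max (Re (p - 1)) (Re q) - 1 + \<epsilon>)"
      using that m by (intro C) auto
    also have "\<dots> \<le> ?B" using C(1) by (intro mult_left_mono powr_mono) auto
    finally have 2: "norm (MP_conv n (p - 1) q) \<le> ?B" .
    have "norm (MP_conv n p q) \<le> (norm (MP_conv n p (q - 1)) + norm (MP_conv n (p - 1) q)) / 2"
      by (subst MP_conv_split) (simp add: norm_divide norm_triangle_ineq)
    also have "\<dots> \<le> (?B + ?B) / 2" using 1 2 by (intro divide_right_mono add_mono) auto
    finally show ?thesis by simp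
  qed
  then show ?case using C(1) by blast
qed

section \<open>The polynomials as coefficients of the generating function\<close>

lemma binomial_sum_Suc:
  fixes x :: "'a :: comm_ring_1"
  shows "(\<Sum>j\<le>Suc n. of_nat (Suc n choose j) * x ^ j * F j) =
     (\<Sum>j\<le>n. of_nat (n choose j) * x ^ j * F j) +
     x * (\<Sum>j\<le>n. of_nat (n choose j) * x ^ j * F (Suc j))"
proof -
  have "(\<Sum>j\<le>Suc n. of_nat (Suc n choose j) * x ^ j * F j) =
     F 0 + (\<Sum>j\<le>n. of_nat (n choose Suc j) * x ^ Suc j * F (Suc j)) +
     (\<Sum>j\<le>n. of_nat (n choose j) * x ^ Suc j * F (Suc j))"
    unfolding sum.atMost_Suc_shift by (simp add: algebra_simps sum.distrib)
  also have "F 0 + (\<Sum>j\<le>n. of_nat (n choose Suc j) * x ^ Suc j * F (Suc j)) =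
     (\<Sum>j\<le>Suc n. of_nat (n choose j) * x ^ j * F j)"
    unfolding sum.atMost_Suc_shift by simp
  also have "\<dots> = (\<Sum>j\<le>n. of_nat (n choose j) * x ^ j * F j)" by (simp add: binomial_eq_0)
  finally show ?thesis by (simp add: sum_distrib_left mult_ac)
qed

text \<open>If \<open>t k l\<close> is the integral of \<open>u\<^sup>k (1 - u)\<^sup>l\<close>, both sides are the integral of
  \<open>u\<^sup>k (1 - u)\<^sup>l (1 - 2 u)\<^sup>n\<close>.\<close>

lemma binomial_sum_eq_of_pascal:
  fixes t :: "nat \<Rightarrow> nat \<Rightarrow> 'a :: comm_ring_1"
  assumes pascal: "\<And>k l. t (Suc k) l + t k (Suc l) = t k l"
  shows "(\<Sum>j\<le>n. of_nat (n choose j) * (-2) ^ j * t (k + j) l) =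
    (\<Sum>j\<le>n. of_nat (n choose j) * (-1) ^ j * t (k + j) (l + n - j))"
proof (induction n arbitrary: k l)
  case (Suc n)
  define T where "T = (\<lambda>k l. \<Sum>j\<le>n. of_nat (n choose j) * (-2) ^ j * t (k + j) l)"
  have T: "T (Suc k) l + T k (Suc l) = T k l"
  proof -
    have "T (Suc k) l + T k (Suc l) =
       (\<Sum>j\<le>n. of_nat (n choose j) * (-2) ^ j * (t (Suc (k + j)) l + t (k + j) (Suc l)))"
      by (simp add: T_def sum.distrib algebra_simps)
    then show ?thesis by (simp add: pascal T_def)
  qed
  have "(\<Sum>j\<le>Suc n. of_nat (Suc n choose j) * (-2) ^ j * t (k + j) l) = T k l - 2 * T (Suc k) l"
    using binomial_sum_Suc[of n "-2" "\<lambda>j. t (k + j) l"] by (simp add: T_def)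
  also have "\<dots> = T k (Suc l) - T (Suc k) l" using T by (simp add: algebra_simps)
  also have "\<dots> = (\<Sum>j\<le>Suc n. of_nat (Suc n choose j) * (-1) ^ j * t (k + j) (l + Suc n - j))"
    using binomial_sum_Suc[of n "-1" "\<lambda>j. t (k + j) (l + Suc n - j)"]
    by (simp add: T_def Suc.IH)
  finally show ?case .
qed auto

lemma pochhammer_of_real_ne_0: "\<nu> > 0 \<Longrightarrow> pochhammer (of_real \<nu> :: complex) n \<noteq> 0"
  by (metis of_real_eq_0_iff order_less_irrefl pochhammer_of_real pochhammer_pos)

lemma MP_poly_binomial_sum:
  assumes "\<nu> > 0"
  shows "MP_poly \<nu> n s = of_real (pochhammer \<nu> n / fact n) *
    (\<Sum>k\<le>n. of_nat (n choose k) * (-2) ^ k *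
       (pochhammer (s + of_real \<nu> / 2) k / pochhammer (of_real \<nu>) k))"
proof -
  have "pochhammer (- of_nat n) k / fact k = (-1) ^ k * (of_nat (n choose k) :: complex)" for k
    by (simp add: binomial_gbinomial gbinomial_pochhammer)
  then have "pochhammer (- of_nat n) k * pochhammer (s + of_real \<nu> / 2) k /
              (pochhammer (of_real \<nu>) k * fact k) * 2 ^ k =
      of_nat (n choose k) * (-2) ^ k *
       (pochhammer (s + of_real \<nu> / 2) k / pochhammer (of_real \<nu>) k)" for k
    by (simp add: field_simps pochhammer_of_real_ne_0[OF assms] flip: power_mult_distrib)
  then show ?thesis unfolding MP_poly_eq_finite_sum by simp
qed

text \<open>The quotients \<open>t k l\<close> of the proof are formally the moments of
  \<open>u^k * (1 - u)^l\<close> for the beta density with parameters \<open>p\<close> and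
  \<open>q\<close>. Their Pascal relation rests only on \<open>p + q = \<nu>\<close>, so no
  condition on the real parts of \<open>p\<close> and \<open>q\<close> arises and \<open>s\<close>
  may be any complex number.\<close>

lemma MP_poly_eq_MP_conv:
  assumes "\<nu> > 0"
  shows "MP_poly \<nu> n s = MP_conv n (of_real \<nu> / 2 + s) (of_real \<nu> / 2 - s)"
proof -
  define p where "p = of_real \<nu> / 2 + s"
  define q where "q = of_real \<nu> / 2 - s"
  define t where "t = (\<lambda>k l. pochhammer p k * pochhammer q l / pochhammer (of_real \<nu> :: complex) (k + l))"
  have nz: "pochhammer (of_real \<nu> :: complex) k \<noteq> 0" for k
    using assms by (rule pochhammer_of_real_ne_0)
  have pq: "p + q = of_real \<nu>" by (simp add: p_def q_def)
  have "t (Suc k) l + t k (Suc l) = t k l" for k l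
  proof -
    have "(p + of_nat k) + (q + of_nat l) = of_real \<nu> + of_nat (k + l)" using pq by simp
    moreover have "of_real \<nu> + of_nat (k + l) \<noteq> (0 :: complex)"
      using nz[of "Suc (k + l)"] by (auto simp: pochhammer_Suc)
    moreover have "t (Suc k) l = t k l * ((p + of_nat k) / (of_real \<nu> + of_nat (k + l)))"
      "t k (Suc l) = t k l * ((q + of_nat l) / (of_real \<nu> + of_nat (k + l)))"
      by (simp_all add: t_def pochhammer_Suc)
    ultimately show ?thesis
      by (metis add_divide_distrib distrib_left divide_self mult.right_neutral)
  qed
  from binomial_sum_eq_of_pascal[of t n 0 0, OF this]
  have eq: "(\<Sum>j\<le>n. of_nat (n choose j) * (-2) ^ j * t j 0) =
    (\<Sum>j\<le>n. of_nat (n choose j) * (-1) ^ j * t j (n - j))" by simp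
  have "MP_poly \<nu> n s = of_real (pochhammer \<nu> n / fact n) *
      (\<Sum>j\<le>n. of_nat (n choose j) * (-2) ^ j * t j 0)"
    by (simp add: MP_poly_binomial_sum[OF assms] t_def p_def add.commute)
  also have "\<dots> = (\<Sum>j\<le>n. of_real (pochhammer \<nu> n / fact n) *
      (of_nat (n choose j) * (-1) ^ j * t j (n - j)))"
    unfolding eq by (rule sum_distrib_left)
  also have "\<dots> = MP_conv n p q"
    unfolding MP_conv_def
  proof (intro sum.cong refl)
    fix j assume "j \<in> {..n}"
    then have j: "j \<le> n" by simp
    then have "of_nat (n choose j) = (fact n / (fact j * fact (n - j)) :: complex)"
      by (rule binomial_fact)
    then show "of_real (pochhammer \<nu> n / fact n) * (of_nat (n choose j) * (-1) ^ j * t j (n - j)) =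
      (-1) ^ j * (pochhammer p j / fact j) * (pochhammer q (n - j) / fact (n - j))"
      using j nz[of n] by (simp add: t_def pochhammer_of_real)
  qed
  finally show ?thesis by (simp add: p_def q_def)
qed

lemma norm_MP_poly_le:
  fixes \<epsilon> M \<nu> :: real
  assumes "\<epsilon> > 0" "\<nu> > 0"
  obtains C where "C \<ge> 0" "\<And>n s. norm s \<le> M \<Longrightarrow>
    norm (MP_poly \<nu> n s) \<le> C * real (n + 1) powr (\<nu> / 2 + \<bar>Re s\<bar> - 1 + \<epsilon>)"
proof -
  obtain N :: nat where N: "\<nu> \<le> real N" using real_arch_simple by blast
  obtain C where C: "C \<ge> 0" "\<And>n p q. norm p \<le> M + \<nu> / 2 \<Longrightarrow> norm q \<le> M + \<nu> / 2 \<Longrightarrow>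
    Re p + Re q \<le> real N \<Longrightarrow>
    norm (MP_conv n p q) \<le> C * real (n + 1) powr (max (Re p) (Re q) - 1 + \<epsilon>)"
    using norm_MP_conv_le[OF assms(1), of "M + \<nu> / 2" N] by blast
  have "norm (MP_poly \<nu> n s) \<le> C * real (n + 1) powr (\<nu> / 2 + \<bar>Re s\<bar> - 1 + \<epsilon>)"
    if "norm s \<le> M" for n s
  proof -
    let ?b = "of_real \<nu> / 2 :: complex"
    have b: "norm ?b = \<nu> / 2" using assms by (simp add: norm_divide)
    have "norm (MP_conv n (?b + s) (?b - s)) \<le>
        C * real (n + 1) powr (max (Re (?b + s)) (Re (?b - s)) - 1 + \<epsilon>)"
      using that b N norm_triangle_ineq[of ?b s] norm_triangle_ineq4[of ?b s] by (intro C) auto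
    moreover have "max (Re (?b + s)) (Re (?b - s)) = \<nu> / 2 + \<bar>Re s\<bar>" by (auto simp: max_def)
    ultimately show ?thesis by (simp add: MP_poly_eq_MP_conv[OF assms(2)])
  qed
  then show ?thesis using that C(1) by blast
qed

section \<open>The kernel\<close>

lemma Re_cosh_complex: "Re (cosh z) = cosh (Re z) * cos (Im z)"
  by (simp add: cosh_def Re_exp) (simp add: field_simps)
lemma Im_cosh_complex: "Im (cosh z) = sinh (Re z) * sin (Im z)"
  by (simp add: cosh_def sinh_def Im_exp) (simp add: field_simps)
lemma Re_sinh_complex: "Re (sinh z) = sinh (Re z) * cos (Im z)"
  by (simp add: sinh_def Re_exp) (simp add: field_simps)
lemma Im_sinh_complex: "Im (sinh z) = cosh (Re z) * sin (Im z)"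
  by (simp add: cosh_def sinh_def Im_exp) (simp add: field_simps)

lemma cmod_cosh_squared: "(cmod (cosh z))\<^sup>2 = (sinh (Re z))\<^sup>2 + (cos (Im z))\<^sup>2"
proof -
  have "(cmod (cosh z))\<^sup>2 = (sinh (Re z))\<^sup>2 * ((sin (Im z))\<^sup>2 + (cos (Im z))\<^sup>2) + (cos (Im z))\<^sup>2"
    unfolding cmod_power2 Re_cosh_complex Im_cosh_complex power_mult_distrib cosh_square_eq
    by (simp only: algebra_simps)
  then show ?thesis by simp
qed

lemma cmod_sinh_squared: "(cmod (sinh z))\<^sup>2 = (sinh (Re z))\<^sup>2 + (sin (Im z))\<^sup>2"
proof -
  have "(cmod (sinh z))\<^sup>2 = (sinh (Re z))\<^sup>2 * ((sin (Im z))\<^sup>2 + (cos (Im z))\<^sup>2) + (sin (Im z))\<^sup>2"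
    unfolding cmod_power2 Re_sinh_complex Im_sinh_complex power_mult_distrib cosh_square_eq
    by (simp only: algebra_simps)
  then show ?thesis by simp
qed

lemma cosh_ge_half_exp_abs: "exp \<bar>x :: real\<bar> / 2 \<le> cosh x"
  by (auto simp: cosh_def abs_if)
lemma cosh_le_exp_abs: "cosh (x :: real) \<le> exp \<bar>x\<bar>"
proof -
  have "exp x \<le> exp \<bar>x\<bar>" "exp (-x) \<le> exp \<bar>x\<bar>" by auto
  then have "exp x + exp (- x) \<le> exp \<bar>x\<bar> + exp \<bar>x\<bar>" by (rule add_mono)
  then show ?thesis by (simp add: cosh_def)
qed

lemma cosh_complex_of_real: "cosh (complex_of_real x) = of_real (cosh x)"
  by (simp add: complex_eq_iff Re_cosh_complex Im_cosh_complex)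

lemma sinh_complex_of_real: "sinh (complex_of_real x) = of_real (sinh x)"
  by (simp add: complex_eq_iff Re_sinh_complex Im_sinh_complex)

lemma tanh_complex_of_real: "tanh (complex_of_real x) = of_real (tanh x)"
  by (simp add: tanh_def cosh_complex_of_real sinh_complex_of_real)

definition MP_kernel :: "real \<Rightarrow> nat \<Rightarrow> complex \<Rightarrow> complex" where
  "MP_kernel \<nu> n y = (2 * cosh (y / 2)) powr (- of_real \<nu>) * (- tanh (y / 2)) ^ n"

lemma Re_cosh_half_pos:
  assumes "\<bar>Im y\<bar> < pi"
  shows "Re (cosh (y / 2)) > 0"
  using assms unfolding Re_cosh_complex by (intro mult_pos_pos cos_gt_zero_pi) auto

lemma cosh_half_ne_0: "\<bar>Im y\<bar> < pi \<Longrightarrow> cosh (y / 2) \<noteq> 0"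
  using Re_cosh_half_pos by force

text \<open>In this strip \<open>cosh (y / 2)\<close> has positive real part. This keeps the base of
  the power off the cut of \<open>powr\<close> and the denominator of \<open>tanh\<close> away from
  0.\<close>

lemma holomorphic_on_MP_kernel: "MP_kernel \<nu> n holomorphic_on {y. \<bar>Im y\<bar> < pi}"
proof -
  have "2 * cosh (y / 2) \<notin> \<real>\<^sub>\<le>\<^sub>0" if "\<bar>Im y\<bar> < pi" for y
    using Re_cosh_half_pos[OF that] by (auto simp: complex_nonpos_Reals_iff)
  moreover have "(\<lambda>y :: complex. tanh (y / 2)) holomorphic_on {y. \<bar>Im y\<bar> < pi}"
    unfolding holomorphic_on_open[OF open_strip]
    using cosh_half_ne_0 by (auto intro!: exI derivative_eq_intros)
  moreover have "(\<lambda>y :: complex. cosh (y / 2)) holomorphic_on {y. \<bar>Im y\<bar> < pi}"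
    unfolding holomorphic_on_open[OF open_strip]
    by (auto intro!: exI derivative_eq_intros)
  ultimately show ?thesis
    unfolding MP_kernel_def [abs_def] by (intro holomorphic_intros) auto
qed

lemma MP_kernel_minus: "MP_kernel \<nu> n (- y) = (- 1) ^ n * MP_kernel \<nu> n y"
  by (simp add: MP_kernel_def flip: power_mult_distrib)

lemma MP_kernel_of_real:
  "MP_kernel \<nu> n (of_real y) = of_real ((2 * cosh (y / 2)) powr (- \<nu>) * (- tanh (y / 2)) ^ n)"
proof -
  have "cosh (of_real y / 2 :: complex) = of_real (cosh (y / 2))"
    by (metis cosh_complex_of_real of_real_divide of_real_numeral)
  moreover have "tanh (of_real y / 2 :: complex) = of_real (tanh (y / 2))"
    by (metis tanh_complex_of_real of_real_divide of_real_numeral)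
  ultimately show ?thesis unfolding MP_kernel_def
    using powr_of_real[of "2 * cosh (y / 2)" "- \<nu>"] by simp
qed

text \<open>With \<open>S\<close> the squared modulus of \<open>cosh (y / 2)\<close>, that of
  \<open>tanh (y / 2)\<close> is \<open>1 - cos v / S\<close>. Here \<open>S \<le> exp |u|\<close>,
  and \<open>1 - x \<le> exp (- x)\<close> turns the power into an exponential. The restriction on
  \<open>\<theta>\<close> makes the rate \<open>cos \<theta> / 2\<close> positive.\<close>

lemma norm_tanh_half_power_le:
  assumes "\<bar>v\<bar> \<le> \<theta>" "\<theta> < pi / 2"
  shows "norm (tanh ((of_real u + \<i> * of_real v) / 2 :: complex)) ^ n \<le>
    exp (- (cos \<theta> / 2) * real n * exp (- \<bar>u\<bar>))"
proof -
  let ?z = "(of_real u + \<i> * of_real v) / 2 :: complex"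
  define S where "S = (sinh (u / 2))\<^sup>2 + (cos (v / 2))\<^sup>2"
  have cv: "cos (v / 2) > 0" using assms by (intro cos_gt_zero_pi) auto
  have S0: "S > 0" unfolding S_def using cv by (intro add_nonneg_pos) auto
  have "S \<le> (sinh (u / 2))\<^sup>2 + 1" unfolding S_def by (simp add: abs_square_le_1)
  also have "\<dots> = (cosh (u / 2))\<^sup>2" by (simp add: cosh_square_eq)
  also have "\<dots> \<le> (exp \<bar>u / 2\<bar>)\<^sup>2" by (intro power_mono cosh_le_exp_abs) auto
  also have "\<dots> = exp \<bar>u\<bar>" by (simp add: power2_eq_square flip: exp_add)
  finally have S1: "S \<le> exp \<bar>u\<bar>" .
  have cc: "cos \<theta> \<le> cos v" using assms
    using cos_monotone_0_pi_le[of "\<bar>v\<bar>" \<theta>] by simp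
  have c0: "cos \<theta> \<ge> 0" using assms by (intro cos_ge_zero) auto
  have "cos \<theta> * exp (- \<bar>u\<bar>) \<le> cos v * (1 / S)"
    using S0 S1 cc c0 by (intro mult_mono) (auto simp: exp_minus field_simps)
  then have 1: "1 - cos v / S \<le> 1 - cos \<theta> * exp (- \<bar>u\<bar>)" by simp
  have "(norm (tanh ?z))\<^sup>2 = ((sinh (u / 2))\<^sup>2 + (sin (v / 2))\<^sup>2) / S"
    by (simp add: tanh_def norm_divide power_divide cmod_sinh_squared cmod_cosh_squared S_def)
  also have "(sinh (u / 2))\<^sup>2 + (sin (v / 2))\<^sup>2 = S - cos v"
    using cos_double[of "v / 2"] by (simp add: S_def)
  also have "(S - cos v) / S = 1 - cos v / S" using S0 by (simp add: field_simps)
  also have "\<dots> \<le> exp (- (cos \<theta> * exp (- \<bar>u\<bar>)))"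
    using 1 exp_ge_add_one_self[of "- (cos \<theta> * exp (- \<bar>u\<bar>))"] by linarith
  also have "\<dots> = (exp (- (cos \<theta> / 2) * exp (- \<bar>u\<bar>)))\<^sup>2"
    by (simp add: power2_eq_square flip: exp_add)
  finally have "norm (tanh ?z) \<le> exp (- (cos \<theta> / 2) * exp (- \<bar>u\<bar>))"
    by (rule power2_le_imp_le) simp
  then have "norm (tanh ?z) ^ n \<le> exp (- (cos \<theta> / 2) * exp (- \<bar>u\<bar>)) ^ n"
    by (intro power_mono) auto
  also have "\<dots> = exp (- (cos \<theta> / 2) * real n * exp (- \<bar>u\<bar>))"
    by (simp add: mult_ac flip: exp_of_nat_mult)
  finally show ?thesis .
qed

lemma norm_cosh_half_powr_le:
  assumes "\<bar>v\<bar> \<le> \<theta>" "\<theta> < pi" "\<nu> > 0"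
  shows "norm ((2 * cosh ((of_real u + \<i> * of_real v) / 2)) powr (- complex_of_real \<nu>)) \<le>
    cos (\<theta> / 2) powr (- \<nu>) * exp (- (\<nu> / 2) * \<bar>u\<bar>)"
proof -
  let ?w = "2 * cosh ((of_real u + \<i> * of_real v) / 2) :: complex"
  have ct: "cos (\<theta> / 2) > 0" using assms by (intro cos_gt_zero_pi) auto
  have cc: "cos (\<theta> / 2) \<le> cos (v / 2)"
    using cos_monotone_0_pi_le[of "\<bar>v / 2\<bar>" "\<theta> / 2"] assms by (simp del: abs_divide)
  have "cos (\<theta> / 2) * exp (\<bar>u\<bar> / 2) \<le> cos (v / 2) * (2 * cosh (u / 2))"
    using ct cc cosh_ge_half_exp_abs[of "u / 2"] by (intro mult_mono) auto
  also have "\<dots> = Re ?w" by (simp add: Re_cosh_complex)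
  also have "\<dots> \<le> norm ?w" by (rule complex_Re_le_cmod)
  finally have le: "cos (\<theta> / 2) * exp (\<bar>u\<bar> / 2) \<le> norm ?w" .
  have "norm (?w powr (- complex_of_real \<nu>)) = norm ?w powr (- \<nu>)"
    using norm_powr_real_powr'[of "- complex_of_real \<nu>"] by simp
  also have "\<dots> \<le> (cos (\<theta> / 2) * exp (\<bar>u\<bar> / 2)) powr (- \<nu>)"
    using le ct assms by (intro powr_mono2') auto
  also have "\<dots> = cos (\<theta> / 2) powr (- \<nu>) * exp (- (\<nu> / 2) * \<bar>u\<bar>)"
    using ct by (simp add: powr_mult exp_powr_real)
  finally show ?thesis .
qed

lemma norm_MP_kernel_zero_le:
  assumes "\<bar>v\<bar> \<le> \<theta>" "\<theta> < pi" "\<nu> > 0"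
  shows "norm (MP_kernel \<nu> 0 (of_real u + \<i> * of_real v)) \<le>
    cos (\<theta> / 2) powr (- \<nu>) * exp (- (\<nu> / 2) * \<bar>u\<bar>)"
  using norm_cosh_half_powr_le[OF assms, of u] by (simp add: MP_kernel_def)

text \<open>The function \<open>x powr c * exp (- x)\<close> is largest at
  \<open>x = c\<close>.\<close>

lemma powr_le_const_mult_exp:
  fixes c x :: real
  assumes "c > 0" "x > 0"
  shows "x powr c \<le> c powr c * exp x"
proof -
  have "ln (x / c) \<le> x / c - 1" using assms by (intro ln_le_minus_one) auto
  then have "c * ln (x / c) \<le> c * (x / c)" using assms by (intro mult_left_mono) auto
  then have "c * ln x \<le> c * ln c + x" using assms by (simp add: ln_div algebra_simps)
  then have "exp (c * ln x) \<le> exp (c * ln c + x)" by simp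
  then show ?thesis using assms by (simp add: powr_def exp_add)
qed

text \<open>Decay in \<open>n\<close> is bought with growth in \<open>u\<close>: the bound of
  \<open>norm_tanh_half_power_le\<close> is an exponential of minus a multiple of
  \<open>n * exp (- |u|)\<close>, hence at most a constant times any negative power of that
  quantity. The exponent \<open>c\<close> is the price, and it is chosen differently for
  integrability, for the coefficients and for the expansion on the axis.\<close>

lemma norm_MP_kernel_le:
  assumes "0 \<le> \<theta>" "\<theta> < pi / 2" "\<nu> > 0" "c > 0"
  obtains C where "C > 0" "\<And>n u v. \<bar>v\<bar> \<le> \<theta> \<Longrightarrow>
    norm (MP_kernel \<nu> n (of_real u + \<i> * of_real v)) \<le>
      C * real (n + 1) powr (- c) * exp ((c - \<nu> / 2) * \<bar>u\<bar>)"
proof -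
  define k where "k = cos \<theta> / 2"
  define A where "A = cos (\<theta> / 2) powr (- \<nu>)"
  define C where "C = A * exp k * (c powr c * k powr (- c))"
  have k0: "k > 0" unfolding k_def using assms by (intro divide_pos_pos cos_gt_zero_pi) auto
  have A0: "A > 0" unfolding A_def using assms cos_gt_zero_pi[of "\<theta> / 2"] by auto
  have "norm (MP_kernel \<nu> n (of_real u + \<i> * of_real v)) \<le>
      C * real (n + 1) powr (- c) * exp ((c - \<nu> / 2) * \<bar>u\<bar>)" if v: "\<bar>v\<bar> \<le> \<theta>" for n u v
  proof -
    define E where "E = exp (- \<bar>u\<bar>)"
    have E: "0 < E" "E \<le> 1" by (auto simp: E_def)
    define X where "X = k * (real (n + 1) * E)"
    have X0: "X > 0" using k0 E by (simp add: X_def)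
    \<comment> \<open>Replacing \<open>n\<close> by \<open>n + 1\<close> costs a factor
      \<open>exp k\<close>, because \<open>E \<le> 1\<close>; it keeps \<open>X\<close> positive
      also for \<open>n = 0\<close>.\<close>
    have "- k * real n * E \<le> k + - X" using k0 E by (simp add: X_def algebra_simps)
    then have "exp (- k * real n * E) \<le> exp k * exp (- X)" by (simp flip: exp_add)
    also have "exp (- X) \<le> c powr c * X powr (- c)"
      using powr_le_const_mult_exp[OF assms(4) X0] X0
      by (simp add: exp_minus powr_minus field_simps)
    also have "X powr (- c) = k powr (- c) * (real (n + 1) powr (- c) * exp (c * \<bar>u\<bar>))"
      using k0 by (simp add: X_def E_def powr_mult exp_powr_real mult.commute[of c])
    finally have 1: "exp (- k * real n * E) \<le>
       exp k * (c powr c * (k powr (- c) * (real (n + 1) powr (- c) * exp (c * \<bar>u\<bar>))))"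
      by simp
    have "norm (MP_kernel \<nu> n (of_real u + \<i> * of_real v)) \<le>
        (A * exp (- (\<nu> / 2) * \<bar>u\<bar>)) * exp (- k * real n * E)"
      unfolding MP_kernel_def norm_mult norm_power norm_minus_cancel A_def k_def E_def
      using v assms A0
      by (intro mult_mono norm_cosh_half_powr_le norm_tanh_half_power_le) auto
    also have "\<dots> \<le> (A * exp (- (\<nu> / 2) * \<bar>u\<bar>)) *
      (exp k * (c powr c * (k powr (- c) * (real (n + 1) powr (- c) * exp (c * \<bar>u\<bar>)))))"
      using A0 1 by (intro mult_left_mono) auto
    also have "\<dots> = C * real (n + 1) powr (- c) * (exp (c * \<bar>u\<bar>) * exp (- (\<nu> / 2) * \<bar>u\<bar>))"
      by (simp only: C_def mult_ac)
    also have "exp (c * \<bar>u\<bar>) * exp (- (\<nu> / 2) * \<bar>u\<bar>) = exp ((c - \<nu> / 2) * \<bar>u\<bar>)"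
      by (simp add: algebra_simps flip: exp_add)
    finally show ?thesis .
  qed
  moreover have "C > 0" using A0 k0 assms by (simp add: C_def)
  ultimately show ?thesis using that by blast
qed

text \<open>This takes \<open>c = \<nu> / 4\<close> in \<open>norm_MP_kernel_le\<close>; any value
  strictly between 0 and \<open>\<nu> / 2\<close> leaves exponential decay in \<open>u\<close> after
  the power of \<open>n + 1\<close> is estimated by 1.\<close>

lemma norm_MP_kernel_le_exp:
  assumes "0 \<le> \<theta>" "\<theta> < pi / 2" and \<nu>: "\<nu> > 0"
  obtains A where "A > 0" "\<And>n u v. \<bar>v\<bar> \<le> \<theta> \<Longrightarrow>
    norm (MP_kernel \<nu> n (of_real u + \<i> * of_real v)) \<le> A * exp (- (\<nu> / 4) * \<bar>u\<bar>)"
proof -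
  obtain A where A: "A > 0" "\<And>n u v. \<bar>v\<bar> \<le> \<theta> \<Longrightarrow> norm (MP_kernel \<nu> n (of_real u + \<i> * of_real v)) \<le>
      A * real (n + 1) powr (- (\<nu> / 4)) * exp ((\<nu> / 4 - \<nu> / 2) * \<bar>u\<bar>)"
    using norm_MP_kernel_le[OF assms, of "\<nu> / 4"] \<nu> by auto
  have "norm (MP_kernel \<nu> n (of_real u + \<i> * of_real v)) \<le> A * exp (- (\<nu> / 4) * \<bar>u\<bar>)"
    if "\<bar>v\<bar> \<le> \<theta>" for n u v
  proof -
    have "real (n + 1) powr (- (\<nu> / 4)) \<le> real (n + 1) powr 0" using \<nu> by (intro powr_mono) auto
    then have "A * real (n + 1) powr (- (\<nu> / 4)) * exp ((\<nu> / 4 - \<nu> / 2) * \<bar>u\<bar>) \<le>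
        A * 1 * exp ((\<nu> / 4 - \<nu> / 2) * \<bar>u\<bar>)"
      using A(1) by (intro mult_right_mono mult_left_mono) auto
    then show ?thesis using A(2)[OF that, of n u] by simp
  qed
  then show ?thesis using that A(1) by blast
qed

section \<open>Fourier transform of the kernel\<close>

lemma measurable_MP_kernel [measurable]:
  "(\<lambda>y :: real. MP_kernel \<nu> n (of_real y)) \<in> borel_measurable borel"
  by (intro borel_measurable_continuous_onI
        continuous_on_compose2[OF holomorphic_on_imp_continuous_on[OF holomorphic_on_MP_kernel]])
     (auto intro!: continuous_intros)

text \<open>Euler's integral after the substitution \<open>t = exp a\<close>. On the additive line
  the scalings of the classical proof of the beta integral become translations, under which
  \<open>lborel\<close> is invariant.\<close>

lemma Gamma_integral_exp:
  assumes p: "Re p > 0"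
  shows "integrable lborel (\<lambda>a :: real. exp (p * of_real a - of_real (exp a)))"
    "(\<integral>a. exp (p * of_real a - of_real (exp a)) \<partial>lborel) = Gamma p"
proof -
  let ?f = "\<lambda>t :: real. of_real t powr (p - 1) / complex_of_real (exp t)"
  let ?c = "Re p"
  show int: "integrable lborel (\<lambda>a :: real. exp (p * of_real a - of_real (exp a)))"
  proof (rule integrable_lborel_dominated[OF p])
    fix a :: real
    have n: "norm (exp (p * of_real a - of_real (exp a))) = exp (?c * a) * exp (- exp a)"
      by (simp add: norm_exp_eq_Re flip: exp_add)
    show "norm (exp (p * of_real a - of_real (exp a))) \<le>
        max 1 ((2 * ?c) powr (2 * ?c)) * exp (- ?c * \<bar>a\<bar>)"
    proof (cases "a \<le> 0")
      case True
      have "exp (?c * a) * exp (- exp a) \<le> exp (?c * a) * 1" by (intro mult_left_mono) auto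
      also have "\<dots> \<le> max 1 ((2 * ?c) powr (2 * ?c)) * exp (- ?c * \<bar>a\<bar>)"
        using True by simp
      finally show ?thesis using n by simp
    next
      case False
      \<comment> \<open>The exponent is twice \<open>?c\<close> so that, against the factor
        \<open>exp (?c * a)\<close>, a decay \<open>exp (- ?c * a)\<close> remains.\<close>
      have "exp a powr (2 * ?c) \<le> (2 * ?c) powr (2 * ?c) * exp (exp a)"
        using p by (intro powr_le_const_mult_exp) auto
      then have "exp (- exp a) \<le> (2 * ?c) powr (2 * ?c) * exp (- (2 * ?c * a))"
        by (simp add: exp_powr_real exp_minus field_simps)
      then have "exp (?c * a) * exp (- exp a) \<le>
          exp (?c * a) * ((2 * ?c) powr (2 * ?c) * exp (- (2 * ?c * a)))"
        by (intro mult_left_mono) auto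
      also have "\<dots> = (2 * ?c) powr (2 * ?c) * (exp (?c * a) * exp (- (2 * ?c * a)))" by simp
      also have "exp (?c * a) * exp (- (2 * ?c * a)) = exp (- ?c * \<bar>a\<bar>)"
        using False by (simp flip: exp_add)
      also have "(2 * ?c) powr (2 * ?c) * exp (- ?c * \<bar>a\<bar>) \<le>
          max 1 ((2 * ?c) powr (2 * ?c)) * exp (- ?c * \<bar>a\<bar>)" by (intro mult_right_mono) auto
      finally show ?thesis using n by simp
    qed
  qed measurable
  have comp: "exp a *\<^sub>R ?f (exp a) = exp (p * of_real a - of_real (exp a))" for a :: real
    by (simp add: powr_def scaleR_conv_of_real exp_diff algebra_simps flip: exp_of_real)
  have A: "set_integrable lborel {0<..} ?f"
    using absolutely_integrable_Gamma_integral'[OF p]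
    unfolding set_integrable_def by (subst (asm) integrable_completion) auto
  have "interval_lebesgue_integral lborel 0 \<infinity> ?f = (LBINT x=-\<infinity>..\<infinity>. exp x *\<^sub>R ?f (exp x))"
  proof (rule interval_integral_substitution_integrable)
    show "(-\<infinity> :: ereal) < \<infinity>" by simp
    show "(exp has_real_derivative exp x) (at x)" for x :: real by (rule DERIV_exp)
    show "isCont ?f (exp x)" for x :: real
      by (intro continuous_intros) (auto simp: complex_nonpos_Reals_iff)
    show "((ereal \<circ> exp \<circ> real_of_ereal) \<longlongrightarrow> 0) (at_right (- \<infinity>))"
      using exp_at_bot by (simp add: at_right_MInf filterlim_filtermap o_def zero_ereal_def)
    show "((ereal \<circ> exp \<circ> real_of_ereal) \<longlongrightarrow> \<infinity>) (at_left \<infinity>)"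
      using exp_at_top by (simp add: at_left_PInf filterlim_filtermap o_def tendsto_PInfty_eq_at_top)
    show "set_integrable lborel (einterval (- \<infinity>) \<infinity>) (\<lambda>x. exp x *\<^sub>R ?f (exp x))"
      using int unfolding comp by (simp add: set_integrable_def einterval_eq_UNIV)
    show "set_integrable lborel (einterval 0 \<infinity>) ?f"
      using A by (simp add: zero_ereal_def)
  qed auto
  then have "(\<integral>a. exp (p * of_real a - of_real (exp a)) \<partial>lborel) = (LBINT x:{0<..}. ?f x)"
    unfolding comp
    by (simp add: interval_lebesgue_integral_def einterval_eq_UNIV set_lebesgue_integral_def zero_ereal_def)
  also have "\<dots> = Gamma p"
    using set_borel_integral_eq_integral(2)[OF A] Gamma_integral_complex'[OF p]
    by (simp add: integral_unique)
  finally show "(\<integral>a. exp (p * of_real a - of_real (exp a)) \<partial>lborel) = Gamma p" .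
qed

lemma lborel_integral_translate:
  fixes f :: "real \<Rightarrow> 'a :: {banach, second_countable_topology}"
  shows "integral\<^sup>L lborel f = (\<integral>x. f (t + x) \<partial>lborel)"
  using lborel_integral_real_affine[of 1 f t] by simp

lemma lborel_integrable_translate:
  fixes f :: "real \<Rightarrow> 'a :: {banach, second_countable_topology}"
  assumes "integrable lborel f"
  shows "integrable lborel (\<lambda>x. f (t + x))"
  using lborel_integrable_real_affine[OF assms, of 1 t] by simp

text \<open>The beta integral in the variable \<open>y = ln (u / (1 - u))\<close>.\<close>

lemma MP_kernel_zero_fourier:
  assumes \<nu>: "\<nu> > 0"
  shows "(\<integral>y. iexp (\<tau> * y) * MP_kernel \<nu> 0 (of_real y) \<partial>lborel) =
    Gamma (of_real \<nu> / 2 + \<i> * of_real \<tau>) * Gamma (of_real \<nu> / 2 - \<i> * of_real \<tau>) / Gamma (of_real \<nu>)"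
proof -
  define p where "p = of_real \<nu> / 2 + \<i> * of_real \<tau>"
  define q where "q = of_real \<nu> / 2 - \<i> * of_real \<tau>"
  define h where "h = (\<lambda>p (a :: real). exp (p * of_real a - of_real (exp a)) :: complex)"
  define F where "F = (\<lambda>c y. h p (c + y) * h q c)"
  have Re: "Re p > 0" "Re q > 0" "Re (complex_of_real \<nu>) > 0" using \<nu> by (auto simp: p_def q_def)
  have h: "integrable lborel (h r)" "integral\<^sup>L lborel (h r) = Gamma r" if "Re r > 0" for r
    using Gamma_integral_exp[OF that] by (simp_all add: h_def)
  have [measurable]: "h r \<in> borel_measurable borel" for r unfolding h_def by measurable
  have nh: "norm (h r a) = exp (Re r * a - exp a)" for r a by (simp add: h_def norm_exp_eq_Re)
  \<comment> \<open>A majorant of product form is available in \<open>c + y\<close> and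
    \<open>c\<close>, not in \<open>y\<close> and \<open>c\<close>. Integrability on the plane is
    therefore shown by integrating the norm over \<open>y\<close> first, with a translation.\<close>
  have Fint: "integrable (lborel \<Otimes>\<^sub>M lborel) (case_prod F)"
  proof (rule lborel_pair.Fubini_integrable)
    show "case_prod F \<in> borel_measurable (lborel \<Otimes>\<^sub>M lborel)" unfolding F_def by measurable
    have i: "integrable lborel (\<lambda>y. F c y)" for c
      using lborel_integrable_translate[OF h(1)[OF Re(1)], of c] by (simp add: F_def)
    then show "AE x in lborel. integrable lborel (\<lambda>y. case_prod F (x, y))" by (intro AE_I2) auto
    have "(\<integral>y. norm (case_prod F (c, y)) \<partial>lborel) = (\<integral>a. norm (h p a) \<partial>lborel) * norm (h q c)" for c
      using lborel_integral_translate[of "\<lambda>a. norm (h p a)" c] by (simp add: F_def norm_mult)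
    then show "integrable lborel (\<lambda>c. \<integral>y. norm (case_prod F (c, y)) \<partial>lborel)"
      using h(1)[OF Re(2)] by simp
  qed
  have inner: "(\<integral>c. F c y \<partial>lborel) = Gamma (of_real \<nu>) * (iexp (\<tau> * y) * MP_kernel \<nu> 0 (of_real y))" for y
  proof -
    \<comment> \<open>Translating \<open>c\<close> by \<open>- L\<close> turns
      \<open>exp (c + y) + exp c\<close> into \<open>exp c\<close>, so the integral over
      \<open>c\<close> becomes Euler's integral for \<open>\<nu> = p + q\<close>.\<close>
    define L where "L = ln (1 + exp y)"
    have eL: "exp L = 1 + exp y" by (simp add: L_def add_pos_pos)
    have "F (- L + c) y = exp (p * of_real y - of_real (\<nu> * L)) * h (of_real \<nu>) c" for c
    proof -
      have "exp (- L + c + y) + exp (- L + c) = exp (c - L) * exp L"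
        unfolding eL by (simp add: algebra_simps flip: exp_add)
      also have "\<dots> = exp c" by (simp flip: exp_add)
      finally have e: "complex_of_real (exp (- L + c + y)) + of_real (exp (- L + c)) = of_real (exp c)"
        by (metis of_real_add)
      have "F (- L + c) y = exp (p * of_real (- L + c + y) + q * of_real (- L + c) -
          (of_real (exp (- L + c + y)) + of_real (exp (- L + c))))"
        unfolding F_def h_def exp_add[symmetric] by (simp add: algebra_simps)
      also have "p * of_real (- L + c + y) + q * of_real (- L + c) =
          p * of_real y - of_real (\<nu> * L) + of_real \<nu> * of_real c"
        by (simp add: p_def q_def field_simps)
      finally show ?thesis unfolding e h_def exp_add[symmetric] by (simp add: algebra_simps)
    qed
    then have "(\<integral>c. F c y \<partial>lborel) = exp (p * of_real y - of_real (\<nu> * L)) * Gamma (of_real \<nu>)"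
      using lborel_integral_translate[of "\<lambda>c. F c y" "- L"] h(2)[OF Re(3)] by simp
    moreover have "exp (p * of_real y - of_real (\<nu> * L)) = iexp (\<tau> * y) * MP_kernel \<nu> 0 (of_real y)"
    proof -
      have "2 * cosh (y / 2) = exp (- y / 2) * exp L"
        unfolding eL by (simp add: cosh_def algebra_simps flip: exp_add)
      then have "(2 * cosh (y / 2)) powr (- \<nu>) = exp (\<nu> / 2 * y - \<nu> * L)"
        by (simp add: powr_def ln_mult algebra_simps)
      then have "MP_kernel \<nu> 0 (of_real y) = exp (of_real (\<nu> / 2 * y - \<nu> * L))"
        unfolding exp_of_real by (simp add: MP_kernel_of_real)
      then show ?thesis by (simp add: p_def algebra_simps flip: exp_add)
    qed
    ultimately show ?thesis by simp
  qed
  have "Gamma p * Gamma q = (\<integral>c. Gamma p * h q c \<partial>lborel)" using h(2)[OF Re(2)] by simp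
  also have "\<dots> = (\<integral>c. (\<integral>y. F c y \<partial>lborel) \<partial>lborel)"
    using lborel_integral_translate[of "h p"] h(2)[OF Re(1)] by (simp add: F_def)
  also have "\<dots> = (\<integral>y. (\<integral>c. F c y \<partial>lborel) \<partial>lborel)"
    by (rule lborel_pair.Fubini_integral[OF Fint, symmetric])
  also have "\<dots> = Gamma (of_real \<nu>) * (\<integral>y. iexp (\<tau> * y) * MP_kernel \<nu> 0 (of_real y) \<partial>lborel)"
    unfolding inner by (rule integral_mult_right_zero)
  finally have "Gamma p * Gamma q = Gamma (of_real \<nu>) * (\<integral>y. iexp (\<tau> * y) * MP_kernel \<nu> 0 (of_real y) \<partial>lborel)" .
  moreover have "Gamma (complex_of_real \<nu>) \<noteq> 0"
    using \<nu> by (simp add: Gamma_complex_of_real Gamma_real_pos less_imp_neq[symmetric])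
  ultimately show ?thesis by (simp add: p_def q_def field_simps)
qed

lemma integral_derivative_eq_0:
  fixes F :: "real \<Rightarrow> complex"
  assumes "\<And>y. (F has_vector_derivative F' y) (at y)" "continuous_on UNIV F'" "integrable lborel F'"
    and "(F \<longlongrightarrow> 0) at_bot" "(F \<longlongrightarrow> 0) at_top"
  shows "integral\<^sup>L lborel F' = 0"
proof -
  have "(LBINT x=-\<infinity>..\<infinity>. F' x) = 0 - 0"
    by (rule interval_integral_FTC_integrable[where F = F])
       (use assms in \<open>auto simp: set_integrable_def einterval_eq_UNIV at_right_MInf at_left_PInf
          filterlim_filtermap o_def continuous_on_eq_continuous_at\<close>)
  then show ?thesis
    by (simp add: interval_lebesgue_integral_def einterval_eq_UNIV set_lebesgue_integral_def)
qed

lemma integrable_iexp_MP_kernel: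
  assumes "\<nu> > 0"
  shows "integrable lborel (\<lambda>y. iexp (\<tau> * y) * MP_kernel \<nu> n (of_real y))"
proof (rule integrable_lborel_dominated)
  show "\<nu> / 2 > 0" using assms by simp
  show "(\<lambda>y. iexp (\<tau> * y) * MP_kernel \<nu> n (of_real y)) \<in> borel_measurable borel" by measurable
  show "norm (iexp (\<tau> * y) * MP_kernel \<nu> n (of_real y)) \<le>
      cos (0 / 2) powr (- \<nu>) * exp (- (\<nu> / 2) * \<bar>y\<bar>)" for y
  proof -
    have "norm (MP_kernel \<nu> n (of_real y)) = norm (MP_kernel \<nu> 0 (of_real y)) * \<bar>tanh (y / 2)\<bar> ^ n"
      unfolding MP_kernel_of_real norm_of_real by (simp add: abs_mult power_abs)
    also have "\<dots> \<le> norm (MP_kernel \<nu> 0 (of_real y)) * 1"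
      using tanh_real_bounds[of "y / 2"] by (intro mult_left_mono power_le_one) auto
    finally show ?thesis using norm_MP_kernel_zero_le[of 0 0 \<nu> y] assms by (simp add: norm_mult)
  qed
qed

text \<open>In terms of \<open>u = (1 + tanh (y / 2)) / 2\<close> the kernel contains
  \<open>(1 - 2 u)^n\<close>. The integrals \<open>E k\<close> with \<open>u^k\<close> in its place
  satisfy a first-order recursion by integration by parts, whose solution
  \<open>E 0 * (p)_k / (\<nu>)_k\<close> turns the binomial expansion into the terminating
  hypergeometric sum.\<close>

theorem MP_kernel_fourier:
  assumes \<nu>: "\<nu> > 0"
  shows "of_real (pochhammer \<nu> n / fact n) * (\<integral>y. iexp (\<tau> * y) * MP_kernel \<nu> n (of_real y) \<partial>lborel) =
    (\<integral>y. iexp (\<tau> * y) * MP_kernel \<nu> 0 (of_real y) \<partial>lborel) * MP_poly \<nu> n (\<i> * of_real \<tau>)"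
proof -
  define W where "W = (\<lambda>y :: real. (2 * cosh (y / 2)) powr (- \<nu>))"
  \<comment> \<open>The logistic function \<open>1 / (1 + exp (- y))\<close>. Its derivative is
    \<open>u * (1 - u)\<close> and that of \<open>W\<close> is
    \<open>\<nu> / 2 * (1 - 2 * u) * W\<close>, so the derivative of \<open>\<Phi> k\<close> is a
    combination of \<open>\<Phi> k\<close> and \<open>\<Phi> (Suc k)\<close>.\<close>
  define u where "u = (\<lambda>y :: real. (1 + tanh (y / 2)) / 2)"
  define p where "p = \<i> * of_real \<tau> + complex_of_real \<nu> / 2"
  define \<Phi> where "\<Phi> = (\<lambda>k y. iexp (\<tau> * y) * of_real (W y * u y ^ k))"
  define E where "E = (\<lambda>k. integral\<^sup>L lborel (\<Phi> k))"
  have u: "0 < u y" "u y < 1" for y using tanh_real_bounds[of "y / 2"] by (auto simp: u_def)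
  have W: "0 < W y" "W y \<le> exp (- (\<nu> / 2) * \<bar>y\<bar>)" for y
    using norm_MP_kernel_zero_le[of 0 0 \<nu> y] \<nu> MP_kernel_of_real[of \<nu> 0 y] by (auto simp: W_def)
  have n\<Phi>: "norm (\<Phi> k y) \<le> 1 * exp (- (\<nu> / 2) * \<bar>y\<bar>)" for k y
  proof -
    have "norm (\<Phi> k y) = W y * u y ^ k" using u W by (simp add: \<Phi>_def norm_mult norm_power less_imp_le abs_of_pos)
    also have "\<dots> \<le> W y * 1" using u[of y] W[of y] by (intro mult_left_mono power_le_one) auto
    finally show ?thesis using W(2)[of y] by simp
  qed
  have dW: "(W has_real_derivative \<nu> / 2 * (1 - 2 * u y) * W y) (at y)" for y
  proof -
    have "((\<lambda>y. exp (- \<nu> * ln (2 * cosh (y / 2)))) has_real_derivative \<nu> / 2 * (1 - 2 * u y) * W y) (at y)"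
      by (auto intro!: derivative_eq_intros simp: u_def W_def powr_def tanh_def field_simps)
    then show ?thesis by (simp add: W_def powr_def)
  qed
  have du: "(u has_real_derivative u y * (1 - u y)) (at y)" for y
    unfolding u_def by (auto intro!: derivative_eq_intros simp: power2_eq_square field_simps)
  have cont\<Phi>: "continuous_on UNIV (\<Phi> k)" for k
  proof -
    have "continuous_on UNIV W" "continuous_on UNIV u"
      by (intro continuous_at_imp_continuous_on ballI DERIV_isCont[OF dW] DERIV_isCont[OF du])+
    then show ?thesis unfolding \<Phi>_def by (intro continuous_intros) auto
  qed
  have int\<Phi>: "integrable lborel (\<Phi> k)" for k
    using \<nu> by (intro integrable_lborel_dominated[OF _ _ n\<Phi>] borel_measurable_continuous_onI cont\<Phi>) auto
  have d\<Phi>: "(\<Phi> k has_vector_derivative (p + of_nat k) * \<Phi> k y - (of_real \<nu> + of_nat k) * \<Phi> (Suc k) y) (at y)" for k y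
  proof -
    have r: "((\<lambda>y. W y * u y ^ k) has_real_derivative
        (\<nu> / 2 * (1 - 2 * u y) + of_nat k * (1 - u y)) * (W y * u y ^ k)) (at y)"
    proof -
      have "((\<lambda>y. u y ^ k) has_real_derivative of_nat k * (1 - u y) * u y ^ k) (at y)"
        by (rule DERIV_cong[OF DERIV_power[OF du]]) (cases k; simp)
      from DERIV_mult[OF dW this] show ?thesis
        by (rule DERIV_cong) (simp add: algebra_simps)
    qed
    have e: "((\<lambda>y :: real. iexp (\<tau> * y)) has_vector_derivative \<i> * of_real \<tau> * iexp (\<tau> * y)) (at y)"
    proof -
      have "((\<lambda>y :: real. of_real (\<tau> * y) * \<i>) has_vector_derivative of_real \<tau> * \<i>) (at y)"
        by (intro has_vector_derivative_mult_left has_vector_derivative_of_real)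
           (auto intro!: derivative_eq_intros)
      from field_vector_diff_chain_at[OF this DERIV_exp]
      show ?thesis by (simp add: o_def mult_ac)
    qed
    have "(\<Phi> k has_vector_derivative
       iexp (\<tau> * y) * of_real ((\<nu> / 2 * (1 - 2 * u y) + of_nat k * (1 - u y)) * (W y * u y ^ k)) +
       \<i> * of_real \<tau> * iexp (\<tau> * y) * of_real (W y * u y ^ k)) (at y)"
      unfolding \<Phi>_def using e has_vector_derivative_of_real[OF r] by (rule has_vector_derivative_mult)
    then show ?thesis
      by (rule has_vector_derivative_eq_rhs) (simp add: \<Phi>_def p_def algebra_simps)
  qed
  have lim: "(\<Phi> k \<longlongrightarrow> 0) at_bot" "(\<Phi> k \<longlongrightarrow> 0) at_top" for k
  proof -
    have l: "((\<lambda>y. 1 * exp (- (\<nu> / 2) * \<bar>y\<bar>)) \<longlongrightarrow> 0) at_bot"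
      "((\<lambda>y. 1 * exp (- (\<nu> / 2) * \<bar>y\<bar>)) \<longlongrightarrow> 0) at_top" using \<nu> by real_asymp+
    show "(\<Phi> k \<longlongrightarrow> 0) at_bot" "(\<Phi> k \<longlongrightarrow> 0) at_top"
      by (rule Lim_null_comparison[OF always_eventually[OF allI[OF n\<Phi>]]]; rule l)+
  qed
  have rec: "(p + of_nat k) * E k = (of_real \<nu> + of_nat k) * E (Suc k)" for k
  proof -
    have "(\<integral>y. (p + of_nat k) * \<Phi> k y - (of_real \<nu> + of_nat k) * \<Phi> (Suc k) y \<partial>lborel) = 0"
      using int\<Phi> by (intro integral_derivative_eq_0[OF d\<Phi> _ _ lim] continuous_intros cont\<Phi>) auto
    then show ?thesis using int\<Phi> by (simp add: E_def)
  qed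
  have nz: "pochhammer (of_real \<nu> :: complex) k \<noteq> 0" for k using \<nu> by (rule pochhammer_of_real_ne_0)
  have E: "E k = E 0 * (pochhammer p k / pochhammer (of_real \<nu>) k)" for k
  proof (induction k)
    case (Suc k)
    have "of_real \<nu> + of_nat k \<noteq> (0 :: complex)" using nz[of "Suc k"] by (auto simp: pochhammer_Suc)
    then have "E (Suc k) = E k * (p + of_nat k) / (of_real \<nu> + of_nat k)"
      using rec[of k] by (simp add: field_simps)
    then show ?case by (simp add: Suc pochhammer_Suc)
  qed auto
  have K: "iexp (\<tau> * y) * MP_kernel \<nu> n (of_real y) = (\<Sum>k\<le>n. of_nat (n choose k) * (-2) ^ k * \<Phi> k y)" for y n
  proof -
    have t: "- tanh (y / 2) = - 2 * u y + 1" by (simp add: u_def field_simps)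
    have "(- tanh (y / 2)) ^ n = (\<Sum>k\<le>n. of_nat (n choose k) * (-2) ^ k * u y ^ k)"
      unfolding t binomial_ring by (simp only: power_mult_distrib power_one mult_1_right mult.assoc)
    then have "MP_kernel \<nu> n (of_real y) =
        of_real (W y) * of_real (\<Sum>k\<le>n. of_nat (n choose k) * (-2) ^ k * u y ^ k)"
      by (simp add: MP_kernel_of_real W_def)
    then show ?thesis by (simp add: \<Phi>_def sum_distrib_left mult_ac)
  qed
  have L: "(\<integral>y. iexp (\<tau> * y) * MP_kernel \<nu> n (of_real y) \<partial>lborel) =
      (\<Sum>k\<le>n. of_nat (n choose k) * (-2) ^ k * E k)" for n
    unfolding K using int\<Phi> by (simp add: E_def)
  have "(\<integral>y. iexp (\<tau> * y) * MP_kernel \<nu> n (of_real y) \<partial>lborel) =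
      E 0 * (\<Sum>k\<le>n. of_nat (n choose k) * (-2) ^ k * (pochhammer p k / pochhammer (of_real \<nu>) k))"
    unfolding L sum_distrib_left by (intro sum.cong refl) (subst E, simp)
  moreover have "(\<integral>y. iexp (\<tau> * y) * MP_kernel \<nu> 0 (of_real y) \<partial>lborel) = E 0"
    using L[of 0] by simp
  ultimately show ?thesis
    unfolding MP_poly_binomial_sum[OF \<nu>] p_def by (simp add: mult_ac)
qed

section \<open>Decay of the coefficients\<close>

lemma borel_measurable_pair_mono:
  fixes F :: "real \<times> real \<Rightarrow> complex"
  assumes "(\<lambda>x. x) \<in> borel_measurable M1" "(\<lambda>x. x) \<in> borel_measurable M2"
    "F \<in> borel_measurable (borel \<Otimes>\<^sub>M borel)"
  shows "F \<in> borel_measurable (M1 \<Otimes>\<^sub>M M2)"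
proof -
  have "(\<lambda>z. (fst z, snd z)) \<in> measurable (M1 \<Otimes>\<^sub>M M2) (borel \<Otimes>\<^sub>M borel)"
    using measurable_compose[OF measurable_fst assms(1)] measurable_compose[OF measurable_snd assms(2)]
    by (rule measurable_Pair)
  from measurable_compose[OF this assms(3)] show ?thesis by simp
qed

section \<open>The estimate for one sign of \<open>Re y\<close>\<close>

abbreviation left_pt :: "real \<Rightarrow> real \<Rightarrow> complex" where
  "left_pt y v \<equiv> - of_real y + \<i> * of_real v"

text \<open>\<open>quarter_term f K \<theta> \<tau> y\<close> collects, for \<open>y \<ge> 0\<close> and \<open>\<tau> \<ge> 0\<close>, the contributions of \<open>f (i \<tau>)\<close> on
  the line \<open>Im = \<theta>\<close> and of \<open>f (- i \<tau>)\<close> on the line \<open>Im = - \<theta>\<close>, both left of the imaginary axis.\<close>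

definition quarter_term ::
    "(complex \<Rightarrow> complex) \<Rightarrow> (complex \<Rightarrow> complex) \<Rightarrow> real \<Rightarrow> real \<Rightarrow> real \<Rightarrow> complex" where
  "quarter_term f K \<theta> \<tau> y =
     f (\<i> * of_real \<tau>) * (exp (\<i> * of_real \<tau> * (left_pt y \<theta>)) * K (left_pt y \<theta>)) +
     f (- (\<i> * of_real \<tau>)) * (exp (- (\<i> * of_real \<tau>) * (left_pt y (- \<theta>))) * K (left_pt y (- \<theta>)))"

text \<open>The first summand comes from the two half-lines shifted to real part
  \<open>\<sigma>\<close>. The second is the length of the segment from 0 to
  \<open>\<sigma>\<close>, times the bound for \<open>f\<close> there, times the length
  \<open>2 * \<theta>\<close> of a vertical side. Nothing here refers to \<open>K\<close>, so for a
  family of kernels only \<open>B\<close> varies with \<open>n\<close>.\<close>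

definition quarter_const :: "real \<Rightarrow> real \<Rightarrow> real \<Rightarrow> real \<Rightarrow> real \<Rightarrow> real" where
  "quarter_const \<sigma> r \<theta> Cf \<epsilon> = 2 * Cf * (\<integral>\<tau>. exp (- (\<theta> - r) * \<tau>) \<partial>half_line) * (\<integral>y. exp (- \<epsilon> * y) \<partial>half_line) +
      \<sigma> * (Cf * (2 * \<theta>))"

text \<open>The two bounds on \<open>K\<close> have different tasks: \<open>K_bound\<close> gives
  absolute convergence, and \<open>K_bound'\<close> gives the size of the result. The latter may
  grow at the rate \<open>\<sigma> - \<epsilon>\<close>, which the factor
  \<open>exp (- \<sigma> * y)\<close> gained by shifting \<open>f\<close> outweighs.\<close>

locale quarter_setup =
  fixes f K :: "complex \<Rightarrow> complex" and m \<sigma> r \<theta> Cf A a B \<epsilon> :: real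
  assumes f_hol: "f holomorphic_on {z. \<bar>Re z\<bar> < m}"
    and f_bound: "\<And>x \<tau>. \<bar>x\<bar> \<le> \<sigma> \<Longrightarrow> norm (f (of_real x + \<i> * of_real \<tau>)) \<le> Cf * exp (r * \<bar>\<tau>\<bar>)"
    and \<sigma>: "0 < \<sigma>" "\<sigma> < m"
    and \<theta>: "0 \<le> r" "r < \<theta>" "\<theta> < pi"
    and K_hol: "K holomorphic_on {z. \<bar>Im z\<bar> < pi}"
    and a: "a > 0" and \<epsilon>: "\<epsilon> > 0"
    and K_bound: "\<And>y v. \<bar>v\<bar> \<le> \<theta> \<Longrightarrow> norm (K (of_real y + \<i> * of_real v)) \<le> A * exp (- a * \<bar>y\<bar>)"
    and K_bound': "\<And>y v. \<bar>v\<bar> \<le> \<theta> \<Longrightarrow> norm (K (of_real y + \<i> * of_real v)) \<le> B * exp ((\<sigma> - \<epsilon>) * \<bar>y\<bar>)"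
begin

lemma Cf_nonneg: "Cf \<ge> 0"
  using order_trans[OF norm_ge_zero f_bound[of 0 0]] \<sigma> by simp

lemma continuous_f: "continuous_on {z. \<bar>Re z\<bar> < m} f"
  using f_hol by (rule holomorphic_on_imp_continuous_on)

lemma continuous_K: "continuous_on {z. \<bar>Im z\<bar> < pi} K"
  using K_hol by (rule holomorphic_on_imp_continuous_on)

lemma measurable_f [measurable]:
  "(\<lambda>\<tau> :: real. f (\<i> * of_real \<tau>)) \<in> borel_measurable borel"
  "(\<lambda>\<tau> :: real. f (- (\<i> * of_real \<tau>))) \<in> borel_measurable borel"
  using \<sigma> by (intro borel_measurable_continuous_onI continuous_on_compose2[OF continuous_f] continuous_intros; auto)+

lemma measurable_K:
  "\<bar>v\<bar> \<le> \<theta> \<Longrightarrow> (\<lambda>y :: real. K (left_pt y v)) \<in> borel_measurable borel"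
  using \<theta> by (intro borel_measurable_continuous_onI continuous_on_compose2[OF continuous_K] continuous_intros) auto

lemma measurable_K' [measurable]:
  "(\<lambda>y :: real. K (left_pt y \<theta>)) \<in> borel_measurable borel"
  "(\<lambda>y :: real. K (left_pt y (- \<theta>))) \<in> borel_measurable borel"
  using measurable_K[of \<theta>] measurable_K[of "- \<theta>"] \<theta> by simp_all

lemma norm_K_le:
  assumes "\<bar>v\<bar> \<le> \<theta>" "y \<ge> 0"
  shows "norm (K (left_pt y v)) \<le> A * exp (- a * y)"
    "norm (K (left_pt y v)) \<le> B * exp ((\<sigma> - \<epsilon>) * y)"
  using K_bound[OF assms(1), of "- y"] K_bound'[OF assms(1), of "- y"] assms(2) by auto

text \<open>The heights are paired with the signs of the argument of \<open>f\<close> so that both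
  exponentials have modulus \<open>exp (- \<theta> * \<tau>)\<close>, which beats
  \<open>exp (r * \<tau>)\<close>.\<close>

lemma norm_quarter_term_le:
  assumes "\<tau> \<ge> 0" "y \<ge> 0"
  shows "norm (quarter_term f K \<theta> \<tau> y) \<le> exp (- (\<theta> - r) * \<tau>) * (2 * Cf * A * exp (- a * y))"
proof -
  have f: "norm (f (\<i> * of_real \<tau>)) \<le> Cf * exp (r * \<tau>)" "norm (f (- (\<i> * of_real \<tau>))) \<le> Cf * exp (r * \<tau>)"
    using f_bound[of 0 \<tau>] f_bound[of 0 "- \<tau>"] assms \<sigma> by auto
  have e: "norm (exp (\<i> * of_real \<tau> * (left_pt y \<theta>))) = exp (- \<theta> * \<tau>)"
    "norm (exp (- (\<i> * of_real \<tau>) * (left_pt y (- \<theta>)))) = exp (- \<theta> * \<tau>)"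
    by (simp_all add: norm_exp_eq_Re mult.commute)
  have K: "norm (K (left_pt y \<theta>)) \<le> A * exp (- a * y)"
    "norm (K (left_pt y (- \<theta>))) \<le> A * exp (- a * y)"
    using norm_K_le(1)[of \<theta> y] norm_K_le(1)[of "- \<theta>" y] \<theta> assms by simp_all
  have g: "norm (u * (v * w)) \<le> k * (l * n)"
    if "norm u \<le> k" "norm v = l" "norm w \<le> n" for u v w :: complex and k l n :: real
    unfolding norm_mult using that
    by (auto intro!: mult_mono mult_nonneg_nonneg intro: order_trans[OF norm_ge_zero])
  have "norm (quarter_term f K \<theta> \<tau> y) \<le>
    (Cf * exp (r * \<tau>)) * (exp (- \<theta> * \<tau>) * (A * exp (- a * y))) +
    (Cf * exp (r * \<tau>)) * (exp (- \<theta> * \<tau>) * (A * exp (- a * y)))"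
    unfolding quarter_term_def by (intro order_trans[OF norm_triangle_ineq] add_mono g f e K)
  also have "\<dots> = (exp (r * \<tau>) * exp (- \<theta> * \<tau>)) * (2 * Cf * A * exp (- a * y))" by simp
  also have "exp (r * \<tau>) * exp (- \<theta> * \<tau>) = exp (- (\<theta> - r) * \<tau>)"
    by (simp add: algebra_simps flip: exp_add)
  finally show ?thesis .
qed

lemma measurable_quarter_term [measurable]:
  "case_prod (quarter_term f K \<theta>) \<in> borel_measurable (borel \<Otimes>\<^sub>M borel)"
  unfolding quarter_term_def [abs_def] by measurable

lemma quarter_term_Fubini:
  "(\<integral>\<tau>. (\<integral>y. quarter_term f K \<theta> \<tau> y \<partial>half_line) \<partial>half_line) =
   (\<integral>y. (\<integral>\<tau>. quarter_term f K \<theta> \<tau> y \<partial>half_line) \<partial>half_line)" (is ?T1)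
  "integrable half_line (\<lambda>\<tau>. \<integral>y. quarter_term f K \<theta> \<tau> y \<partial>half_line)" (is ?T2)
  "integrable half_line (\<lambda>y. \<integral>\<tau>. quarter_term f K \<theta> \<tau> y \<partial>half_line)" (is ?T3)
proof -
  have "(\<lambda>x. x) \<in> borel_measurable half_line" by simp
  note meas = borel_measurable_pair_mono[OF this this measurable_quarter_term]
  have "integrable half_line (\<lambda>\<tau>. exp (- (\<theta> - r) * \<tau>))"
    "integrable half_line (\<lambda>y. 2 * Cf * A * exp (- a * y))"
    using \<theta> integrable_half_line_exp[of "\<theta> - r"] integrable_half_line_exp[OF a] by simp_all
  note F = Fubini_product_dominated[OF sigma_finite_half_line sigma_finite_half_line meas this]
  show ?T1 ?T2 ?T3
    by (rule F; simp add: norm_quarter_term_le[simplified])+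
qed

lemma integrable_quarter_term:
  assumes "\<tau> \<ge> 0"
  shows "integrable half_line (quarter_term f K \<theta> \<tau>)"
proof (rule half_line_dominated(1)[OF a])
  show "quarter_term f K \<theta> \<tau> \<in> borel_measurable borel"
    unfolding quarter_term_def [abs_def] by measurable
  show "norm (quarter_term f K \<theta> \<tau> y) \<le> exp (- (\<theta> - r) * \<tau>) * (2 * Cf * A) * exp (- a * y)"
    if "y \<ge> 0" for y
    using norm_quarter_term_le[OF assms that] by (simp add: mult_ac)
qed

text \<open>Rotation by a right angle turns the vertical strip of \<open>f\<close> into the
  horizontal one of \<open>half_strip_integral_identity\<close>.\<close>

lemma holomorphic_rotated: "s = \<i> \<or> s = - \<i> \<Longrightarrow> (\<lambda>\<xi>. f (s * \<xi>) * exp (s * \<xi> * Y)) holomorphic_on {z. \<bar>Im z\<bar> < m}"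
proof -
  assume s: "s = \<i> \<or> s = - \<i>"
  have "(f \<circ> (\<lambda>\<xi>. s * \<xi>)) holomorphic_on {z. \<bar>Im z\<bar> < m}"
    by (rule holomorphic_on_compose_gen[OF _ f_hol]) (use s in \<open>auto intro!: holomorphic_intros\<close>)
  then show ?thesis by (auto simp: o_def intro!: holomorphic_intros)
qed

text \<open>Cauchy's theorem in the half-strip above the segment from 0 to \<open>\<sigma>\<close>.
  The gain is a factor \<open>exp (- \<sigma> * y)\<close> on the shifted half-line; the price is
  the segment integral, which lacks it.\<close>

lemma shift_upper:
  assumes "y \<ge> 0"
  defines "Y \<equiv> left_pt y \<theta>"
  shows "(\<integral>\<tau>. f (\<i> * of_real \<tau>) * exp (\<i> * of_real \<tau> * Y) \<partial>half_line) =
    (\<integral>\<tau>. f (of_real \<sigma> + \<i> * of_real \<tau>) * exp ((of_real \<sigma> + \<i> * of_real \<tau>) * Y) \<partial>half_line) -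
    \<i> * (LBINT x:{0..\<sigma>}. f (of_real x) * exp (of_real x * Y))"
proof -
  let ?G = "\<lambda>\<xi>. f (- \<i> * \<xi>) * exp (- \<i> * \<xi> * Y)"
  have "(\<integral>u. ?G (- of_real u + \<i> * of_real \<sigma>) \<partial>half_line) -
      (\<integral>u. ?G (- of_real u + \<i> * of_real 0) \<partial>half_line) = \<i> * (LBINT v:{0..\<sigma>}. ?G (\<i> * of_real v))"
  proof (rule half_strip_integral_identity)
    show "?G holomorphic_on {z. \<bar>Im z\<bar> < m}" by (rule holomorphic_rotated) simp
    show "\<theta> - r > 0" using \<theta> by simp
    fix u v :: real assume uv: "0 \<le> u" "0 \<le> v" "v \<le> \<sigma>"
    have "norm (?G (left_pt u v)) =
        norm (f (of_real v + \<i> * of_real u)) * exp (- v * y - u * \<theta>)"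
      by (simp add: norm_mult norm_exp_eq_Re Y_def algebra_simps)
    also have "\<dots> \<le> (Cf * exp (r * \<bar>u\<bar>)) * exp (- u * \<theta>)"
      using uv assms Cf_nonneg by (intro mult_mono f_bound) auto
    also have "\<dots> = Cf * exp (- (\<theta> - r) * u)" using uv by (simp add: algebra_simps flip: exp_add)
    finally show "norm (?G (left_pt u v)) \<le> Cf * exp (- (\<theta> - r) * u)" .
  qed (use \<sigma> in auto)
  then show ?thesis by (simp add: algebra_simps)
qed

text \<open>The mirror image of \<open>shift_upper\<close>, below the segment. The orientation is
  reversed, so the segment integral has the opposite sign, and together the two form the difference
  in \<open>bottom_term\<close>.\<close>

lemma shift_lower:
  assumes "y \<ge> 0"
  defines "Y \<equiv> left_pt y (- \<theta>)"
  shows "(\<integral>\<tau>. f (- (\<i> * of_real \<tau>)) * exp (- (\<i> * of_real \<tau>) * Y) \<partial>half_line) =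
    (\<integral>\<tau>. f (of_real \<sigma> - \<i> * of_real \<tau>) * exp ((of_real \<sigma> - \<i> * of_real \<tau>) * Y) \<partial>half_line) +
    \<i> * (LBINT x:{0..\<sigma>}. f (of_real x) * exp (of_real x * Y))"
proof -
  let ?G = "\<lambda>\<xi>. f (\<i> * \<xi>) * exp (\<i> * \<xi> * Y)"
  have "(\<integral>u. ?G (- of_real u + \<i> * of_real 0) \<partial>half_line) -
      (\<integral>u. ?G (- of_real u + \<i> * of_real (- \<sigma>)) \<partial>half_line) = \<i> * (LBINT v:{- \<sigma>..0}. ?G (\<i> * of_real v))"
  proof (rule half_strip_integral_identity)
    show "?G holomorphic_on {z. \<bar>Im z\<bar> < m}" by (rule holomorphic_rotated) simp
    show "\<theta> - r > 0" using \<theta> by simp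
    fix u v :: real assume uv: "0 \<le> u" "- \<sigma> \<le> v" "v \<le> 0"
    have "norm (?G (left_pt u v)) =
        norm (f (of_real (- v) + \<i> * of_real (- u))) * exp (v * y - u * \<theta>)"
      by (simp add: norm_mult norm_exp_eq_Re Y_def algebra_simps)
    also have "\<dots> \<le> (Cf * exp (r * \<bar>- u\<bar>)) * exp (- u * \<theta>)"
      using uv assms Cf_nonneg by (intro mult_mono f_bound) (auto simp: mult_le_0_iff)
    also have "\<dots> = Cf * exp (- (\<theta> - r) * u)" using uv by (simp add: algebra_simps flip: exp_add)
    finally show "norm (?G (left_pt u v)) \<le> Cf * exp (- (\<theta> - r) * u)" .
  qed (use \<sigma> in auto)
  moreover have "(LBINT v:{- \<sigma>..0}. ?G (\<i> * of_real v)) =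
      (LBINT x:{0..\<sigma>}. f (of_real x) * exp (of_real x * Y))"
    by (subst set_integral_reflect) (auto intro!: arg_cong2[where f = "set_lebesgue_integral lborel"])
  ultimately show ?thesis by (simp add: algebra_simps)
qed

text \<open>Clamping the argument of \<open>f\<close> to \<open>[0, \<sigma>]\<close> makes the term measurable on the whole plane.\<close>

definition bottom_term :: "real \<Rightarrow> real \<Rightarrow> complex" where
  "bottom_term y x =
     f (of_real (max 0 (min \<sigma> x))) *
      (exp (of_real x * (left_pt y \<theta>)) * K (left_pt y \<theta>) -
       exp (of_real x * (left_pt y (- \<theta>))) * K (left_pt y (- \<theta>)))"

definition segment :: "real measure" where
  "segment = restrict_space lborel {0..\<sigma>}"

lemma space_segment [simp]: "space segment = {0..\<sigma>}"
  by (simp add: segment_def space_restrict_space)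

lemma integral_segment: "integral\<^sup>L segment g = (LBINT x:{0..\<sigma>}. g x :: complex)"
  unfolding segment_def set_lebesgue_integral_def by (rule integral_restrict_space) auto

lemma integrable_segment_const: "integrable segment (\<lambda>x. c :: real)"
proof -
  have "emeasure lborel {0..\<sigma>} < top"
    using emeasure_compact_finite[of "{0..\<sigma>}"] by simp
  then have "finite_measure segment"
    by (intro finite_measureI) (simp add: segment_def emeasure_restrict_space space_restrict_space)
  then show ?thesis by (rule finite_measure.integrable_const)
qed

lemma bottom_Fubini:
  "(\<integral>y. (\<integral>x. bottom_term y x \<partial>segment) \<partial>half_line) = (\<integral>x. (\<integral>y. bottom_term y x \<partial>half_line) \<partial>segment)" (is ?T1)
  "integrable half_line (\<lambda>y. \<integral>x. bottom_term y x \<partial>segment)" (is ?T2)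
  "integrable segment (\<lambda>x. \<integral>y. bottom_term y x \<partial>half_line)" (is ?T3)
proof -
  have sf: "sigma_finite_measure segment"
    unfolding segment_def by (rule sigma_finite_measure_restrict_space[OF lborel.sigma_finite_measure_axioms]) auto
  have [measurable]: "(\<lambda>x. f (of_real (max 0 (min \<sigma> x)))) \<in> borel_measurable borel"
    using \<sigma> by (intro borel_measurable_continuous_onI continuous_on_compose2[OF continuous_f] continuous_intros) auto
  have meas: "case_prod bottom_term \<in> borel_measurable (borel \<Otimes>\<^sub>M borel)"
    unfolding bottom_term_def [abs_def] by measurable
  have seg: "(\<lambda>x. x) \<in> borel_measurable segment"
    unfolding segment_def by (rule measurable_restrict_space1) simp
  have le: "norm (bottom_term y x) \<le> exp (- a * y) * (2 * Cf * A)" if "y \<ge> 0" "0 \<le> x" "x \<le> \<sigma>" for y x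
  proof -
    have K: "norm (K (left_pt y \<theta>)) \<le> A * exp (- a * y)"
      "norm (K (left_pt y (- \<theta>))) \<le> A * exp (- a * y)"
      using norm_K_le(1)[of \<theta> y] norm_K_le(1)[of "- \<theta>" y] \<theta> that by simp_all
    have e: "norm (exp (of_real x * (left_pt y v))) \<le> 1" for v
      using that by (simp add: norm_exp_eq_Re)
    have f: "norm (f (of_real (max 0 (min \<sigma> x)))) \<le> Cf" using f_bound[of x 0] that by simp
    have "norm (bottom_term y x) \<le> Cf * (1 * (A * exp (- a * y)) + 1 * (A * exp (- a * y)))"
      unfolding bottom_term_def norm_mult
      by (intro mult_mono f order_trans[OF norm_triangle_ineq4] add_mono)
         (auto simp only: norm_mult intro!: mult_mono e K Cf_nonneg norm_ge_zero add_nonneg_nonneg mult_nonneg_nonneg)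
    then show ?thesis by (simp add: mult_ac)
  qed
  have "(\<lambda>x. x) \<in> borel_measurable half_line" by simp
  note meas' = borel_measurable_pair_mono[OF this seg meas]
  have "integrable segment (\<lambda>x. 2 * Cf * A)" by (rule integrable_segment_const)
  note F = Fubini_product_dominated[OF sigma_finite_half_line sf meas' integrable_half_line_exp[OF a] this]
  show ?T1 ?T2 ?T3
    by (rule F; simp add: le[simplified])+
qed

text \<open>For small \<open>x\<close> nothing compensates the growth in \<open>K_bound'\<close>, so
  an estimate under both integrals would fail. With \<open>x\<close> fixed, however, the integrals
  over \<open>y\<close> on the heights \<open>\<theta>\<close> and \<open>- \<theta>\<close> differ,
  by Cauchy's theorem, by an integral over the vertical segment at real part 0, where
  \<open>K_bound'\<close> gives just \<open>B\<close>.\<close>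

lemma norm_bottom_le:
  "norm (\<integral>y. (\<integral>x. bottom_term y x \<partial>segment) \<partial>half_line) \<le> B * (\<sigma> * (Cf * (2 * \<theta>)))"
proof -
  have le: "norm (\<integral>y. bottom_term y x \<partial>half_line) \<le> Cf * (B * (2 * \<theta>))" if x: "0 \<le> x" "x \<le> \<sigma>" for x
  proof -
    let ?G = "\<lambda>\<xi>. exp (of_real x * \<xi>) * K \<xi>"
    have bd: "norm (?G (left_pt u v)) \<le> A * exp (- a * u)"
      if "0 \<le> u" "\<bar>v\<bar> \<le> \<theta>" for u v
    proof -
      have "norm (?G (left_pt u v)) \<le> 1 * (A * exp (- a * u))"
        unfolding norm_mult using that x by (intro mult_mono norm_K_le) (auto simp: norm_exp_eq_Re)
      then show ?thesis by simp
    qed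
    have G: "integrable half_line (\<lambda>u. ?G (left_pt u v))" if v: "\<bar>v\<bar> \<le> \<theta>" for v
    proof (rule half_line_dominated(1)[OF a _ bd[OF _ v]])
      note [measurable] = measurable_K[OF v]
      show "(\<lambda>u. ?G (left_pt u v)) \<in> borel_measurable borel" by measurable
    qed
    have "(\<integral>u. ?G (left_pt u \<theta>) \<partial>half_line) -
      (\<integral>u. ?G (left_pt u (- \<theta>)) \<partial>half_line) = \<i> * (LBINT v:{- \<theta>..\<theta>}. ?G (\<i> * of_real v))"
      using \<theta> by (intro half_strip_integral_identity[where c = a and w = pi and C = A] bd a holomorphic_intros K_hol) auto
    moreover have "(\<integral>y. bottom_term y x \<partial>half_line) =
       f (of_real x) * ((\<integral>u. ?G (left_pt u \<theta>) \<partial>half_line) -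
      (\<integral>u. ?G (left_pt u (- \<theta>)) \<partial>half_line))"
      using G[of \<theta>] G[of "- \<theta>"] \<theta> x by (simp add: bottom_term_def)
    ultimately have eq: "(\<integral>y. bottom_term y x \<partial>half_line) =
       f (of_real x) * (\<i> * (LBINT v:{- \<theta>..\<theta>}. ?G (\<i> * of_real v)))" by simp
    have "norm (LBINT v:{- \<theta>..\<theta>}. ?G (\<i> * of_real v)) \<le> B * (\<theta> - (- \<theta>))"
    proof (rule norm_set_integral_Icc_le)
      show "- \<theta> \<le> \<theta>" using \<theta> by simp
      show "continuous_on {- \<theta>..\<theta>} (\<lambda>v. ?G (\<i> * of_real v))"
        using \<theta> by (intro continuous_intros continuous_on_compose2[OF continuous_K]) auto
      fix v assume "- \<theta> \<le> v" "v \<le> \<theta>"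
      then show "norm (?G (\<i> * of_real v)) \<le> B"
        using K_bound'[of v 0] by (simp add: norm_mult norm_exp_eq_Re)
    qed
    moreover have "norm (f (of_real x)) \<le> Cf" using f_bound[of x 0] x by simp
    ultimately have "norm (f (of_real x)) * (norm \<i> * norm (LBINT v:{- \<theta>..\<theta>}. ?G (\<i> * of_real v))) \<le>
        Cf * (1 * (B * (\<theta> - (- \<theta>))))"
      using Cf_nonneg by (intro mult_mono) auto
    then show ?thesis by (simp add: eq norm_mult)
  qed
  have "norm (\<integral>x. (\<integral>y. bottom_term y x \<partial>half_line) \<partial>segment) \<le>
      (\<integral>x. norm (\<integral>y. bottom_term y x \<partial>half_line) \<partial>segment)"
    by (rule integral_norm_bound)
  also have "\<dots> \<le> (\<integral>x. Cf * (B * (2 * \<theta>)) \<partial>segment)"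
    using bottom_Fubini(3) le by (intro integral_mono integrable_segment_const) auto
  also have "\<dots> = \<sigma> * (Cf * (B * (2 * \<theta>)))"
    using \<sigma> by (simp add: segment_def measure_restrict_space)
  finally show ?thesis unfolding bottom_Fubini(1) by (simp add: mult_ac)
qed

lemma norm_quarter_integral_le:
  "norm (\<integral>\<tau>. (\<integral>y. quarter_term f K \<theta> \<tau> y \<partial>half_line) \<partial>half_line) \<le>
    B * quarter_const \<sigma> r \<theta> Cf \<epsilon>"
proof -
  define I where "I = (\<integral>\<tau>. exp (- (\<theta> - r) * \<tau>) \<partial>half_line)"
  \<comment> \<open>Adding the segment terms undoes what \<open>shift_upper\<close> and
    \<open>shift_lower\<close> leave behind, so \<open>R y\<close> consists only of the integrals
    over the half-lines at real part \<open>\<sigma>\<close>.\<close>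
  define R where "R = (\<lambda>y. (\<integral>\<tau>. quarter_term f K \<theta> \<tau> y \<partial>half_line) + \<i> * (\<integral>x. bottom_term y x \<partial>segment))"
  have c: "\<theta> - r > 0" using \<theta> by simp
  have le: "norm (R y) \<le> (B * (2 * Cf * I)) * exp (- \<epsilon> * y)" if y: "y \<ge> 0" for y
  proof -
    define Y where "Y = left_pt y \<theta>"
    define Y' where "Y' = left_pt y (- \<theta>)"
    \<comment> \<open>The sign \<open>s\<close> covers the upper and the lower half-line at once.
      The case \<open>x = \<sigma>\<close> supplies the bounds and \<open>x = 0\<close> the
      integrability of the original integrands.\<close>
    have J: "integrable half_line (\<lambda>\<tau>. f (of_real x + \<i> * of_real (s * \<tau>)) *
        exp ((of_real x + \<i> * of_real (s * \<tau>)) * (- of_real y + \<i> * of_real (s * \<theta>))))"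
      "norm (\<integral>\<tau>. f (of_real x + \<i> * of_real (s * \<tau>)) *
        exp ((of_real x + \<i> * of_real (s * \<tau>)) * (- of_real y + \<i> * of_real (s * \<theta>))) \<partial>half_line) \<le>
        Cf * exp (- x * y) * I"
      if x: "\<bar>x\<bar> \<le> \<sigma>" and s: "s = 1 \<or> s = - 1" for x s
    proof -
      let ?g = "\<lambda>\<tau>. f (of_real x + \<i> * of_real (s * \<tau>)) *
        exp ((of_real x + \<i> * of_real (s * \<tau>)) * (- of_real y + \<i> * of_real (s * \<theta>)))"
      have meas: "?g \<in> borel_measurable borel"
        using \<sigma> x by (intro borel_measurable_continuous_onI continuous_intros continuous_on_compose2[OF continuous_f]) auto
      have le: "norm (?g \<tau>) \<le> Cf * exp (- x * y) * exp (- (\<theta> - r) * \<tau>)" if \<tau>: "\<tau> \<ge> 0" for \<tau>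
      proof -
        have 1: "norm (exp ((of_real x + \<i> * of_real (s * \<tau>)) * (- of_real y + \<i> * of_real (s * \<theta>)))) =
            exp (- x * y - \<theta> * \<tau>)"
          using s by (auto simp: norm_exp_eq_Re mult.commute)
        have "\<bar>s * \<tau>\<bar> = \<tau>" using s \<tau> by auto
        then have 2: "norm (f (of_real x + \<i> * of_real (s * \<tau>))) \<le> Cf * exp (r * \<tau>)"
          using f_bound[OF x, of "s * \<tau>"] by simp
        have "norm (?g \<tau>) \<le> (Cf * exp (r * \<tau>)) * exp (- x * y - \<theta> * \<tau>)"
          unfolding norm_mult 1 by (intro mult_right_mono 2) simp
        also have "\<dots> = Cf * exp (- x * y) * exp (- (\<theta> - r) * \<tau>)"
          by (simp add: algebra_simps flip: exp_add)
        finally show ?thesis .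
      qed
      show "integrable half_line ?g" "norm (integral\<^sup>L half_line ?g) \<le> Cf * exp (- x * y) * I"
        unfolding I_def by (rule half_line_dominated[OF c meas le]; assumption)+
    qed
    have up: "norm (\<integral>\<tau>. f (of_real \<sigma> + \<i> * of_real \<tau>) * exp ((of_real \<sigma> + \<i> * of_real \<tau>) * Y) \<partial>half_line) \<le>
        Cf * exp (- \<sigma> * y) * I"
      using J(2)[of \<sigma> 1] \<sigma> by (simp add: Y_def)
    have lo: "norm (\<integral>\<tau>. f (of_real \<sigma> - \<i> * of_real \<tau>) * exp ((of_real \<sigma> - \<i> * of_real \<tau>) * Y') \<partial>half_line) \<le>
        Cf * exp (- \<sigma> * y) * I"
      using J(2)[of \<sigma> "- 1"] \<sigma> by (simp add: Y'_def)
    have i1: "integrable half_line (\<lambda>\<tau>. f (\<i> * of_real \<tau>) * exp (\<i> * of_real \<tau> * Y))"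
      using J(1)[of 0 1] \<sigma> by (simp add: Y_def)
    have i2: "integrable half_line (\<lambda>\<tau>. f (- (\<i> * of_real \<tau>)) * exp (- (\<i> * of_real \<tau>) * Y'))"
      using J(1)[of 0 "- 1"] \<sigma> by (simp add: Y'_def)
    have ib: "set_integrable lborel {0..\<sigma>} (\<lambda>x. f (of_real x) * exp (of_real x * Z))" for Z
      using \<sigma> by (intro borel_integrable_atLeastAtMost' continuous_intros continuous_on_compose2[OF continuous_f]) auto
    have "(\<integral>\<tau>. quarter_term f K \<theta> \<tau> y \<partial>half_line) =
      (\<integral>\<tau>. f (\<i> * of_real \<tau>) * exp (\<i> * of_real \<tau> * Y) \<partial>half_line) * K Y +
      (\<integral>\<tau>. f (- (\<i> * of_real \<tau>)) * exp (- (\<i> * of_real \<tau>) * Y') \<partial>half_line) * K Y'"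
      unfolding quarter_term_def Y_def[symmetric] Y'_def[symmetric] mult.assoc[symmetric]
      using i1 i2 by simp
    note Q = this
    have Bt: "(\<integral>x. bottom_term y x \<partial>segment) =
      (LBINT x:{0..\<sigma>}. f (of_real x) * exp (of_real x * Y)) * K Y -
      (LBINT x:{0..\<sigma>}. f (of_real x) * exp (of_real x * Y')) * K Y'"
    proof -
      have "(\<integral>x. bottom_term y x \<partial>segment) =
        (LBINT x:{0..\<sigma>}. f (of_real x) * exp (of_real x * Y) * K Y - f (of_real x) * exp (of_real x * Y') * K Y')"
        unfolding integral_segment
        by (intro set_lebesgue_integral_cong) (auto simp: bottom_term_def Y_def Y'_def algebra_simps)
      then show ?thesis using ib[of Y] ib[of Y'] by (simp add: set_integral_diff)
    qed
    have alg: "q + \<i> * t = u * k + w * k'"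
      if "q = a * k + b * k'" "t = s * k - s' * k'" "a = u - \<i> * s" "b = w + \<i> * s'"
      for q t a b s s' u w k k' :: complex
      unfolding that by (simp add: algebra_simps)
    have "R y =
      (\<integral>\<tau>. f (of_real \<sigma> + \<i> * of_real \<tau>) * exp ((of_real \<sigma> + \<i> * of_real \<tau>) * Y) \<partial>half_line) * K Y +
      (\<integral>\<tau>. f (of_real \<sigma> - \<i> * of_real \<tau>) * exp ((of_real \<sigma> - \<i> * of_real \<tau>) * Y') \<partial>half_line) * K Y'"
      unfolding R_def
      by (rule alg[OF Q Bt shift_upper[OF y, folded Y_def] shift_lower[OF y, folded Y'_def]])
    also have "norm \<dots> \<le> (Cf * exp (- \<sigma> * y) * I) * (B * exp ((\<sigma> - \<epsilon>) * y)) +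
        (Cf * exp (- \<sigma> * y) * I) * (B * exp ((\<sigma> - \<epsilon>) * y))"
    proof (intro order_trans[OF norm_triangle_ineq] add_mono)
      show "norm ((\<integral>\<tau>. f (of_real \<sigma> + \<i> * of_real \<tau>) * exp ((of_real \<sigma> + \<i> * of_real \<tau>) * Y) \<partial>half_line) * K Y) \<le>
        (Cf * exp (- \<sigma> * y) * I) * (B * exp ((\<sigma> - \<epsilon>) * y))"
        unfolding norm_mult using up norm_K_le(2)[of \<theta> y] y \<theta> order_trans[OF norm_ge_zero up]
        by (intro mult_mono) (auto simp: Y_def)
      show "norm ((\<integral>\<tau>. f (of_real \<sigma> - \<i> * of_real \<tau>) * exp ((of_real \<sigma> - \<i> * of_real \<tau>) * Y') \<partial>half_line) * K Y') \<le>
        (Cf * exp (- \<sigma> * y) * I) * (B * exp ((\<sigma> - \<epsilon>) * y))"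
        unfolding norm_mult using lo norm_K_le(2)[of "- \<theta>" y] y \<theta> order_trans[OF norm_ge_zero up]
        by (intro mult_mono) (auto simp: Y'_def)
    qed
    also have "\<dots> = (B * (2 * Cf * I)) * (exp (- \<sigma> * y) * exp ((\<sigma> - \<epsilon>) * y))" by simp
    \<comment> \<open>The margin \<open>\<epsilon>\<close> is what remains to make the integral over
      \<open>y\<close> converge.\<close>
    also have "exp (- \<sigma> * y) * exp ((\<sigma> - \<epsilon>) * y) = exp (- \<epsilon> * y)"
      by (simp add: algebra_simps flip: exp_add)
    finally show ?thesis .
  qed
  have iR: "integrable half_line R"
    unfolding R_def using quarter_term_Fubini(3) bottom_Fubini(2) by simp
  have "norm (integral\<^sup>L half_line R) \<le> (\<integral>y. norm (R y) \<partial>half_line)" by (rule integral_norm_bound)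
  also have "\<dots> \<le> (\<integral>y. (B * (2 * Cf * I)) * exp (- \<epsilon> * y) \<partial>half_line)"
    using iR le integrable_half_line_exp[OF \<epsilon>] by (intro integral_mono) auto
  also have "\<dots> = B * (2 * Cf * I * (\<integral>y. exp (- \<epsilon> * y) \<partial>half_line))" by simp
  finally have 1: "norm (integral\<^sup>L half_line R) \<le> B * (2 * Cf * I * (\<integral>y. exp (- \<epsilon> * y) \<partial>half_line))" .
  have "(\<integral>y. (\<integral>\<tau>. quarter_term f K \<theta> \<tau> y \<partial>half_line) \<partial>half_line) =
      integral\<^sup>L half_line R - \<i> * (\<integral>y. (\<integral>x. bottom_term y x \<partial>segment) \<partial>half_line)"
    unfolding R_def using quarter_term_Fubini(3) bottom_Fubini(2) by simp
  then have "norm (\<integral>y. (\<integral>\<tau>. quarter_term f K \<theta> \<tau> y \<partial>half_line) \<partial>half_line) \<le>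
      norm (integral\<^sup>L half_line R) + norm (\<integral>y. (\<integral>x. bottom_term y x \<partial>segment) \<partial>half_line)"
    by (metis norm_triangle_ineq4 norm_mult norm_ii mult_1)
  also have "\<dots> \<le> B * (2 * Cf * I * (\<integral>y. exp (- \<epsilon> * y) \<partial>half_line)) + B * (\<sigma> * (Cf * (2 * \<theta>)))"
    using 1 norm_bottom_le by (rule add_mono)
  finally show ?thesis unfolding quarter_term_Fubini(1) quarter_const_def I_def by (simp add: algebra_simps)
qed

end

section \<open>Pairing \<open>f\<close> with the Fourier transform of a kernel\<close>

lemma fourier_shift:
  fixes K :: "complex \<Rightarrow> complex"
  assumes K: "K holomorphic_on {z. \<bar>Im z\<bar> < pi}" and \<theta>: "\<theta> < pi" and a: "a > 0"
    and bound: "\<And>u v. \<bar>v\<bar> \<le> \<theta> \<Longrightarrow> norm (K (of_real u + \<i> * of_real v)) \<le> A * exp (- a * \<bar>u\<bar>)"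
    and \<eta>: "\<bar>\<eta>\<bar> \<le> \<theta>"
  shows "integrable lborel (\<lambda>u. exp (\<i> * of_real \<tau> * (of_real u + \<i> * of_real \<eta>)) * K (of_real u + \<i> * of_real \<eta>))"
    "(\<integral>u. iexp (\<tau> * u) * K (of_real u) \<partial>lborel) =
      (\<integral>u. exp (\<i> * of_real \<tau> * (of_real u + \<i> * of_real \<eta>)) * K (of_real u + \<i> * of_real \<eta>) \<partial>lborel)"
proof -
  let ?G = "\<lambda>z. exp (\<i> * of_real \<tau> * z) * K z"
  have G: "?G holomorphic_on {z. \<bar>Im z\<bar> < pi}" by (intro holomorphic_intros K)
  have le: "norm (?G (of_real u + \<i> * of_real v)) \<le> (exp (\<bar>\<tau>\<bar> * \<theta>) * A) * exp (- a * \<bar>u\<bar>)"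
    if v: "\<bar>v\<bar> \<le> \<theta>" for u v
  proof -
    have "- (\<tau> * v) \<le> \<bar>\<tau>\<bar> * \<bar>v\<bar>" by (metis abs_ge_minus_self abs_mult)
    also have "\<dots> \<le> \<bar>\<tau>\<bar> * \<theta>" using v by (intro mult_left_mono) auto
    finally have "norm (exp (\<i> * of_real \<tau> * (of_real u + \<i> * of_real v))) \<le> exp (\<bar>\<tau>\<bar> * \<theta>)"
      by (simp add: norm_exp_eq_Re)
    then have "norm (?G (of_real u + \<i> * of_real v)) \<le> exp (\<bar>\<tau>\<bar> * \<theta>) * (A * exp (- a * \<bar>u\<bar>))"
      unfolding norm_mult using bound[OF v, of u] by (intro mult_mono) auto
    then show ?thesis by (simp add: mult_ac)
  qed
  have "continuous_on UNIV (\<lambda>u :: real. ?G (of_real u + \<i> * of_real \<eta>))"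
    using \<theta> \<eta> by (intro continuous_intros continuous_on_compose2[OF holomorphic_on_imp_continuous_on[OF K]]) auto
  then show "integrable lborel (\<lambda>u. ?G (of_real u + \<i> * of_real \<eta>))"
    by (intro integrable_lborel_dominated[OF a _ le[OF \<eta>]] borel_measurable_continuous_onI)
  have "(\<integral>u. ?G (of_real u + \<i> * of_real 0) \<partial>lborel) = (\<integral>u. ?G (of_real u + \<i> * of_real \<eta>) \<partial>lborel)"
  proof (cases "\<eta> \<ge> 0")
    case True
    show ?thesis
      by (rule strip_integral_shift[OF G _ _ _ a le, of 0 \<eta>, symmetric]) (use True \<theta> \<eta> in auto)
  next
    case False
    show ?thesis
      by (rule strip_integral_shift[OF G _ _ _ a le, of \<eta> 0]) (use False \<theta> \<eta> in auto)
  qed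
  then show "(\<integral>u. iexp (\<tau> * u) * K (of_real u) \<partial>lborel) =
      (\<integral>u. ?G (of_real u + \<i> * of_real \<eta>) \<partial>lborel)" by (simp add: mult.assoc)
qed

text \<open>On the line at height \<open>\<theta> * sgn \<tau>\<close> the exponential has modulus
  \<open>exp (- \<theta> * |\<tau>|)\<close>, and the integral may be moved there.\<close>

lemma norm_fourier_le:
  fixes K :: "complex \<Rightarrow> complex"
  assumes K: "K holomorphic_on {z. \<bar>Im z\<bar> < pi}" and \<theta>: "0 \<le> \<theta>" "\<theta> < pi" and a: "a > 0"
    and bound: "\<And>u v. \<bar>v\<bar> \<le> \<theta> \<Longrightarrow> norm (K (of_real u + \<i> * of_real v)) \<le> A * exp (- a * \<bar>u\<bar>)"
  shows "norm (\<integral>u. iexp (\<tau> * u) * K (of_real u) \<partial>lborel) \<le>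
    (A * (\<integral>u. exp (- a * \<bar>u\<bar>) \<partial>lborel)) * exp (- \<theta> * \<bar>\<tau>\<bar>)"
proof -
  define \<eta> where "\<eta> = \<theta> * sgn \<tau>"
  have \<eta>: "\<bar>\<eta>\<bar> \<le> \<theta>" using \<theta> by (simp add: \<eta>_def abs_mult abs_sgn_eq)
  note S = fourier_shift[OF K \<theta>(2) a bound \<eta>, of \<tau>]
  let ?g = "\<lambda>u. exp (\<i> * of_real \<tau> * (of_real u + \<i> * of_real \<eta>)) * K (of_real u + \<i> * of_real \<eta>)"
  have e: "norm (exp (\<i> * of_real \<tau> * (of_real u + \<i> * of_real \<eta>))) = exp (- \<theta> * \<bar>\<tau>\<bar>)" for u
  proof -
    have "\<tau> * \<eta> = \<theta> * \<bar>\<tau>\<bar>" by (simp add: \<eta>_def abs_sgn mult_ac)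
    then show ?thesis by (simp add: norm_exp_eq_Re)
  qed
  have "norm (integral\<^sup>L lborel ?g) \<le> (\<integral>u. norm (?g u) \<partial>lborel)" by (rule integral_norm_bound)
  also have "\<dots> \<le> (\<integral>u. exp (- \<theta> * \<bar>\<tau>\<bar>) * (A * exp (- a * \<bar>u\<bar>)) \<partial>lborel)"
  proof (intro integral_mono)
    show "integrable lborel (\<lambda>u. norm (?g u))" using S(1) by (rule integrable_norm)
    show "integrable lborel (\<lambda>u. exp (- \<theta> * \<bar>\<tau>\<bar>) * (A * exp (- a * \<bar>u\<bar>)))"
      using integrable_lborel_exp_abs[OF a] by simp
    show "norm (?g u) \<le> exp (- \<theta> * \<bar>\<tau>\<bar>) * (A * exp (- a * \<bar>u\<bar>))" for u
      unfolding norm_mult e by (intro mult_left_mono bound \<eta>) auto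
  qed
  finally have "norm (integral\<^sup>L lborel ?g) \<le>
      (A * (\<integral>u. exp (- a * \<bar>u\<bar>) \<partial>lborel)) * exp (- \<theta> * \<bar>\<tau>\<bar>)" by (simp add: mult_ac)
  moreover have "(\<integral>u. iexp (\<tau> * u) * K (of_real u) \<partial>lborel) = integral\<^sup>L lborel ?g"
    by (rule S(2))
  ultimately show ?thesis by (simp only:)
qed

text \<open>Splitting both variables at 0 gives four quarters. The two with negative real part of
  \<open>y\<close> make up \<open>quarter_term\<close> for \<open>f\<close>. The parity of
  \<open>K\<close> reflects the other two to the left, where they make up
  \<open>quarter_term\<close> for \<open>g z = f (- z)\<close>; shifting \<open>g\<close> to real
  part \<open>\<sigma>\<close> is shifting \<open>f\<close> to \<open>- \<sigma>\<close>.\<close>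

lemma (in quarter_setup) norm_fourier_pairing_le:
  assumes par: "\<And>y. K (- y) = s * K y" and s: "s = 1 \<or> s = - 1"
  shows "norm (\<integral>\<tau>. f (\<i> * of_real \<tau>) * (\<integral>y. iexp (\<tau> * y) * K (of_real y) \<partial>lborel) \<partial>lborel) \<le>
    2 * (B * quarter_const \<sigma> r \<theta> Cf \<epsilon>)"
proof -
  let ?k = "\<lambda>\<tau> \<eta> z. exp (\<i> * of_real \<tau> * (z + \<i> * of_real \<eta>)) * K (z + \<i> * of_real \<eta>)"
  define L where "L = (\<lambda>\<tau>. \<integral>y. iexp (\<tau> * y) * K (of_real y) \<partial>lborel)"
  define g where "g = (\<lambda>z. f (- z))"
  have "(f \<circ> uminus) holomorphic_on {z. \<bar>Re z\<bar> < m}"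
    by (rule holomorphic_on_compose_gen[OF _ f_hol]) (auto intro!: holomorphic_intros)
  then have g_hol: "g holomorphic_on {z. \<bar>Re z\<bar> < m}" by (simp add: g_def o_def)
  have g_bound: "norm (g (of_real x + \<i> * of_real \<tau>)) \<le> Cf * exp (r * \<bar>\<tau>\<bar>)" if "\<bar>x\<bar> \<le> \<sigma>" for x \<tau>
    using f_bound[of "- x" "- \<tau>"] that by (simp add: g_def)
  interpret g: quarter_setup g K m \<sigma> r \<theta> Cf A a B \<epsilon>
    by (unfold_locales; fact g_hol g_bound \<sigma> \<theta> K_hol a \<epsilon> K_bound K_bound')
  have \<theta>0: "0 \<le> \<theta>" using \<theta> by simp
  have L: "L \<tau> = (\<integral>y. ?k \<tau> \<eta> (of_real y) +
      ?k \<tau> \<eta> (- of_real y) \<partial>half_line)"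
    "integrable half_line (\<lambda>y. ?k \<tau> \<eta> (of_real y) +
      ?k \<tau> \<eta> (- of_real y))"
    if \<eta>: "\<bar>\<eta>\<bar> \<le> \<theta>" for \<tau> \<eta>
  proof -
    note S = fourier_shift[OF K_hol \<theta>(3) a K_bound \<eta>, of \<tau>]
    show "L \<tau> = (\<integral>y. ?k \<tau> \<eta> (of_real y) +
      ?k \<tau> \<eta> (- of_real y) \<partial>half_line)"
    proof -
      have "L \<tau> = (\<integral>y. ?k \<tau> \<eta> (of_real y) \<partial>lborel)"
        unfolding L_def by (rule S(2))
      then show ?thesis using integral_lborel_eq_half_line[OF S(1)] by simp
    qed
    show "integrable half_line (\<lambda>y. ?k \<tau> \<eta> (of_real y) +
      ?k \<tau> \<eta> (- of_real y))"
      using Bochner_Integration.integrable_add[OF integrable_half_lineI[OF S(1)]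
        integrable_half_lineI[OF lborel_integral_reflect(1)[OF S(1)]]] by simp
  qed
  have par': "K (of_real y + \<i> * of_real \<eta>) = s * K (left_pt y (- \<eta>))" for y \<eta>
    using par[of "left_pt y (- \<eta>)"] by (simp add: add.commute)
  \<comment> \<open>The value \<open>L \<tau>\<close> is computed at height \<open>\<theta>\<close>
    and \<open>L (- \<tau>)\<close> at height \<open>- \<theta>\<close>, so that both exponentials
    decay in \<open>\<tau>\<close>.\<close>
  have inner: "f (\<i> * of_real \<tau>) * L \<tau> + f (- (\<i> * of_real \<tau>)) * L (- \<tau>) =
      (\<integral>y. quarter_term f K \<theta> \<tau> y \<partial>half_line) + s * (\<integral>y. quarter_term g K \<theta> \<tau> y \<partial>half_line)"
    if \<tau>: "\<tau> \<ge> 0" for \<tau>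
  proof -
    have "f (\<i> * of_real \<tau>) * L \<tau> + f (- (\<i> * of_real \<tau>)) * L (- \<tau>) =
      (\<integral>y. f (\<i> * of_real \<tau>) * (?k \<tau> \<theta> (of_real y) +
      ?k \<tau> \<theta> (- of_real y)) +
      f (- (\<i> * of_real \<tau>)) * (?k (- \<tau>) (- \<theta>) (of_real y) +
      ?k (- \<tau>) (- \<theta>) (- of_real y)) \<partial>half_line)"
      using L[of \<theta> \<tau>] L[of "- \<theta>" "- \<tau>"] \<theta>0
      by (subst Bochner_Integration.integral_add) (simp_all only: integrable_mult_right integral_mult_right_zero abs_minus_cancel abs_of_nonneg order_refl)
    also have "\<dots> = (\<integral>y. quarter_term f K \<theta> \<tau> y + s * quarter_term g K \<theta> \<tau> y \<partial>half_line)"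
    proof (rule Bochner_Integration.integral_cong[OF refl])
      fix y
      have e: "exp (\<i> * of_real \<tau> * (of_real y + \<i> * of_real \<theta>)) =
          exp (- (\<i> * of_real \<tau>) * (left_pt y (- \<theta>)))"
        "exp (\<i> * of_real (- \<tau>) * (of_real y + \<i> * of_real (- \<theta>))) =
          exp (\<i> * of_real \<tau> * (left_pt y \<theta>))"
        "exp (\<i> * of_real (- \<tau>) * (left_pt y (- \<theta>))) =
          exp (- (\<i> * of_real \<tau>) * (left_pt y (- \<theta>)))"
        by (rule arg_cong[of _ _ exp], simp add: algebra_simps)+
      show "f (\<i> * of_real \<tau>) * (?k \<tau> \<theta> (of_real y) +
      ?k \<tau> \<theta> (- of_real y)) +
      f (- (\<i> * of_real \<tau>)) * (?k (- \<tau>) (- \<theta>) (of_real y) +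
      ?k (- \<tau>) (- \<theta>) (- of_real y)) =
      quarter_term f K \<theta> \<tau> y + s * quarter_term g K \<theta> \<tau> y"
        unfolding par' e quarter_term_def g_def minus_minus by (simp only: ring_distribs mult_ac add_ac)
    qed
    also have "\<dots> = (\<integral>y. quarter_term f K \<theta> \<tau> y \<partial>half_line) + s * (\<integral>y. quarter_term g K \<theta> \<tau> y \<partial>half_line)"
      using integrable_quarter_term[OF \<tau>] g.integrable_quarter_term[OF \<tau>] by simp
    finally show ?thesis .
  qed
  have Lle: "norm (L \<tau>) \<le> (A * (\<integral>u. exp (- a * \<bar>u\<bar>) \<partial>lborel)) * exp (- \<theta> * \<bar>\<tau>\<bar>)" for \<tau>
    unfolding L_def by (rule norm_fourier_le[OF K_hol \<theta>0 \<theta>(3) a K_bound])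
  have iL: "integrable lborel (\<lambda>\<tau>. f (\<i> * of_real \<tau>) * L \<tau>)"
  proof (rule integrable_lborel_dominated)
    show "\<theta> - r > 0" using \<theta> by simp
    have [measurable]: "(\<lambda>y :: real. K (of_real y)) \<in> borel_measurable borel"
      by (intro borel_measurable_continuous_onI continuous_on_compose2[OF continuous_K] continuous_intros) auto
    show "(\<lambda>\<tau>. f (\<i> * of_real \<tau>) * L \<tau>) \<in> borel_measurable borel"
      unfolding L_def by measurable
    fix \<tau> :: real
    have "norm (f (\<i> * of_real \<tau>) * L \<tau>) \<le>
        (Cf * exp (r * \<bar>\<tau>\<bar>)) * ((A * (\<integral>u. exp (- a * \<bar>u\<bar>) \<partial>lborel)) * exp (- \<theta> * \<bar>\<tau>\<bar>))"
      unfolding norm_mult using f_bound[of 0 \<tau>] \<sigma> Lle[of \<tau>] Cf_nonneg by (intro mult_mono) auto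
    also have "\<dots> = (Cf * (A * (\<integral>u. exp (- a * \<bar>u\<bar>) \<partial>lborel))) * exp (- (\<theta> - r) * \<bar>\<tau>\<bar>)"
      by (simp add: algebra_simps flip: exp_add)
    finally show "norm (f (\<i> * of_real \<tau>) * L \<tau>) \<le> (Cf * (A * (\<integral>u. exp (- a * \<bar>u\<bar>) \<partial>lborel))) * exp (- (\<theta> - r) * \<bar>\<tau>\<bar>)" .
  qed
  have "(\<integral>\<tau>. f (\<i> * of_real \<tau>) * L \<tau> \<partial>lborel) =
      (\<integral>\<tau>. f (\<i> * of_real \<tau>) * L \<tau> + f (- (\<i> * of_real \<tau>)) * L (- \<tau>) \<partial>half_line)"
    using integral_lborel_eq_half_line[OF iL] by simp
  also have "\<dots> = (\<integral>\<tau>. (\<integral>y. quarter_term f K \<theta> \<tau> y \<partial>half_line) + s * (\<integral>y. quarter_term g K \<theta> \<tau> y \<partial>half_line) \<partial>half_line)"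
    by (intro Bochner_Integration.integral_cong refl inner) simp
  also have "\<dots> = (\<integral>\<tau>. (\<integral>y. quarter_term f K \<theta> \<tau> y \<partial>half_line) \<partial>half_line) +
      s * (\<integral>\<tau>. (\<integral>y. quarter_term g K \<theta> \<tau> y \<partial>half_line) \<partial>half_line)"
    using quarter_term_Fubini(2) g.quarter_term_Fubini(2) by simp
  also have "norm \<dots> \<le> norm (\<integral>\<tau>. (\<integral>y. quarter_term f K \<theta> \<tau> y \<partial>half_line) \<partial>half_line) +
      norm (\<integral>\<tau>. (\<integral>y. quarter_term g K \<theta> \<tau> y \<partial>half_line) \<partial>half_line)"
    using s by (intro order_trans[OF norm_triangle_ineq]) (auto simp: norm_mult)
  finally show ?thesis
    using norm_quarter_integral_le g.norm_quarter_integral_le unfolding L_def by linarith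
qed

section \<open>Transfer to the coefficients\<close>

definition MP_fourier :: "real \<Rightarrow> nat \<Rightarrow> real \<Rightarrow> complex" where
  "MP_fourier \<nu> n \<tau> = (\<integral>y. iexp (\<tau> * y) * MP_kernel \<nu> n (of_real y) \<partial>lborel)"

text \<open>Times \<open>2 powr \<nu> / (2 * pi)\<close> this is the density of
  \<open>MP_measure\<close>, which is how the Gamma function is eliminated from
  \<open>MP_coeff\<close>.\<close>

lemma MP_fourier_zero:
  assumes "\<nu> > 0"
  shows "MP_fourier \<nu> 0 \<tau> = of_real ((norm (Gamma (\<i> * of_real \<tau> + of_real \<nu> / 2 :: complex)))\<^sup>2 / Gamma \<nu>)"
proof -
  let ?p = "\<i> * of_real \<tau> + of_real \<nu> / 2 :: complex"
  have "of_real \<nu> / 2 - \<i> * of_real \<tau> = cnj ?p" by simp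
  then have "MP_fourier \<nu> 0 \<tau> = Gamma ?p * cnj (Gamma ?p) / Gamma (of_real \<nu>)"
    unfolding MP_fourier_def MP_kernel_zero_fourier[OF assms] by (simp add: cnj_Gamma add.commute)
  then show ?thesis
    by (simp add: complex_norm_square[symmetric] Gamma_complex_of_real)
qed

lemma MP_fourier_MP_poly:
  assumes "\<nu> > 0"
  shows "of_real (pochhammer \<nu> n / fact n) * MP_fourier \<nu> n \<tau> =
    MP_fourier \<nu> 0 \<tau> * MP_poly \<nu> n (\<i> * of_real \<tau>)"
  unfolding MP_fourier_def using assms by (rule MP_kernel_fourier)

lemma cnj_MP_fourier_minus: "cnj (MP_fourier \<nu> n \<tau>) = MP_fourier \<nu> n (- \<tau>)"
  unfolding MP_fourier_def Bochner_Integration.integral_cnj[symmetric]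
  by (simp add: exp_cnj MP_kernel_of_real del: Bochner_Integration.integral_cnj)

lemma cnj_MP_fourier: "cnj (MP_fourier \<nu> n \<tau>) = (- 1) ^ n * MP_fourier \<nu> n \<tau>"
proof -
  have "MP_fourier \<nu> n (- \<tau>) =
      (\<integral>y. iexp (- \<tau> * (0 + - 1 * y)) * MP_kernel \<nu> n (of_real (0 + - 1 * y)) \<partial>lborel)"
    unfolding MP_fourier_def by (subst lborel_integral_real_affine[of "- 1" _ 0]) simp_all
  also have "\<dots> = (\<integral>y. (- 1) ^ n * (iexp (\<tau> * y) * MP_kernel \<nu> n (of_real y)) \<partial>lborel)"
    by (simp add: MP_kernel_minus mult_ac)
  finally show ?thesis unfolding cnj_MP_fourier_minus by (simp add: MP_fourier_def)
qed

lemma holomorphic_on_MP_poly [holomorphic_intros]: "MP_poly \<nu> n holomorphic_on S"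
proof -
  have "(\<lambda>s. pochhammer (s + of_real \<nu> / 2) k) holomorphic_on S" for k
    unfolding pochhammer_prod by (intro holomorphic_intros)
  then have "(\<lambda>s. of_real (pochhammer \<nu> n / fact n) * (\<Sum>k\<le>n. (pochhammer (- of_nat n) k /
      (pochhammer (of_real \<nu>) k * fact k) * 2 ^ k) * pochhammer (s + of_real \<nu> / 2) k)) holomorphic_on S"
    by (intro holomorphic_on_mult holomorphic_on_sum holomorphic_on_const)
  then show ?thesis by (simp add: MP_poly_eq_finite_sum [abs_def] mult_ac)
qed

lemma continuous_on_Gamma_vertical:
  assumes "\<nu> > 0"
  shows "continuous_on UNIV (\<lambda>t :: real. Gamma (\<i> * of_real t + of_real \<nu> / 2 :: complex))"
  using assms by (intro continuous_at_imp_continuous_on ballI continuous_intros isCont_Gamma)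
    (auto elim!: nonpos_Ints_cases simp: complex_eq_iff)

text \<open>The density times the conjugate polynomial is, by \<open>MP_fourier_MP_poly\<close>, a
  multiple of the conjugate of \<open>MP_fourier\<close>. The factor
  \<open>pochhammer \<nu> n / fact n\<close> that appears cancels the normalisation in
  \<open>MP_coeff\<close>.\<close>

lemma MP_coeff_eq:
  assumes \<nu>: "\<nu> > 0" and f: "continuous_on UNIV (\<lambda>\<tau> :: real. f (\<i> * of_real \<tau>))"
  shows "MP_coeff \<nu> f n = of_real (2 powr \<nu> / (2 * pi)) *
    (\<integral>\<tau>. f (\<i> * of_real \<tau>) * cnj (MP_fourier \<nu> n \<tau>) \<partial>lborel)"
proof -
  define h where "h = pochhammer \<nu> n / fact n"
  define w where "w = (\<lambda>t. 1 / (2 * pi) * (2 powr \<nu> / Gamma \<nu>) *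
      (norm (Gamma (\<i> * of_real t + of_real \<nu> / 2 :: complex)))\<^sup>2)"
  have h0: "h > 0" using \<nu> by (simp add: h_def pochhammer_pos)
  have [measurable]: "w \<in> borel_measurable borel" unfolding w_def
    by (intro borel_measurable_continuous_onI continuous_intros continuous_on_Gamma_vertical \<nu>)
  have w0: "w t \<ge> 0" for t unfolding w_def using \<nu> by (simp add: Gamma_real_pos less_imp_le)
  have [measurable]: "(\<lambda>\<tau> :: real. f (\<i> * of_real \<tau>)) \<in> borel_measurable borel"
    using f by (rule borel_measurable_continuous_onI)
  let ?F = "\<lambda>t. f (\<i> * of_real t) * cnj (MP_poly \<nu> n (\<i> * of_real t))"
  have "continuous_on UNIV (MP_poly \<nu> n)" by (intro holomorphic_on_imp_continuous_on holomorphic_intros)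
  then have "continuous_on UNIV (\<lambda>t :: real. MP_poly \<nu> n (\<i> * of_real t))"
    by (rule continuous_on_compose2) (auto intro!: continuous_intros)
  then have "continuous_on UNIV ?F" by (intro continuous_intros f)
  then have "?F \<in> borel_measurable borel" by (rule borel_measurable_continuous_onI)
  then have "?F \<in> borel_measurable lborel" by simp
  moreover have "MP_measure \<nu> = density lborel (\<lambda>t. ennreal (w t))"
    by (simp add: MP_measure_def w_def)
  ultimately have "integral\<^sup>L (MP_measure \<nu>) ?F = (\<integral>t. w t *\<^sub>R ?F t \<partial>lborel)"
    using w0 by (simp only:) (rule integral_density; simp)
  moreover have "fact n / pochhammer \<nu> n = inverse h" by (simp add: h_def)
  ultimately have "MP_coeff \<nu> f n = of_real (inverse h) * (\<integral>t. w t *\<^sub>R ?F t \<partial>lborel)"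
    unfolding MP_coeff_def by simp
  also have "(\<lambda>t. w t *\<^sub>R (f (\<i> * of_real t) * cnj (MP_poly \<nu> n (\<i> * of_real t)))) =
     (\<lambda>t. of_real (2 powr \<nu> / (2 * pi) * h) * (f (\<i> * of_real t) * cnj (MP_fourier \<nu> n t)))"
  proof
    fix t
    have "w t = 2 powr \<nu> / (2 * pi) * Re (MP_fourier \<nu> 0 t)"
      by (simp add: w_def MP_fourier_zero[OF \<nu>])
    then have "of_real (w t) = of_real (2 powr \<nu> / (2 * pi)) * cnj (MP_fourier \<nu> 0 t)"
      by (simp add: MP_fourier_zero[OF \<nu>])
    then have "w t *\<^sub>R (f (\<i> * of_real t) * cnj (MP_poly \<nu> n (\<i> * of_real t))) =
       of_real (2 powr \<nu> / (2 * pi)) * f (\<i> * of_real t) * cnj (MP_fourier \<nu> 0 t * MP_poly \<nu> n (\<i> * of_real t))"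
      by (simp add: scaleR_conv_of_real mult_ac)
    then show "w t *\<^sub>R (f (\<i> * of_real t) * cnj (MP_poly \<nu> n (\<i> * of_real t))) =
      of_real (2 powr \<nu> / (2 * pi) * h) * (f (\<i> * of_real t) * cnj (MP_fourier \<nu> n t))"
      unfolding MP_fourier_MP_poly[OF \<nu>, symmetric] h_def[symmetric] by (simp add: mult_ac)
  qed
  finally have "MP_coeff \<nu> f n = of_real (inverse h) *
      (of_real (2 powr \<nu> / (2 * pi) * h) * (\<integral>t. f (\<i> * of_real t) * cnj (MP_fourier \<nu> n t) \<partial>lborel))"
    by (simp only: integral_mult_right_zero)
  then show ?thesis using h0 by simp
qed

text \<open>The height \<open>\<theta>\<close> is the midpoint of \<open>r\<close> and
  \<open>pi / 2\<close>: above \<open>r\<close> to absorb the growth of \<open>f\<close>, below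
  \<open>pi / 2\<close> for the decay of the kernel in \<open>n\<close>. The exponent
  \<open>c = \<nu> / 2 + \<sigma> - \<epsilon>\<close> in \<open>norm_MP_kernel_le\<close> is the
  one for which the kernel grows exactly at the rate \<open>\<sigma> - \<epsilon>\<close> of
  \<open>quarter_setup\<close>.\<close>

lemma MP_coeff_bound:
  fixes \<nu> m \<sigma> r Cf \<epsilon> :: real
  assumes \<nu>: "\<nu> > 0" and f_hol: "f holomorphic_on {z. \<bar>Re z\<bar> < m}"
    and f_bound: "\<And>x \<tau>. \<bar>x\<bar> \<le> \<sigma> \<Longrightarrow> norm (f (of_real x + \<i> * of_real \<tau>)) \<le> Cf * exp (r * \<bar>\<tau>\<bar>)"
    and \<sigma>: "0 < \<sigma>" "\<sigma> < m" and r: "0 \<le> r" "r < pi / 2" and \<epsilon>: "0 < \<epsilon>" "\<epsilon> < \<sigma>"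
  obtains C where "C \<ge> 0" "\<And>n. norm (MP_coeff \<nu> f n) \<le> C * real (n + 1) powr (- (\<nu> / 2 + \<sigma> - \<epsilon>))"
proof -
  let ?w = "\<lambda>n. real (n + 1) powr (- (\<nu> / 2 + \<sigma> - \<epsilon>))"
  define \<theta> where "\<theta> = (r + pi / 2) / 2"
  have \<theta>: "0 \<le> r" "r < \<theta>" "\<theta> < pi" "0 \<le> \<theta>" "\<theta> < pi / 2" using r by (auto simp: \<theta>_def)
  obtain A where A: "A > 0" "\<And>n u v. \<bar>v\<bar> \<le> \<theta> \<Longrightarrow>
      norm (MP_kernel \<nu> n (of_real u + \<i> * of_real v)) \<le> A * exp (- (\<nu> / 4) * \<bar>u\<bar>)"
    using norm_MP_kernel_le_exp[OF \<theta>(4,5) \<nu>] by blast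
  obtain B where B: "B > 0" "\<And>n u v. \<bar>v\<bar> \<le> \<theta> \<Longrightarrow> norm (MP_kernel \<nu> n (of_real u + \<i> * of_real v)) \<le>
      B * ?w n * exp ((\<nu> / 2 + \<sigma> - \<epsilon> - \<nu> / 2) * \<bar>u\<bar>)"
    using norm_MP_kernel_le[OF \<theta>(4,5) \<nu>, of "\<nu> / 2 + \<sigma> - \<epsilon>"] \<nu> \<epsilon> by auto
  have B': "norm (MP_kernel \<nu> n (of_real u + \<i> * of_real v)) \<le>
      B * ?w n * exp ((\<sigma> - \<epsilon>) * \<bar>u\<bar>)"
    if "\<bar>v\<bar> \<le> \<theta>" for n u v
    using B(2)[OF that, of n u] by simp
  have \<nu>': "\<nu> / 4 > 0" using \<nu> by simp
  define Q where "Q = quarter_const \<sigma> r \<theta> Cf \<epsilon>"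
  have X: "norm (\<integral>\<tau>. f (\<i> * of_real \<tau>) * MP_fourier \<nu> n \<tau> \<partial>lborel) \<le>
     2 * (B * ?w n * Q)" for n
  proof -
    interpret quarter_setup f "MP_kernel \<nu> n" m \<sigma> r \<theta> Cf A "\<nu> / 4" "B * ?w n" \<epsilon>
      by (unfold_locales; fact f_hol f_bound \<sigma> \<theta> \<epsilon> holomorphic_on_MP_kernel A(2) B' \<nu>')
    show ?thesis
      unfolding MP_fourier_def Q_def
      by (rule norm_fourier_pairing_le[of "(- 1) ^ n"]) (auto simp: MP_kernel_minus minus_one_power_iff)
  qed
  have cont: "continuous_on UNIV (\<lambda>\<tau> :: real. f (\<i> * of_real \<tau>))"
    using \<sigma> by (intro continuous_on_compose2[OF holomorphic_on_imp_continuous_on[OF f_hol]] continuous_intros) auto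
  define C where "C = 2 powr \<nu> / (2 * pi) * (2 * (B * Q))"
  have le: "norm (MP_coeff \<nu> f n) \<le> C * ?w n" for n
  proof -
    have "(\<integral>\<tau>. f (\<i> * of_real \<tau>) * cnj (MP_fourier \<nu> n \<tau>) \<partial>lborel) =
       (\<integral>\<tau>. (- 1) ^ n * (f (\<i> * of_real \<tau>) * MP_fourier \<nu> n \<tau>) \<partial>lborel)"
      unfolding cnj_MP_fourier by (simp add: mult_ac)
    then have "norm (MP_coeff \<nu> f n) = 2 powr \<nu> / (2 * pi) * norm (\<integral>\<tau>. f (\<i> * of_real \<tau>) * MP_fourier \<nu> n \<tau> \<partial>lborel)"
      unfolding MP_coeff_eq[OF \<nu> cont] by (simp add: norm_mult norm_divide norm_power)
    also have "\<dots> \<le> 2 powr \<nu> / (2 * pi) * (2 * (B * ?w n * Q))"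
      by (intro mult_left_mono X) auto
    finally show ?thesis by (simp add: C_def mult_ac)
  qed
  have "C \<ge> 0" using order_trans[OF norm_ge_zero le[of 0]] by simp
  then show ?thesis using that le by blast
qed

section \<open>Convergence of the expansion\<close>

definition MP_weight :: "real \<Rightarrow> nat \<Rightarrow> real" where
  "MP_weight \<nu> n = pochhammer \<nu> n / fact n"

definition MP_kernel_real :: "real \<Rightarrow> nat \<Rightarrow> real \<Rightarrow> real" where
  "MP_kernel_real \<nu> n y = (2 * cosh (y / 2)) powr (- \<nu>) * (- tanh (y / 2)) ^ n"

lemma MP_kernel_eq_real: "MP_kernel \<nu> n (of_real y) = of_real (MP_kernel_real \<nu> n y)"
  by (simp add: MP_kernel_of_real MP_kernel_real_def)

lemma MP_kernel_real_eq: "MP_kernel_real \<nu> n y = MP_kernel_real \<nu> 0 y * (- tanh (y / 2)) ^ n"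
  by (simp add: MP_kernel_real_def)

lemma MP_kernel_real_zero_pos: "MP_kernel_real \<nu> 0 y > 0"
  by (simp add: MP_kernel_real_def cosh_real_pos)

lemma MP_weight_nonneg: "\<nu> > 0 \<Longrightarrow> MP_weight \<nu> n \<ge> 0"
  by (simp add: MP_weight_def pochhammer_pos less_imp_le)

lemma MP_weight_le:
  obtains C where "C \<ge> 0" "\<And>n. \<bar>MP_weight \<nu> n\<bar> \<le> C * real (n + 1) powr (\<nu> - 1)"
proof -
  have "\<bar>MP_weight \<nu> n\<bar> \<le> exp (2 * (\<bar>\<nu> - 1\<bar> + (norm (complex_of_real \<nu> - 1))\<^sup>2)) * real (n + 1) powr (\<nu> - 1)" for n
  proof -
    have "\<bar>MP_weight \<nu> n\<bar> = norm (complex_of_real (MP_weight \<nu> n))" by simp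
    also have "complex_of_real (MP_weight \<nu> n) = pochhammer (of_real \<nu>) n / fact n"
      by (simp add: MP_weight_def pochhammer_of_real)
    finally show ?thesis using norm_pochhammer_over_fact_le[of "of_real \<nu>" n] by simp
  qed
  then show ?thesis using that by (metis exp_ge_zero)
qed

lemma MP_weight_sums:
  assumes "\<bar>X\<bar> < 1"
  shows "(\<lambda>n. MP_weight \<nu> n * X ^ n) sums (1 - X) powr (- \<nu>)"
proof -
  have "(\<lambda>n. ((- \<nu>) gchoose n) * (- X) ^ n) sums (1 + - X) powr (- \<nu>)"
    using assms by (intro gen_binomial_real) simp
  moreover have "((- \<nu>) gchoose n) * (- X) ^ n = MP_weight \<nu> n * X ^ n" for n
    by (simp add: gbinomial_pochhammer MP_weight_def flip: power_mult_distrib)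
  ultimately show ?thesis by simp
qed

lemma MP_weight_summable: "\<nu> > 0 \<Longrightarrow> 0 \<le> X \<Longrightarrow> X < 1 \<Longrightarrow> summable (\<lambda>n. MP_weight \<nu> n * X ^ n)"
  using MP_weight_sums[of X \<nu>] by (auto simp: sums_iff)

text \<open>Poisson kernel: \<open>1 - tanh a tanh b = cosh (a - b) / (cosh a cosh b)\<close>.\<close>

lemma MP_kernel_real_product_sums:
  "(\<lambda>n. MP_weight \<nu> n * MP_kernel_real \<nu> n y * MP_kernel_real \<nu> n y') sums
     (2 powr (- \<nu>) * MP_kernel_real \<nu> 0 (y' - y))"
proof -
  define X where "X = tanh (y / 2) * tanh (y' / 2)"
  have t: "\<bar>tanh x\<bar> < 1" for x :: real using tanh_real_bounds[of x] by auto
  have "\<bar>X\<bar> < 1 * 1" unfolding X_def abs_mult by (intro mult_strict_mono' t) auto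
  then have X: "\<bar>X\<bar> < 1" by simp
  have "MP_weight \<nu> n * MP_kernel_real \<nu> n y * MP_kernel_real \<nu> n y' =
      MP_kernel_real \<nu> 0 y * MP_kernel_real \<nu> 0 y' * (MP_weight \<nu> n * X ^ n)" for n
    by (simp add: MP_kernel_real_def X_def mult_ac flip: power_mult_distrib)
  then have "(\<lambda>n. MP_weight \<nu> n * MP_kernel_real \<nu> n y * MP_kernel_real \<nu> n y') sums
     (MP_kernel_real \<nu> 0 y * MP_kernel_real \<nu> 0 y' * (1 - X) powr (- \<nu>))"
    by (simp only: sums_mult MP_weight_sums[OF X])
  also have "MP_kernel_real \<nu> 0 y * MP_kernel_real \<nu> 0 y' * (1 - X) powr (- \<nu>) =
      ((2 * cosh (y / 2)) * (2 * cosh (y' / 2)) * (1 - X)) powr (- \<nu>)"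
    by (simp only: MP_kernel_real_def powr_mult power_0 mult_1_right)
  also have "(2 * cosh (y / 2)) * (2 * cosh (y' / 2)) * (1 - X) =
      4 * (cosh (y' / 2) * cosh (y / 2) - sinh (y' / 2) * sinh (y / 2))"
    using cosh_real_pos[of "y / 2"] cosh_real_pos[of "y' / 2"]
    by (simp add: X_def tanh_def field_simps)
  also have "\<dots> = 2 * (2 * cosh ((y' - y) / 2))"
    by (simp add: cosh_diff diff_divide_distrib)
  also have "\<dots> powr (- \<nu>) = 2 powr (- \<nu>) * MP_kernel_real \<nu> 0 (y' - y)"
    by (subst powr_mult) (simp_all add: MP_kernel_real_def)
  finally show ?thesis .
qed

lemma integrable_MP_kernel_real:
  assumes "\<nu> > 0"
  shows "integrable lborel (MP_kernel_real \<nu> n)"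
proof -
  have "integrable lborel (\<lambda>y. complex_of_real (MP_kernel_real \<nu> n y))"
    using integrable_iexp_MP_kernel[OF assms, of 0 n] by (simp add: MP_kernel_eq_real)
  then show ?thesis by (simp only: complex_of_real_integrable_eq)
qed

text \<open>The Poisson kernel is multiplied by \<open>iexp (\<tau> * y')\<close> and integrated
  termwise over \<open>y'\<close>; the factor \<open>iexp (\<tau> * y)\<close> comes from its
  dependence on \<open>y' - y\<close> alone. For fixed \<open>y\<close> the powers of
  \<open>|tanh (y / 2)| < 1\<close> provide a summable majorant.\<close>

lemma MP_fourier_sums:
  assumes \<nu>: "\<nu> > 0"
  shows "(\<lambda>n. of_real (MP_weight \<nu> n * MP_kernel_real \<nu> n y) * MP_fourier \<nu> n \<tau>) sums
    (of_real (2 powr (- \<nu>)) * iexp (\<tau> * y) * MP_fourier \<nu> 0 \<tau>)"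
proof -
  define F where "F = (\<lambda>n y'. iexp (\<tau> * y') * complex_of_real (MP_weight \<nu> n * MP_kernel_real \<nu> n y * MP_kernel_real \<nu> n y'))"
  let ?t = "\<bar>tanh (y / 2)\<bar>"
  let ?q = "\<lambda>n. MP_kernel_real \<nu> 0 y * (MP_weight \<nu> n * ?t ^ n)"
  have t: "?t < 1" using tanh_real_bounds[of "y / 2"] by auto
  have nF: "norm (F n y') \<le> MP_kernel_real \<nu> 0 y' * (?q n)" for n y'
  proof -
    have "\<bar>tanh (y' / 2)\<bar> ^ n \<le> 1" using tanh_real_bounds[of "y' / 2"] by (intro power_le_one) auto
    then have "MP_kernel_real \<nu> 0 y' * \<bar>tanh (y' / 2)\<bar> ^ n \<le> MP_kernel_real \<nu> 0 y' * 1"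
      using MP_kernel_real_zero_pos[of \<nu> y'] by (intro mult_left_mono) auto
    then have "(MP_kernel_real \<nu> 0 y' * \<bar>tanh (y' / 2)\<bar> ^ n) * (?q n) \<le>
        (MP_kernel_real \<nu> 0 y' * 1) * (?q n)"
      using MP_kernel_real_zero_pos[of \<nu> y] MP_weight_nonneg[OF \<nu>, of n] by (intro mult_right_mono) auto
    moreover have "norm (F n y') = (MP_kernel_real \<nu> 0 y' * \<bar>tanh (y' / 2)\<bar> ^ n) * (?q n)"
    proof -
      have "norm (F n y') = \<bar>MP_weight \<nu> n * MP_kernel_real \<nu> n y * MP_kernel_real \<nu> n y'\<bar>"
        unfolding F_def norm_mult norm_of_real by simp
      then show ?thesis
        unfolding MP_kernel_real_eq[of \<nu> n] using MP_weight_nonneg[OF \<nu>, of n]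
        by (simp add: abs_mult power_abs MP_kernel_real_zero_pos abs_of_pos)
    qed
    ultimately show ?thesis by simp
  qed
  have [measurable]: "MP_kernel_real \<nu> n \<in> borel_measurable borel" for n
    using borel_measurable_integrable[OF integrable_MP_kernel_real[OF \<nu>]] by simp
  have "F n \<in> borel_measurable lborel" for n unfolding F_def by measurable
  moreover have "summable (\<lambda>n. ?q n)"
    using t by (intro summable_mult MP_weight_summable[OF \<nu>]) auto
  ultimately have "(\<lambda>n. integral\<^sup>L lborel (F n)) sums (\<integral>y'. (\<Sum>n. F n y') \<partial>lborel)"
    by (rule sums_integral_dominated(1)[OF integrable_MP_kernel_real[OF \<nu>, of 0] _ nF])
  moreover have "integral\<^sup>L lborel (F n) = of_real (MP_weight \<nu> n * MP_kernel_real \<nu> n y) * MP_fourier \<nu> n \<tau>" for n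
  proof -
    have "F n = (\<lambda>y'. of_real (MP_weight \<nu> n * MP_kernel_real \<nu> n y) * (iexp (\<tau> * y') * MP_kernel \<nu> n (of_real y')))"
      by (simp add: F_def MP_kernel_eq_real fun_eq_iff)
    then show ?thesis by (simp only: integral_mult_right_zero MP_fourier_def)
  qed
  moreover have "(\<integral>y'. (\<Sum>n. F n y') \<partial>lborel) = of_real (2 powr (- \<nu>)) * iexp (\<tau> * y) * MP_fourier \<nu> 0 \<tau>"
  proof -
    have "(\<Sum>n. F n y') = iexp (\<tau> * y') * of_real (2 powr (- \<nu>) * MP_kernel_real \<nu> 0 (y' - y))" for y'
      unfolding F_def
      by (intro sums_unique[symmetric] sums_mult sums_of_real MP_kernel_real_product_sums)
    then have "(\<integral>y'. (\<Sum>n. F n y') \<partial>lborel) =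
        (\<integral>x. iexp (\<tau> * (y + x)) * of_real (2 powr (- \<nu>) * MP_kernel_real \<nu> 0 (y + x - y)) \<partial>lborel)"
      by (simp only:) (rule lborel_integral_translate)
    also have "\<dots> = (\<integral>x. of_real (2 powr (- \<nu>)) * iexp (\<tau> * y) * (iexp (\<tau> * x) * MP_kernel \<nu> 0 (of_real x)) \<partial>lborel)"
      by (intro Bochner_Integration.integral_cong refl)
         (simp add: MP_kernel_eq_real exp_add ring_distribs mult_ac)
    finally show ?thesis by (simp only: integral_mult_right_zero MP_fourier_def)
  qed
  ultimately show ?thesis by simp
qed

lemma MP_fourier_zero_minus: "\<nu> > 0 \<Longrightarrow> MP_fourier \<nu> 0 (- \<tau>) = MP_fourier \<nu> 0 \<tau>"
  using cnj_MP_fourier_minus[of \<nu> 0 \<tau>] by (simp add: cnj_MP_fourier)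

lemma MP_fourier_zero_ne_0:
  assumes "\<nu> > 0"
  shows "MP_fourier \<nu> 0 \<tau> \<noteq> 0"
proof -
  have "Gamma (\<i> * of_real \<tau> + of_real \<nu> / 2 :: complex) \<noteq> 0"
    unfolding Gamma_eq_zero_iff using assms by (auto simp: complex_eq_iff elim!: nonpos_Ints_cases)
  moreover have "Gamma \<nu> \<noteq> 0" using Gamma_real_pos[OF assms] by linarith
  ultimately show ?thesis by (simp add: MP_fourier_zero[OF assms])
qed

lemma measurable_MP_fourier [measurable]: "MP_fourier \<nu> n \<in> borel_measurable borel"
  unfolding MP_fourier_def [abs_def] by measurable

lemma continuous_MP_fourier_zero:
  assumes "\<nu> > 0"
  shows "continuous_on UNIV (MP_fourier \<nu> 0)"
  unfolding MP_fourier_zero[OF assms, abs_def]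
  using Gamma_real_pos[OF assms]
  by (intro continuous_intros continuous_on_Gamma_vertical assms) auto

lemma norm_MP_fourier_le:
  assumes \<nu>: "\<nu> > 0" and \<theta>: "0 \<le> \<theta>" "\<theta> < pi / 2"
  obtains D where "D \<ge> 0" "\<And>n \<tau>. norm (MP_fourier \<nu> n \<tau>) \<le> D * exp (- \<theta> * \<bar>\<tau>\<bar>)"
proof -
  obtain A where A: "A > 0" "\<And>n u v. \<bar>v\<bar> \<le> \<theta> \<Longrightarrow>
      norm (MP_kernel \<nu> n (of_real u + \<i> * of_real v)) \<le> A * exp (- (\<nu> / 4) * \<bar>u\<bar>)"
    using norm_MP_kernel_le_exp[OF \<theta> \<nu>] by blast
  have "\<theta> < pi" using \<theta> by simp
  have "norm (MP_fourier \<nu> n \<tau>) \<le> (A * (\<integral>u. exp (- (\<nu> / 4) * \<bar>u\<bar>) \<partial>lborel)) * exp (- \<theta> * \<bar>\<tau>\<bar>)" for n \<tau>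
    unfolding MP_fourier_def
    by (rule norm_fourier_le[OF holomorphic_on_MP_kernel \<theta>(1) \<open>\<theta> < pi\<close> _ A(2)]) (use \<nu> in auto)
  moreover have "A * (\<integral>u. exp (- (\<nu> / 4) * \<bar>u\<bar>) \<partial>lborel) \<ge> 0"
    using A(1) by (intro mult_nonneg_nonneg Bochner_Integration.integral_nonneg) auto
  ultimately show ?thesis using that by blast
qed

text \<open>For index 0 the factor with \<open>tanh\<close> is absent, so heights up to
  \<open>pi\<close> instead of \<open>pi / 2\<close> are available. Square integrability of
  \<open>f\<close> needs a decay rate above \<open>2 * r\<close>, which may exceed
  \<open>pi / 2\<close>.\<close>

lemma norm_MP_fourier_zero_le:
  assumes \<nu>: "\<nu> > 0" and \<theta>: "0 \<le> \<theta>" "\<theta> < pi"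
  obtains D where "\<And>\<tau>. norm (MP_fourier \<nu> 0 \<tau>) \<le> D * exp (- \<theta> * \<bar>\<tau>\<bar>)"
proof -
  have "norm (MP_fourier \<nu> 0 \<tau>) \<le>
      (cos (\<theta> / 2) powr (- \<nu>) * (\<integral>u. exp (- (\<nu> / 2) * \<bar>u\<bar>) \<partial>lborel)) * exp (- \<theta> * \<bar>\<tau>\<bar>)" for \<tau>
    unfolding MP_fourier_def
    by (rule norm_fourier_le[OF holomorphic_on_MP_kernel \<theta> _ norm_MP_kernel_zero_le]) (use \<nu> \<theta> in auto)
  then show ?thesis using that by blast
qed

lemma summable_Suc_powr:
  assumes "s < - 1"
  shows "summable (\<lambda>n. real (n + 1) powr s)"
  using summable_ignore_initial_segment[of "\<lambda>n. real n powr s" 1] assms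
  by (simp add: summable_real_powr_iff)

text \<open>On the real line, \<open>c = \<nu> / 2 - \<epsilon>\<close> in
  \<open>norm_MP_kernel_le\<close> keeps almost the power \<open>\<nu> / 2\<close> of decay in
  \<open>n\<close> and still leaves an integrable factor in \<open>y\<close>.\<close>

lemma MP_kernel_real_le:
  assumes \<nu>: "\<nu> > 0" and \<epsilon>: "0 < \<epsilon>" "\<epsilon> < \<nu> / 2"
  obtains C where "C \<ge> 0" "\<And>n y. \<bar>MP_kernel_real \<nu> n y\<bar> \<le> C * real (n + 1) powr (- (\<nu> / 2 - \<epsilon>)) * exp (- \<epsilon> * \<bar>y\<bar>)"
proof -
  have z: "(0 :: real) \<le> 0" "0 < pi / 2" "\<nu> / 2 - \<epsilon> > 0" using \<epsilon> by auto
  obtain C where C: "C > 0" "\<And>n u v. \<bar>v\<bar> \<le> 0 \<Longrightarrow> norm (MP_kernel \<nu> n (of_real u + \<i> * of_real v)) \<le>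
      C * real (n + 1) powr (- (\<nu> / 2 - \<epsilon>)) * exp ((\<nu> / 2 - \<epsilon> - \<nu> / 2) * \<bar>u\<bar>)"
    using norm_MP_kernel_le[OF z(1,2) \<nu> z(3)] by blast
  have "\<bar>MP_kernel_real \<nu> n y\<bar> \<le> C * real (n + 1) powr (- (\<nu> / 2 - \<epsilon>)) * exp (- \<epsilon> * \<bar>y\<bar>)" for n y
    using C(2)[of 0 n y] by (simp add: MP_kernel_eq_real)
  then show ?thesis using that C(1) by (metis less_imp_le)
qed

text \<open>The constant in \<open>f_bound\<close> may depend on \<open>\<sigma>\<close>, because
  \<open>f\<close> may have a pole on the boundary of the strip.\<close>

context
  fixes \<nu> m r :: real and f :: "complex \<Rightarrow> complex"
  assumes \<nu>: "\<nu> > 0" and m: "m > 0" and f_hol: "f holomorphic_on {z. \<bar>Re z\<bar> < m}"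
    and f_bound: "\<And>\<sigma>. 0 < \<sigma> \<Longrightarrow> \<sigma> < m \<Longrightarrow>
      \<exists>C. \<forall>x \<tau>. \<bar>x\<bar> \<le> \<sigma> \<longrightarrow> norm (f (of_real x + \<i> * of_real \<tau>)) \<le> C * exp (r * \<bar>\<tau>\<bar>)"
    and r: "0 \<le> r" "r < pi / 2"
begin

lemma axis_bound:
  obtains C where "C \<ge> 0" "\<And>\<tau>. norm (f (\<i> * of_real \<tau>)) \<le> C * exp (r * \<bar>\<tau>\<bar>)"
proof -
  obtain C where C: "\<And>x \<tau>. \<bar>x\<bar> \<le> m / 2 \<Longrightarrow> norm (f (of_real x + \<i> * of_real \<tau>)) \<le> C * exp (r * \<bar>\<tau>\<bar>)"
    using f_bound[of "m / 2"] m by auto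
  have "norm (f (\<i> * of_real \<tau>)) \<le> C * exp (r * \<bar>\<tau>\<bar>)" for \<tau> using C[of 0 \<tau>] m by simp
  moreover from this[of 0] have "C \<ge> 0" using order_trans[OF norm_ge_zero] by force
  ultimately show ?thesis using that by blast
qed

lemma axis_continuous: "continuous_on UNIV (\<lambda>\<tau> :: real. f (\<i> * of_real \<tau>))"
  using m by (intro continuous_on_compose2[OF holomorphic_on_imp_continuous_on[OF f_hol]] continuous_intros) auto

lemma coeff_bound:
  assumes "0 < \<sigma>" "\<sigma> < m" "0 < \<epsilon>" "\<epsilon> < \<sigma>"
  obtains C where "C \<ge> 0" "\<And>n. norm (MP_coeff \<nu> f n) \<le> C * real (n + 1) powr (- (\<nu> / 2 + \<sigma> - \<epsilon>))"
proof -
  obtain C where "\<And>x \<tau>. \<bar>x\<bar> \<le> \<sigma> \<Longrightarrow> norm (f (of_real x + \<i> * of_real \<tau>)) \<le> C * exp (r * \<bar>\<tau>\<bar>)"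
    using f_bound[OF assms(1,2)] by auto
  from MP_coeff_bound[OF \<nu> f_hol this assms(1,2) r assms(3,4)] show ?thesis using that by blast
qed

lemma square_integrable: "MP_L2 \<nu> (\<lambda>t. f (\<i> * of_real t))"
proof -
  define w where "w = (\<lambda>t. 1 / (2 * pi) * (2 powr \<nu> / Gamma \<nu>) *
      (norm (Gamma (\<i> * of_real t + of_real \<nu> / 2 :: complex)))\<^sup>2)"
  \<comment> \<open>The midpoint of \<open>2 * r\<close> and \<open>pi\<close>: the weight has to
    outweigh the square of \<open>f\<close>.\<close>
  define \<theta> where "\<theta> = (2 * r + pi) / 2"
  have \<theta>: "2 * r < \<theta>" "0 \<le> \<theta>" "\<theta> < pi" using r by (auto simp: \<theta>_def)
  obtain D where D: "\<And>\<tau>. norm (MP_fourier \<nu> 0 \<tau>) \<le> D * exp (- \<theta> * \<bar>\<tau>\<bar>)"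
    using norm_MP_fourier_zero_le[OF \<nu> \<theta>(2,3)] by blast
  obtain C where C: "C \<ge> 0" "\<And>\<tau>. norm (f (\<i> * of_real \<tau>)) \<le> C * exp (r * \<bar>\<tau>\<bar>)"
    using axis_bound by blast
  have w: "w t = 2 powr \<nu> / (2 * pi) * norm (MP_fourier \<nu> 0 t)" for t
    using Gamma_real_pos[OF \<nu>] by (simp add: w_def MP_fourier_zero[OF \<nu>] norm_divide norm_power)
  have [measurable]: "w \<in> borel_measurable borel" unfolding w by measurable
  have [measurable]: "(\<lambda>\<tau> :: real. f (\<i> * of_real \<tau>)) \<in> borel_measurable borel"
    using axis_continuous by (rule borel_measurable_continuous_onI)
  have M: "MP_measure \<nu> = density lborel (\<lambda>t. ennreal (w t))" by (simp add: MP_measure_def w_def)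
  have "integrable lborel (\<lambda>t. w t *\<^sub>R (norm (f (\<i> * of_real t)))\<^sup>2)"
  proof (rule integrable_lborel_dominated)
    show "\<theta> - 2 * r > 0" using \<theta> by simp
    fix t
    have "(norm (f (\<i> * of_real t)))\<^sup>2 \<le> (C * exp (r * \<bar>t\<bar>))\<^sup>2" by (intro power_mono C) auto
    also have "\<dots> = C\<^sup>2 * exp (2 * r * \<bar>t\<bar>)"
      by (simp add: power_mult_distrib flip: exp_double)
    finally have "norm (MP_fourier \<nu> 0 t) * (norm (f (\<i> * of_real t)))\<^sup>2 \<le>
        (D * exp (- \<theta> * \<bar>t\<bar>)) * (C\<^sup>2 * exp (2 * r * \<bar>t\<bar>))"
      using D[of t] by (intro mult_mono) (auto intro: order_trans[OF norm_ge_zero])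
    also have "\<dots> = (D * C\<^sup>2) * exp (- (\<theta> - 2 * r) * \<bar>t\<bar>)"
      by (simp add: algebra_simps flip: exp_add)
    finally have "2 powr \<nu> / (2 * pi) * (norm (MP_fourier \<nu> 0 t) * (norm (f (\<i> * of_real t)))\<^sup>2) \<le>
       2 powr \<nu> / (2 * pi) * ((D * C\<^sup>2) * exp (- (\<theta> - 2 * r) * \<bar>t\<bar>))"
      by (intro mult_left_mono) auto
    then show "norm (w t *\<^sub>R (norm (f (\<i> * of_real t)))\<^sup>2) \<le>
        (2 powr \<nu> / (2 * pi) * (D * C\<^sup>2)) * exp (- (\<theta> - 2 * r) * \<bar>t\<bar>)"
      by (simp add: w abs_mult)
  qed measurable
  then show ?thesis
    unfolding MP_L2_def M by (subst integrable_density) (auto simp: w)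
qed

section \<open>Expansion on the imaginary axis\<close>

text \<open>Its Fourier transform is \<open>2 \<pi> \<Sum>\<^sub>n a\<^sub>n ((\<nu>)\<^sub>n / n!) g\<^sub>n\<close> with \<open>g\<^sub>n = MP_kernel_real \<nu> n\<close>; inverting
  this term by term gives the expansion on the imaginary axis.\<close>

definition axis_integrand :: "real \<Rightarrow> complex" where
  "axis_integrand \<tau> = f (\<i> * of_real \<tau>) * MP_fourier \<nu> 0 \<tau>"

lemma axis_integrand_le:
  obtains C c where "c > 0" "C \<ge> 0"
    "\<And>n \<tau>. norm (f (\<i> * of_real \<tau>) * MP_fourier \<nu> n \<tau>) \<le> C * exp (- c * \<bar>\<tau>\<bar>)"
    "\<And>n \<tau>. norm (f (\<i> * of_real \<tau>) * MP_fourier \<nu> n (- \<tau>)) \<le> C * exp (- c * \<bar>\<tau>\<bar>)"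
proof -
  define \<theta> where "\<theta> = (r + pi / 2) / 2"
  have \<theta>: "r < \<theta>" "0 \<le> \<theta>" "\<theta> < pi / 2" using r by (auto simp: \<theta>_def)
  obtain D where D: "D \<ge> 0" "\<And>n \<tau>. norm (MP_fourier \<nu> n \<tau>) \<le> D * exp (- \<theta> * \<bar>\<tau>\<bar>)"
    using norm_MP_fourier_le[OF \<nu> \<theta>(2,3)] by blast
  obtain C where C: "C \<ge> 0" "\<And>\<tau>. norm (f (\<i> * of_real \<tau>)) \<le> C * exp (r * \<bar>\<tau>\<bar>)"
    using axis_bound by blast
  have "norm (f (\<i> * of_real \<tau>) * MP_fourier \<nu> n \<tau>') \<le> (C * D) * exp (- (\<theta> - r) * \<bar>\<tau>\<bar>)"
    if "\<bar>\<tau>'\<bar> = \<bar>\<tau>\<bar>" for n \<tau> \<tau>'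
  proof -
    have "norm (f (\<i> * of_real \<tau>) * MP_fourier \<nu> n \<tau>') \<le> (C * exp (r * \<bar>\<tau>\<bar>)) * (D * exp (- \<theta> * \<bar>\<tau>\<bar>))"
      unfolding norm_mult using C(1) D(2)[of n \<tau>'] that by (intro mult_mono C) auto
    also have "\<dots> = (C * D) * exp (- (\<theta> - r) * \<bar>\<tau>\<bar>)" by (simp add: algebra_simps flip: exp_add)
    finally show ?thesis .
  qed
  then show ?thesis using that[of "\<theta> - r" "C * D"] \<theta> C(1) D(1) by simp
qed

text \<open>\<open>MP_fourier_sums\<close> at \<open>- \<tau>\<close>, multiplied by
  \<open>f (\<i> * of_real \<tau>)\<close> and integrated over \<open>\<tau>\<close>. Since
  \<open>MP_fourier \<nu> n (- \<tau>)\<close> is the conjugate of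
  \<open>MP_fourier \<nu> n \<tau>\<close>, the terms become the coefficients by
  \<open>MP_coeff_eq\<close>.\<close>

lemma axis_transform_sums:
  "(\<lambda>n. of_real (MP_weight \<nu> n * MP_kernel_real \<nu> n y) * MP_coeff \<nu> f n) sums
     (of_real (1 / (2 * pi)) * (\<integral>\<tau>. axis_integrand \<tau> * iexp (- (\<tau> * y)) \<partial>lborel))"
proof -
  obtain C c where Cc: "c > 0" "C \<ge> 0"
    "\<And>n \<tau>. norm (f (\<i> * of_real \<tau>) * MP_fourier \<nu> n (- \<tau>)) \<le> C * exp (- c * \<bar>\<tau>\<bar>)"
    using axis_integrand_le by metis
  define F where "F = (\<lambda>n \<tau>. of_real (MP_weight \<nu> n * MP_kernel_real \<nu> n y) * (f (\<i> * of_real \<tau>) * MP_fourier \<nu> n (- \<tau>)))"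
  let ?t = "\<bar>tanh (y / 2)\<bar>"
  let ?q = "\<lambda>n. MP_kernel_real \<nu> 0 y * (MP_weight \<nu> n * ?t ^ n)"
  have t: "?t < 1" using tanh_real_bounds[of "y / 2"] by auto
  have [measurable]: "(\<lambda>\<tau> :: real. f (\<i> * of_real \<tau>)) \<in> borel_measurable borel"
    using axis_continuous by (rule borel_measurable_continuous_onI)
  have nF: "norm (F n \<tau>) \<le> (C * exp (- c * \<bar>\<tau>\<bar>)) * (?q n)" for n \<tau>
  proof -
    have "norm (complex_of_real (MP_weight \<nu> n * MP_kernel_real \<nu> n y)) = ?q n"
      unfolding MP_kernel_real_eq[of \<nu> n] norm_of_real
      using MP_kernel_real_zero_pos[of \<nu> y] MP_weight_nonneg[OF \<nu>, of n] by (simp add: abs_mult power_abs)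
    then have "norm (F n \<tau>) = (?q n) * norm (f (\<i> * of_real \<tau>) * MP_fourier \<nu> n (- \<tau>))"
      unfolding F_def by (metis norm_mult)
    also have "\<dots> \<le> (?q n) * (C * exp (- c * \<bar>\<tau>\<bar>))"
      using MP_kernel_real_zero_pos[of \<nu> y] MP_weight_nonneg[OF \<nu>, of n] by (intro mult_left_mono Cc) auto
    finally show ?thesis by (simp only: mult_ac)
  qed
  have "F n \<in> borel_measurable lborel" for n unfolding F_def by measurable
  moreover have "summable (\<lambda>n. ?q n)"
    using t by (intro summable_mult MP_weight_summable[OF \<nu>]) auto
  moreover have "integrable lborel (\<lambda>\<tau>. C * exp (- c * \<bar>\<tau>\<bar>))"
    using integrable_lborel_exp_abs[OF Cc(1)] by simp
  ultimately have "(\<lambda>n. integral\<^sup>L lborel (F n)) sums (\<integral>\<tau>. (\<Sum>n. F n \<tau>) \<partial>lborel)"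
    using nF by (intro sums_integral_dominated(1))
  moreover have "(\<Sum>n. F n \<tau>) = of_real (2 powr (- \<nu>)) * (axis_integrand \<tau> * iexp (- (\<tau> * y)))" for \<tau>
  proof -
    have "(\<lambda>n. f (\<i> * of_real \<tau>) * (of_real (MP_weight \<nu> n * MP_kernel_real \<nu> n y) * MP_fourier \<nu> n (- \<tau>))) sums
        (f (\<i> * of_real \<tau>) * (of_real (2 powr (- \<nu>)) * iexp ((- \<tau>) * y) * MP_fourier \<nu> 0 (- \<tau>)))"
      by (intro sums_mult MP_fourier_sums \<nu>)
    then have "(\<lambda>n. F n \<tau>) sums (f (\<i> * of_real \<tau>) * (of_real (2 powr (- \<nu>)) * iexp ((- \<tau>) * y) * MP_fourier \<nu> 0 (- \<tau>)))"
      by (simp only: F_def mult_ac)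
    then show ?thesis by (simp add: sums_iff axis_integrand_def MP_fourier_zero_minus[OF \<nu>] mult_ac)
  qed
  ultimately have S: "(\<lambda>n. of_real (2 powr \<nu> / (2 * pi)) * integral\<^sup>L lborel (F n)) sums
     (of_real (2 powr \<nu> / (2 * pi)) * (of_real (2 powr (- \<nu>)) * (\<integral>\<tau>. axis_integrand \<tau> * iexp (- (\<tau> * y)) \<partial>lborel)))"
    by (intro sums_mult) (simp only: integral_mult_right_zero)
  have a: "of_real (2 powr \<nu> / (2 * pi)) * integral\<^sup>L lborel (F n) =
      of_real (MP_weight \<nu> n * MP_kernel_real \<nu> n y) * MP_coeff \<nu> f n" for n
    unfolding MP_coeff_eq[OF \<nu> axis_continuous] F_def cnj_MP_fourier_minus integral_mult_right_zero
    by (simp only: mult_ac)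
  have "2 powr \<nu> / (2 * pi) * 2 powr (- \<nu>) = 1 / (2 * pi)" by (simp add: powr_minus)
  then have b: "of_real (2 powr \<nu> / (2 * pi)) * (of_real (2 powr (- \<nu>)) * x) = of_real (1 / (2 * pi)) * x" for x :: complex
    by (metis mult.assoc of_real_mult)
  show ?thesis using S unfolding a b .
qed

lemma expansion_on_axis: "(\<lambda>n. MP_coeff \<nu> f n * MP_poly \<nu> n (\<i> * of_real t)) sums f (\<i> * of_real t)"
proof -
  let ?N = "\<lambda>n. real (n + 1)"
  define \<sigma> where "\<sigma> = m / 2"
  \<comment> \<open>The bound by \<open>\<sigma> / 4\<close> makes the majorant \<open>q\<close>
    summable; the bound by \<open>\<nu> / 4\<close> makes \<open>MP_kernel_real_le\<close>
    applicable.\<close>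
  define \<epsilon> where "\<epsilon> = min (\<sigma> / 4) (\<nu> / 4)"
  have \<sigma>: "0 < \<sigma>" "\<sigma> < m" and \<epsilon>: "0 < \<epsilon>" "\<epsilon> < \<sigma>" "\<epsilon> < \<nu> / 2" "2 * \<epsilon> < \<sigma>"
    using m \<nu> by (auto simp: \<sigma>_def \<epsilon>_def min_def)
  obtain Ca where Ca: "Ca \<ge> 0" "\<And>n. norm (MP_coeff \<nu> f n) \<le> Ca * ?N n powr (- (\<nu> / 2 + \<sigma> - \<epsilon>))"
    using coeff_bound[OF \<sigma> \<epsilon>(1,2)] by blast
  obtain Ch where Ch: "Ch \<ge> 0" "\<And>n. \<bar>MP_weight \<nu> n\<bar> \<le> Ch * ?N n powr (\<nu> - 1)"
    using MP_weight_le[of \<nu>] by blast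
  obtain Ck where Ck: "Ck \<ge> 0" "\<And>n y. \<bar>MP_kernel_real \<nu> n y\<bar> \<le> Ck * ?N n powr (- (\<nu> / 2 - \<epsilon>)) * exp (- \<epsilon> * \<bar>y\<bar>)"
    using MP_kernel_real_le[OF \<nu> \<epsilon>(1,3)] by blast
  define F where "F = (\<lambda>n y. iexp (t * y) * (of_real (MP_weight \<nu> n * MP_kernel_real \<nu> n y) * MP_coeff \<nu> f n))"
  \<comment> \<open>The exponents of weight, kernel and coefficient add up: \<open>(\<nu> - 1) -
    (\<nu> / 2 - \<epsilon>) - (\<nu> / 2 + \<sigma> - \<epsilon>) = - 1 - (\<sigma> - 2 *
    \<epsilon>)\<close>.\<close>
  define q where "q = (\<lambda>n. Ch * Ck * Ca * ?N n powr (- 1 - (\<sigma> - 2 * \<epsilon>)))"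
  have nF: "norm (F n y) \<le> exp (- \<epsilon> * \<bar>y\<bar>) * q n" for n y
  proof -
    have "norm (F n y) = \<bar>MP_weight \<nu> n\<bar> * \<bar>MP_kernel_real \<nu> n y\<bar> * norm (MP_coeff \<nu> f n)"
      by (simp add: F_def norm_mult abs_mult)
    also have "\<dots> \<le> (Ch * ?N n powr (\<nu> - 1)) * (Ck * ?N n powr (- (\<nu> / 2 - \<epsilon>)) * exp (- \<epsilon> * \<bar>y\<bar>)) *
        (Ca * ?N n powr (- (\<nu> / 2 + \<sigma> - \<epsilon>)))"
      using Ca Ch Ck by (intro mult_mono) (auto intro!: mult_nonneg_nonneg)
    also have "\<dots> = exp (- \<epsilon> * \<bar>y\<bar>) * (Ch * Ck * Ca * (?N n powr (\<nu> - 1) * ?N n powr (- (\<nu> / 2 - \<epsilon>)) *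
        ?N n powr (- (\<nu> / 2 + \<sigma> - \<epsilon>))))"
      by (simp only: mult_ac)
    also have "?N n powr (\<nu> - 1) * ?N n powr (- (\<nu> / 2 - \<epsilon>)) *
        ?N n powr (- (\<nu> / 2 + \<sigma> - \<epsilon>)) = ?N n powr (- 1 - (\<sigma> - 2 * \<epsilon>))"
      unfolding powr_add[symmetric] by (rule arg_cong[of _ _ "(powr) _"]) (simp add: field_simps)
    finally show ?thesis by (simp add: q_def)
  qed
  have sq: "summable q"
    unfolding q_def using \<epsilon> by (intro summable_mult summable_Suc_powr) auto
  have Feq: "F n = (\<lambda>y. MP_coeff \<nu> f n * of_real (MP_weight \<nu> n) * (iexp (t * y) * MP_kernel \<nu> n (of_real y)))" for n
    by (simp add: F_def MP_kernel_eq_real fun_eq_iff)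
  then have "F n \<in> borel_measurable lborel" for n by simp
  note FS = sums_integral_dominated[OF integrable_lborel_exp_abs[OF \<epsilon>(1)] this nF sq]
  define h where "h = (\<lambda>y. \<integral>\<tau>. axis_integrand \<tau> * iexp (- (\<tau> * y)) \<partial>lborel)"
  let ?z = "\<lambda>y. of_real (1 / (2 * pi)) * (iexp (t * y) * h y)"
  have sF: "(\<Sum>n. F n y) = ?z y" for y
    unfolding F_def h_def using sums_mult[OF axis_transform_sums[of y], of "iexp (t * y)"]
    by (simp add: sums_iff mult_ac)
  from FS(2) have i: "integrable lborel (\<lambda>y. ?z y)" by (simp only: sF)
  \<comment> \<open>The integrability of the transform that \<open>fourier_inversion\<close> demands
    is a by-product of the majorant for the series.\<close>
  have ih: "integrable lborel h"
  proof -
    have [measurable]: "(\<lambda>y. ?z y) \<in> borel_measurable lborel"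
      using i by (rule borel_measurable_integrable)
    have "integrable lborel (\<lambda>y. iexp (- (t * y)) * (?z y))"
    proof (rule Bochner_Integration.integrable_bound[OF i])
      show "(\<lambda>y. iexp (- (t * y)) * (?z y)) \<in> borel_measurable lborel"
        by measurable
    qed (intro AE_I2, simp only: norm_mult norm_exp_i_times mult_1_left order_refl)
    then have "integrable lborel (\<lambda>y. of_real (2 * pi) * (iexp (- (t * y)) * (?z y)))"
      by (rule integrable_mult_right)
    moreover have "of_real (2 * pi) * (iexp (- (t * y)) * (?z y)) = h y" for y
      by (simp add: exp_minus)
    ultimately show ?thesis by (simp only:)
  qed
  obtain C c where Cc: "c > 0" "C \<ge> 0"
    "\<And>n \<tau>. norm (f (\<i> * of_real \<tau>) * MP_fourier \<nu> n \<tau>) \<le> C * exp (- c * \<bar>\<tau>\<bar>)"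
    using axis_integrand_le by metis
  have ca: "continuous_on UNIV axis_integrand"
    unfolding axis_integrand_def [abs_def]
    by (intro continuous_intros axis_continuous continuous_MP_fourier_zero \<nu>)
  have "(\<integral>y. iexp (t * y) * h y \<partial>lborel) = 2 * pi * axis_integrand t"
    unfolding h_def
  proof (rule fourier_inversion[OF ca, of C])
    show "integrable lborel axis_integrand"
      using Cc(3)[of _ 0] by (intro integrable_lborel_dominated[OF Cc(1) borel_measurable_continuous_onI[OF ca], of C])
        (simp add: axis_integrand_def)
    show "norm (axis_integrand \<tau>) \<le> C" for \<tau>
    proof -
      have "norm (axis_integrand \<tau>) \<le> C * exp (- c * \<bar>\<tau>\<bar>)" using Cc(3)[of \<tau> 0] by (simp add: axis_integrand_def)
      also have "\<dots> \<le> C * 1" using Cc(1,2) by (intro mult_left_mono) auto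
      finally show ?thesis by simp
    qed
    show "integrable lborel (\<lambda>y. \<integral>\<tau>. axis_integrand \<tau> * iexp (- (\<tau> * y)) \<partial>lborel)"
      using ih by (simp add: h_def)
  qed
  then have "(\<integral>y. (\<Sum>n. F n y) \<partial>lborel) = axis_integrand t"
    unfolding sF by simp
  moreover have "integral\<^sup>L lborel (F n) = MP_fourier \<nu> 0 t * (MP_coeff \<nu> f n * MP_poly \<nu> n (\<i> * of_real t))" for n
  proof -
    have "integral\<^sup>L lborel (F n) = MP_coeff \<nu> f n * (of_real (MP_weight \<nu> n) * MP_fourier \<nu> n t)"
      unfolding Feq integral_mult_right_zero MP_fourier_def by (simp only: mult_ac)
    then show ?thesis unfolding MP_weight_def MP_fourier_MP_poly[OF \<nu>] by (simp only: mult_ac)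
  qed
  ultimately have "(\<lambda>n. MP_fourier \<nu> 0 t * (MP_coeff \<nu> f n * MP_poly \<nu> n (\<i> * of_real t))) sums (MP_fourier \<nu> 0 t * f (\<i> * of_real t))"
    using FS(1) by (simp add: axis_integrand_def mult.commute)
  then show ?thesis
    using MP_fourier_zero_ne_0[OF \<nu>, of t] by (simp add: sums_mult_iff)
qed

section \<open>Uniform convergence and continuation to the strip\<close>

lemma expansion_uniform_limit:
  assumes K: "compact K" "K \<subseteq> {z. \<bar>Re z\<bar> < m}"
  shows "uniform_limit K (\<lambda>N s. \<Sum>n<N. MP_coeff \<nu> f n * MP_poly \<nu> n s)
    (\<lambda>s. \<Sum>n. MP_coeff \<nu> f n * MP_poly \<nu> n s) sequentially"
proof (cases "K = {}")
  case False
  let ?N = "\<lambda>n. real (n + 1)"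
  have "\<exists>z\<in>K. \<forall>w\<in>K. \<bar>Re w\<bar> \<le> \<bar>Re z\<bar>"
    using K(1) False by (intro continuous_attains_sup continuous_intros)
  then obtain z where z: "z \<in> K" "\<And>w. w \<in> K \<Longrightarrow> \<bar>Re w\<bar> \<le> \<bar>Re z\<bar>" by blast
  define \<rho> where "\<rho> = \<bar>Re z\<bar>"
  \<comment> \<open>Compactness makes \<open>\<rho>\<close> strictly less than \<open>m\<close>, so
    there is room for \<open>\<sigma>\<close> in between. The exponents of coefficient and
    polynomial add up to \<open>- 1 - (\<sigma> - \<rho> - 2 * \<epsilon>)\<close>, which is below
    \<open>- 1\<close> for the \<open>\<epsilon>\<close> chosen next.\<close>
  define \<sigma> where "\<sigma> = (\<rho> + m) / 2"
  define \<epsilon> where "\<epsilon> = (\<sigma> - \<rho>) / 4"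
  have "0 \<le> \<rho>" "\<rho> < m" using z(1) K(2) by (auto simp: \<rho>_def)
  then have \<sigma>: "0 < \<sigma>" "\<sigma> < m" and \<epsilon>: "0 < \<epsilon>" "\<epsilon> < \<sigma>" "2 * \<epsilon> < \<sigma> - \<rho>" by (auto simp: \<sigma>_def \<epsilon>_def)
  obtain M where M: "\<And>w. w \<in> K \<Longrightarrow> norm w \<le> M"
    using compact_imp_bounded[OF K(1)] by (auto simp: bounded_iff)
  obtain Ca where Ca: "Ca \<ge> 0" "\<And>n. norm (MP_coeff \<nu> f n) \<le> Ca * ?N n powr (- (\<nu> / 2 + \<sigma> - \<epsilon>))"
    using coeff_bound[OF \<sigma> \<epsilon>(1,2)] by blast
  obtain Cp where Cp: "Cp \<ge> 0" "\<And>n s. norm s \<le> M \<Longrightarrow>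
      norm (MP_poly \<nu> n s) \<le> Cp * ?N n powr (\<nu> / 2 + \<bar>Re s\<bar> - 1 + \<epsilon>)"
    using norm_MP_poly_le[OF \<epsilon>(1) \<nu>] by blast
  show ?thesis
  proof (rule Weierstrass_m_test)
    fix n s assume s: "s \<in> K"
    have "norm (MP_poly \<nu> n s) \<le> Cp * ?N n powr (\<nu> / 2 + \<bar>Re s\<bar> - 1 + \<epsilon>)" using M[OF s] by (rule Cp)
    also have "\<dots> \<le> Cp * ?N n powr (\<nu> / 2 + \<rho> - 1 + \<epsilon>)"
      using z(2)[OF s] Cp(1) by (intro mult_left_mono powr_mono) (auto simp: \<rho>_def)
    finally have "norm (MP_coeff \<nu> f n * MP_poly \<nu> n s) \<le>
      (Ca * ?N n powr (- (\<nu> / 2 + \<sigma> - \<epsilon>))) * (Cp * ?N n powr (\<nu> / 2 + \<rho> - 1 + \<epsilon>))"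
      unfolding norm_mult using Ca by (intro mult_mono) auto
    also have "\<dots> = Ca * Cp * (?N n powr (- (\<nu> / 2 + \<sigma> - \<epsilon>)) * ?N n powr (\<nu> / 2 + \<rho> - 1 + \<epsilon>))"
      by (simp only: mult_ac)
    also have "?N n powr (- (\<nu> / 2 + \<sigma> - \<epsilon>)) * ?N n powr (\<nu> / 2 + \<rho> - 1 + \<epsilon>) =
        ?N n powr (- 1 - (\<sigma> - \<rho> - 2 * \<epsilon>))"
      unfolding powr_add[symmetric] by (rule arg_cong[of _ _ "(powr) _"]) (simp add: field_simps)
    finally show "norm (MP_coeff \<nu> f n * MP_poly \<nu> n s) \<le> Ca * Cp * ?N n powr (- 1 - (\<sigma> - \<rho> - 2 * \<epsilon>))" .
  next
    show "summable (\<lambda>n. Ca * Cp * ?N n powr (- 1 - (\<sigma> - \<rho> - 2 * \<epsilon>)))"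
      using \<epsilon> by (intro summable_mult summable_Suc_powr) auto
  qed
qed (simp add: uniform_limit_iff)

lemma expansion_sum_eq:
  assumes "\<bar>Re s\<bar> < m"
  shows "(\<Sum>n. MP_coeff \<nu> f n * MP_poly \<nu> n s) = f s"
proof -
  let ?U = "{z. \<bar>Re z\<bar> < m}"
  let ?S = "\<lambda>s. \<Sum>n. MP_coeff \<nu> f n * MP_poly \<nu> n s"
  have op: "open ?U" by (intro open_Collect_less continuous_intros)
  have "?U = {z. Re z < m} \<inter> {z. Re z > - m}" by auto
  then have "convex ?U" by (simp add: convex_Int convex_halfspace_Re_lt convex_halfspace_Re_gt)
  then have conn: "connected ?U" by (rule convex_connected)
  have "?S holomorphic_on ?U"
  proof (rule holomorphic_uniform_sequence[OF op])
    show "(\<lambda>s. \<Sum>n<N. MP_coeff \<nu> f n * MP_poly \<nu> n s) holomorphic_on ?U" for N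
      by (intro holomorphic_intros)
    fix z assume "z \<in> ?U"
    then obtain d where "d > 0" "cball z d \<subseteq> ?U" using op open_contains_cball by blast
    then show "\<exists>d>0. cball z d \<subseteq> ?U \<and>
        uniform_limit (cball z d) (\<lambda>N s. \<Sum>n<N. MP_coeff \<nu> f n * MP_poly \<nu> n s) ?S sequentially"
      using expansion_uniform_limit[OF compact_cball] by blast
  qed
  then have "(\<lambda>s. ?S s - f s) holomorphic_on ?U" using f_hol by (intro holomorphic_intros)
  then have "?S s - f s = 0"
  proof (rule analytic_continuation[OF _ op conn])
    show "{z. Re z = 0} \<subseteq> ?U" using m by auto
    show "0 \<in> ?U" using m by simp
    show "0 islimpt {z. Re z = 0}"
      unfolding islimpt_approachable
    proof (intro allI impI)
      fix e :: real assume "e > 0"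
      then show "\<exists>x'\<in>{z. Re z = 0}. x' \<noteq> 0 \<and> dist x' 0 < e"
        by (intro bexI[of _ "\<i> * of_real (e / 2)"]) (auto simp: norm_mult)
    qed
    show "?S z - f z = 0" if "z \<in> {z. Re z = 0}" for z
    proof -
      have "z = \<i> * of_real (Im z)" using that by (simp add: complex_eq_iff)
      then show ?thesis using expansion_on_axis[of "Im z"] by (metis sums_unique right_minus_eq)
    qed
    show "s \<in> ?U" using assms by simp
  qed
  then show ?thesis by simp
qed

theorem MP_expansion_uniform_limit:
  assumes "compact K" "K \<subseteq> {t. \<bar>Im t\<bar> < m}"
  shows "uniform_limit K (\<lambda>N t. \<Sum>n<N. MP_coeff \<nu> f n * MP_poly \<nu> n (\<i> * t)) (\<lambda>t. f (\<i> * t)) sequentially"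
proof -
  have "compact ((\<lambda>t. \<i> * t) ` K)" using assms(1) by (intro compact_continuous_image continuous_intros)
  moreover have "(\<lambda>t. \<i> * t) ` K \<subseteq> {z. \<bar>Re z\<bar> < m}" using assms(2) by auto
  ultimately have "uniform_limit ((\<lambda>t. \<i> * t) ` K) (\<lambda>N s. \<Sum>n<N. MP_coeff \<nu> f n * MP_poly \<nu> n s)
    (\<lambda>s. \<Sum>n. MP_coeff \<nu> f n * MP_poly \<nu> n s) sequentially"
    by (rule expansion_uniform_limit)
  then have "uniform_limit K (\<lambda>N t. \<Sum>n<N. MP_coeff \<nu> f n * MP_poly \<nu> n (\<i> * t))
    (\<lambda>t. \<Sum>n. MP_coeff \<nu> f n * MP_poly \<nu> n (\<i> * t)) sequentially"
    by (rule uniform_limit_compose') auto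
  moreover have "(\<Sum>n. MP_coeff \<nu> f n * MP_poly \<nu> n (\<i> * t)) = f (\<i> * t)" if "t \<in> K" for t
    using assms(2) that by (intro expansion_sum_eq) auto
  ultimately show ?thesis by (simp cong: uniform_limit_cong')
qed

end

section \<open>Reduction to a pole-free strip\<close>

lemma strip_growth_bound:
  fixes f :: "complex \<Rightarrow> complex" and \<sigma> m r :: real and D :: "complex set"
  assumes \<sigma>: "0 < \<sigma>" "\<sigma> < m" and D: "{z. \<bar>Re z\<bar> < m} \<subseteq> D"
    and cont: "continuous_on {z. \<bar>Re z\<bar> < m} f"
    and growth: "f \<in> O[inf at_infinity (principal D)](\<lambda>s. of_real (exp (r * norm s)))"
  shows "\<exists>C. \<forall>x \<tau>. \<bar>x\<bar> \<le> \<sigma> \<longrightarrow> norm (f (of_real x + \<i> * of_real \<tau>)) \<le> C * exp (max r 0 * \<bar>\<tau>\<bar>)"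
proof -
  \<comment> \<open>The given \<open>r\<close> may be negative, and then the upper bound
    \<open>norm s \<le> \<sigma> + |\<tau>|\<close> would not bound \<open>exp (r * norm s)\<close>
    from above.\<close>
  define r' where "r' = max r 0"
  obtain c where c: "c > 0"
    "eventually (\<lambda>s. norm (f s) \<le> c * norm (complex_of_real (exp (r * norm s)))) (inf at_infinity (principal D))"
    using growth by (elim landau_o.bigE)
  then obtain R where R: "\<And>s. R \<le> norm s \<Longrightarrow> s \<in> D \<Longrightarrow> norm (f s) \<le> c * exp (r * norm s)"
    unfolding eventually_inf_principal eventually_at_infinity by auto
  \<comment> \<open>The growth condition is silent about bounded sets; the remaining part of the
    closed substrip is compact, so continuity bounds \<open>f\<close> there.\<close>
  let ?K = "{z. \<bar>Re z\<bar> \<le> \<sigma>} \<inter> cball 0 R"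
  have "compact ?K"
    by (intro closed_Int_compact closed_Collect_le continuous_intros compact_cball)
  moreover have "continuous_on ?K f" using \<sigma> by (intro continuous_on_subset[OF cont]) auto
  ultimately have "bounded (f ` ?K)" by (intro compact_imp_bounded compact_continuous_image)
  then obtain B where "\<forall>z\<in>?K. norm (f z) \<le> B" unfolding bounded_iff by blast
  then have B: "norm (f z) \<le> B" if "z \<in> ?K" for z using that by blast
  have "norm (f (of_real x + \<i> * of_real \<tau>)) \<le> max B (c * exp (r' * \<sigma>)) * exp (r' * \<bar>\<tau>\<bar>)"
    if x: "\<bar>x\<bar> \<le> \<sigma>" for x \<tau>
  proof (cases "R \<le> norm (of_real x + \<i> * of_real \<tau>)")
    case True
    let ?s = "of_real x + \<i> * of_real \<tau> :: complex"
    have "norm ?s \<le> \<bar>x\<bar> + \<bar>\<tau>\<bar>" using norm_triangle_ineq[of "of_real x" "\<i> * of_real \<tau>"] by (simp add: norm_mult)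
    then have "r * norm ?s \<le> r' * (\<sigma> + \<bar>\<tau>\<bar>)"
      using x by (intro mult_mono) (auto simp: r'_def)
    have "norm (f ?s) \<le> c * exp (r * norm ?s)"
      using True x \<sigma> D by (intro R) auto
    also have "\<dots> \<le> c * exp (r' * (\<sigma> + \<bar>\<tau>\<bar>))"
      using c(1) \<open>r * norm ?s \<le> _\<close> by simp
    also have "\<dots> = c * exp (r' * \<sigma>) * exp (r' * \<bar>\<tau>\<bar>)" by (simp add: algebra_simps exp_add)
    also have "\<dots> \<le> max B (c * exp (r' * \<sigma>)) * exp (r' * \<bar>\<tau>\<bar>)" by (intro mult_right_mono) auto
    finally show ?thesis .
  next
    case False
    then have "norm (f (of_real x + \<i> * of_real \<tau>)) \<le> B" using x by (intro B) auto
    also have "\<dots> \<le> max B (c * exp (r' * \<sigma>)) * 1" by simp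
    also have "\<dots> \<le> max B (c * exp (r' * \<sigma>)) * exp (r' * \<bar>\<tau>\<bar>)"
    proof (rule mult_left_mono)
      show "0 \<le> max B (c * exp (r' * \<sigma>))" using c(1) by (simp add: le_max_iff_disj)
    qed (simp add: r'_def)
    finally show ?thesis .
  qed
  then show ?thesis unfolding r'_def by blast
qed

theorem theorem2p3:
  fixes \<nu> \<alpha> \<beta> \<delta> r :: real
    and s_minus s_plus :: complex
    and f :: "complex \<Rightarrow> complex"
    and D :: "complex set"
  assumes "\<nu> > 0"
    and "\<alpha> + 2 < Re s_minus" "Re s_minus < 0" "0 < Re s_plus" "Re s_plus < \<beta> - 2"
    and "\<delta> > 0"
    and "D = {s. Re s \<in> {\<alpha> - \<delta><..<\<beta> + \<delta>}}"
    and "f nicely_meromorphic_on D"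
    and "r < pi / 2"
    and "f \<in> O[inf at_infinity (principal D)](\<lambda>s. of_real (exp (r * norm s)))"
    and "card {s \<in> D. is_pole f s} \<in> {1, 2}"
    and "{s \<in> D. is_pole f s} \<subseteq> {s_minus, s_plus}"
    and "\<forall>s\<in>D. is_pole f s \<longrightarrow> zorder f s = -1"
  shows "MP_L2 \<nu> (\<lambda>t. f (\<i> * of_real t)) \<and>
    (\<forall>K. compact K \<and> K \<subseteq> {t :: complex. \<bar>Im t\<bar> < min \<bar>Re s_plus\<bar> \<bar>Re s_minus\<bar>} \<longrightarrow>
       uniform_limit K
         (\<lambda>N t. \<Sum>n<N. MP_coeff \<nu> f n * MP_poly \<nu> n (\<i> * t))
         (\<lambda>t. f (\<i> * t)) sequentially)"
proof -
  define m where "m = min \<bar>Re s_plus\<bar> \<bar>Re s_minus\<bar>"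
  have m: "m > 0" using assms(3,4) by (simp add: m_def)
  have sub: "{z. \<bar>Re z\<bar> < m} \<subseteq> D"
    using assms(2-6) unfolding assms(7) m_def by auto
  \<comment> \<open>A nicely meromorphic function has the right value at removable singularities, so
    at a point that is not a pole it is analytic. The poles have absolute real part at least
    \<open>m\<close>.\<close>
  have an: "f analytic_on {z}" if z: "\<bar>Re z\<bar> < m" for z
  proof (rule nicely_meromorphic_on_imp_analytic_at[OF assms(8)])
    show "z \<in> D" using sub z by auto
    show "\<not> is_pole f z"
    proof
      assume "is_pole f z"
      with \<open>z \<in> D\<close> assms(12) have "z = s_minus \<or> z = s_plus" by auto
      then show False using z by (auto simp: m_def)
    qed
  qed
  then have hol: "f holomorphic_on {z. \<bar>Re z\<bar> < m}"
    by (intro analytic_imp_holomorphic) (auto simp: analytic_on_def)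
  note growth = strip_growth_bound[OF _ _ sub holomorphic_on_imp_continuous_on[OF hol] assms(10)]
  have r: "0 \<le> max r 0" "max r 0 < pi / 2" using assms(9) by (simp_all add: max_def)
  show ?thesis
    using square_integrable[OF assms(1) m hol growth r]
      MP_expansion_uniform_limit[OF assms(1) m hol growth r]
    unfolding m_def by blast
qed

end
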